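(* Let $n\ge3$ and let $k$ be a positive integer. Put $D_{2k}=\max_{j=0,\dots,k}\dim(H_{2j})$. All $O(\cdot)$ terms below are as $s\to\infty$ with $n$ and $k$ fixed. (1) If $h_s(t):=\dfrac{t^{2s}}{\int_S y_1^{2s}\,d\mu(y)}$ (where $y_1$ is the first coordinate of $y$), then \[\frac{1+\frac n2}{s}+O\left(\tfrac1{s^2}\right)\ \le\ \tau_{2k}(h_s)\ \le\ D_{2k}\,\frac{k^2+\frac{kn}{2}}{s}+O\left(\tfrac1{s^2}\right).\] (2) If $h_s(t)=q_s(t)^2=\sum_{j=0}^{2s}\lambda_jg_j(t)$, where $q_s(t)=\sum_{j=0}^s\eta_jg_j(t)$ is a solution of the minimization problem \[\rho^*_{2k,s}=\min_{q_s,\ \lambda_0=1}\ \sum_{j=0}^k(1-\lambda_{2j})\] (the minimum being over all real polynomials $q_s$ of degree at most $s$ such that the coefficient $\lambda_0$ of $q_s^2$ equals $1$), then \[\tau_{2k}(h_s)\le\sqrt{D_{2k}}\,k^2n^2\,O\left(\tfrac1{s^2}\right).\] In particular, in either case, given cubature rules $(X_{2t},W_{2t})$ for $\mu$ of algebraic degree $2t$ for every $t$, the harmonic hierarchy $(A_s)_{s\in\mathbb{N}}$ determined by these rules and by the sequence $(h_s)_{s\in\mathbb{N}}$ converges to $P_{2k}$ as $s\to\infty$, i.e. $P_{2k}=\overline{\bigcup_{s}A_s}$.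
   Context: $S\subseteq\mathbb{R}^n$ is the unit sphere, $\mu$ is the $(n-1)$-dimensional area measure on $S$, $R_d\subseteq\mathbb{R}[x_1,\dots,x_n]$ is the space of homogeneous polynomials of degree $d$, $H_d\subseteq R_d$ is the subspace of harmonic ones, and $P_{2k}\subseteq R_{2k}$ is the cone of forms nonnegative on $S$. With $\alpha=\frac{n-2}{2}$, the Gegenbauer polynomials are given by $C_0^{(\alpha)}(t)=1$, $C_1^{(\alpha)}(t)=2\alpha t$, $C_j^{(\alpha)}(t)=\frac1j[2t(j+\alpha-1)C_{j-1}^{(\alpha)}(t)-(j+2\alpha-2)C_{j-2}^{(\alpha)}(t)]$ for $j\ge2$, and the normalized ones are $g_j(t)=\frac{\dim(H_j)}{\mu(S)C_j^{(\alpha)}(1)}C_j^{(\alpha)}(t)$. Every univariate polynomial $h$ is written uniquely as $h=\sum_j\lambda_jg_j$ (with $\lambda_j=0$ for $j>\deg h$), and its Frobenius threshold in degree $2k$ is $\tau_{2k}(h)=\sqrt{\sum_{j=0}^{k}\dim(H_{2j})(\frac1{\lambda_{2j}}-1)^2}$, with $\tau_{2k}(h)=+\infty$ if $\lambda_{2j}=0$ for some $0\le j\le k$. A cubature rule of algebraic degree $2t$ for $\mu$ is a pair $(X,W)$ with $X\subseteq S$ finite and $W:X\to\mathbb{R}_{>0}$ such that $\int_S f\,d\mu=\sum_{x\in X}W(x)f(x)$ for every $f\in R_{2t}$. For a univariate polynomial $h(t)=\sum_ia_it^i$, define $\hat{\Gamma}_h:R_{2k}\to R_{2k}$ by $\hat{\Gamma}_h(f)(x)=\sum_ja_{2j}\|x\|^{2(k-j)}\int_S\langle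 x,y\rangle^{2j}f(y)\,d\mu(y)$ (only even-degree coefficients enter; for $j>k$ this is division by $\|x\|^{2(j-k)}$, and the quotient is a polynomial). The harmonic hierarchy in degree $2k$ determined by the cubature rules $(X_{2t},W_{2t})$ and by polynomials $h_s$ nonnegative on $[-1,1]$ is $A_s:=\hat{\Gamma}_{h_s}(Q_s)$, where $Q_s=\{F\in R_{2k}: F(x)\ge0\ \forall x\in X_{2(k+d_s)}\}$ and $d_s=\deg h_s$. *)

theory Defs
  imports
    "HOL-Analysis.Analysis"
    "HOL-Library.Function_Algebras"
    "HOL-Library.Landau_Symbols"
    "HOL-Computational_Algebra.Polynomial"
begin

section \<open>Forms and harmonic forms\<close>

text \<open>Polynomials in the coordinates are represented by the functions they induce on
  \<open>\<real>\<^sup>n\<close>, which is harmless over an infinite field.\<close>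

definition fun_scale :: "real \<Rightarrow> ('a \<Rightarrow> real) \<Rightarrow> 'a \<Rightarrow> real" where
  "fun_scale c f = (\<lambda>x. c * f x)"

global_interpretation real_fun: vector_space fun_scale
  by unfold_locales (auto simp: fun_scale_def fun_eq_iff algebra_simps)

definition forms :: "nat \<Rightarrow> (real^'n \<Rightarrow> real) set" where
  "forms d = real_fun.span {\<lambda>x. \<Prod>i\<in>UNIV. (x $ i) ^ m i | m :: 'n \<Rightarrow> nat. sum m UNIV = d}"

definition partial_deriv :: "'n \<Rightarrow> (real^'n \<Rightarrow> real) \<Rightarrow> real^'n \<Rightarrow> real" where
  "partial_deriv i f x = frechet_derivative f (at x) (axis i 1)"

definition laplacian :: "(real^'n \<Rightarrow> real) \<Rightarrow> real^'n \<Rightarrow> real" where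
  "laplacian f x = (\<Sum>i\<in>UNIV. partial_deriv i (partial_deriv i f) x)"

definition harmonic_forms :: "nat \<Rightarrow> (real^'n \<Rightarrow> real) set" where
  "harmonic_forms d = {f \<in> forms d. \<forall>x. laplacian f x = 0}"

definition dim_harmonic :: "'n::finite itself \<Rightarrow> nat \<Rightarrow> nat" where
  "dim_harmonic _ d = real_fun.dim (harmonic_forms d :: (real^'n \<Rightarrow> real) set)"

definition nonneg_forms :: "nat \<Rightarrow> (real^'n \<Rightarrow> real) set" where
  "nonneg_forms d = {f \<in> forms d. \<forall>x\<in>sphere 0 1. 0 \<le> f x}"


section \<open>Area measure on the unit sphere\<close>

text \<open>Polar-coordinates definition: the area of \<open>A \<subseteq> S\<close> is \<open>n\<close> times the Lebesgue volume of the
  solid cone \<open>{r *\<^sub>R a | 0 < r \<le> 1, a \<in> A}\<close>. Here \<open>sgn x = x /\<^sub>R norm x\<close> is the radial projection.\<close>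

definition sphere_area :: "(real^'n) measure" where
  "sphere_area = scale_measure (of_nat CARD('n))
     (distr (restrict_space lborel (cball 0 1 - {0})) (restrict_space borel (sphere 0 1)) sgn)"

lemma space_sphere_area [simp]: "space sphere_area = sphere 0 1"
  by (simp add: sphere_area_def space_scale_measure space_restrict_space)

lemma sets_sphere_area: "sets sphere_area = sets (restrict_space borel (sphere 0 1))"
  by (simp add: sphere_area_def)

lemma emeasure_sphere_area:
  assumes "A \<in> sets (sphere_area :: (real^'n) measure)"
  shows "emeasure sphere_area A =
    of_nat CARD('n) * emeasure lborel {x :: real^'n. x \<noteq> 0 \<and> norm x \<le> 1 \<and> sgn x \<in> A}"
proof -
  have B: "A \<in> sets (restrict_space borel (sphere 0 1))"
    using assms by (simp add: sphere_area_def)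
  have m: "sgn \<in> measurable (restrict_space lborel (cball 0 1 - {0::real^'n}))
      (restrict_space borel (sphere 0 1))"
    unfolding sgn_div_norm
    by (intro measurable_restrict_space2 measurable_restrict_space1)
       (auto simp: space_restrict_space)
  have eq: "sgn -` A \<inter> (cball 0 1 - {0}) = {x :: real^'n. x \<noteq> 0 \<and> norm x \<le> 1 \<and> sgn x \<in> A}"
    by auto
  have "emeasure (restrict_space lborel (cball 0 1 - {0})) {x :: real^'n. x \<noteq> 0 \<and> norm x \<le> 1 \<and> sgn x \<in> A}
      = emeasure lborel {x :: real^'n. x \<noteq> 0 \<and> norm x \<le> 1 \<and> sgn x \<in> A}"
    by (rule emeasure_restrict_space) auto
  then show ?thesis
    unfolding sphere_area_def
    by (simp add: emeasure_distr[OF m B] space_restrict_space eq)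
qed


section \<open>Gegenbauer polynomials and the Frobenius threshold\<close>

fun gegenbauer :: "real \<Rightarrow> nat \<Rightarrow> real poly" where
  "gegenbauer \<alpha> 0 = 1"
| "gegenbauer \<alpha> (Suc 0) = [:0, 2 * \<alpha>:]"
| "gegenbauer \<alpha> (Suc (Suc j)) = smult (1 / real (j + 2))
     ([:0, 2 * (real (j + 2) + \<alpha> - 1):] * gegenbauer \<alpha> (Suc j)
      - smult (real (j + 2) + 2 * \<alpha> - 2) (gegenbauer \<alpha> j))"

definition normalized_gegenbauer :: "'n::finite itself \<Rightarrow> nat \<Rightarrow> real poly" where
  "normalized_gegenbauer N j =
     (let C = gegenbauer ((real CARD('n) - 2) / 2) j
      in smult (real (dim_harmonic N j) /
           (measure (sphere_area :: (real^'n) measure) (sphere 0 1) * poly C 1)) C)"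

text \<open>The coefficients \<open>\<lambda>\<^sub>j\<close> of the unique expansion \<open>h = (\<Sum>j. \<lambda>\<^sub>j g\<^sub>j)\<close>.\<close>

definition gegenbauer_coeff :: "'n::finite itself \<Rightarrow> real poly \<Rightarrow> nat \<Rightarrow> real" where
  "gegenbauer_coeff N h = (THE l. (\<forall>j>degree h. l j = 0) \<and>
     h = (\<Sum>j\<le>degree h. smult (l j) (normalized_gegenbauer N j)))"

text \<open>\<open>frobenius_threshold N k\<close> is the threshold in degree \<open>2k\<close>.\<close>

definition frobenius_threshold :: "'n::finite itself \<Rightarrow> nat \<Rightarrow> real poly \<Rightarrow> ereal" where
  "frobenius_threshold N k h =
     (if \<exists>j\<le>k. gegenbauer_coeff N h (2 * j) = 0 then \<infinity>
      else ereal (sqrt (\<Sum>j\<le>k. real (dim_harmonic N (2 * j)) *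
             (1 / gegenbauer_coeff N h (2 * j) - 1)\<^sup>2)))"

definition max_dim_harmonic :: "'n::finite itself \<Rightarrow> nat \<Rightarrow> nat" where
  "max_dim_harmonic N k = Max ((\<lambda>j. dim_harmonic N (2 * j)) ` {0..k})"


section \<open>Cubature rules and harmonic hierarchies\<close>

text \<open>Only the values of \<open>W\<close> on \<open>X\<close> matter.\<close>

definition cubature_rule :: "nat \<Rightarrow> (real^'n) set \<Rightarrow> (real^'n \<Rightarrow> real) \<Rightarrow> bool" where
  "cubature_rule d X W \<longleftrightarrow> finite X \<and> X \<subseteq> sphere 0 1 \<and> (\<forall>x\<in>X. 0 < W x) \<and>
     (\<forall>f\<in>forms d. (LINT y|sphere_area. f y) = (\<Sum>x\<in>X. W x * f x))"

text \<open>At \<open>x = 0\<close> the terms with \<open>j > k\<close> involve \<open>inverse 0 = 0\<close>; for \<open>k \<ge> 1\<close> this gives the value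
  \<open>0\<close>, which is the value at \<open>0\<close> of the quotient form of degree \<open>2k\<close>.\<close>

definition gamma_hat ::
    "nat \<Rightarrow> real poly \<Rightarrow> (real^'n \<Rightarrow> real) \<Rightarrow> real^'n \<Rightarrow> real" where
  "gamma_hat k h f x = (\<Sum>j\<le>degree h. coeff h (2 * j) *
     norm x powi (2 * (int k - int j)) * (LINT y|sphere_area. (x \<bullet> y) ^ (2 * j) * f y))"

text \<open>\<open>X d\<close> is the node set of the rule of algebraic degree \<open>d\<close>; only even \<open>d\<close> are used.\<close>

definition harmonic_hierarchy ::
    "nat \<Rightarrow> (nat \<Rightarrow> (real^'n) set) \<Rightarrow> (nat \<Rightarrow> real poly) \<Rightarrow> nat \<Rightarrow> (real^'n \<Rightarrow> real) set" where
  "harmonic_hierarchy k X h s =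
     gamma_hat k (h s) ` {F \<in> forms (2 * k). \<forall>x\<in>X (2 * (k + degree (h s))). 0 \<le> F x}"

text \<open>The closure is taken in \<open>R\<^sub>2\<^sub>k\<close>. The type \<^typ>\<open>real^'n \<Rightarrow> real\<close> carries the topology of
  pointwise convergence, and this induces on the finite-dimensional space \<open>R\<^sub>2\<^sub>k\<close> its only
  Hausdorff vector space topology.\<close>

definition hierarchy_converges :: "nat \<Rightarrow> (nat \<Rightarrow> (real^'n \<Rightarrow> real) set) \<Rightarrow> bool" where
  "hierarchy_converges k A \<longleftrightarrow>
     nonneg_forms (2 * k) = top_of_set (forms (2 * k)) closure_of (\<Union>s. A s)"


section \<open>The two families of kernels\<close>

text \<open>\<open>i\<close> is the coordinate called the first one.\<close>

definition power_kernel :: "'n::finite \<Rightarrow> nat \<Rightarrow> real poly" where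
  "power_kernel i s =
     smult (1 / (LINT y|(sphere_area :: (real^'n) measure). (y $ i) ^ (2 * s))) (monom 1 (2 * s))"

text \<open>\<open>q\<close> is a solution of the minimization problem defining \<open>\<rho>\<^sup>*\<^bsub>2k,s\<^esub>\<close>.\<close>

definition optimal_root :: "'n::finite itself \<Rightarrow> nat \<Rightarrow> nat \<Rightarrow> real poly \<Rightarrow> bool" where
  "optimal_root N k s q \<longleftrightarrow>
     is_arg_min (\<lambda>p. \<Sum>j\<le>k. 1 - gegenbauer_coeff N (p\<^sup>2) (2 * j))
       (\<lambda>p. degree p \<le> s \<and> gegenbauer_coeff N (p\<^sup>2) 0 = 1) q"

end

(*
  The Laplacian maps forms of degree d + 2 onto forms of degree d, which gives dim H_d. Rotation
  invariance gives \<integral> (x \<bullet> y)^(2s) d\<mu>(y) = c_s (x \<bullet> x)^s; applying the Laplacian in x yields the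
  recurrence of the moments c_s, and with it closed forms for the integrals of t^m against the
  polynomials P_j = C_j / C_j(1). Hence P_0, P_1, ... are orthogonal with \<integral> P_j^2 = \<mu>(S) / dim H_j, and
  \<lambda>_j = \<integral> h P_j.

  (1) For the power kernel 1 / \<lambda>_{2j} is the product of (s + n/2 + l) / (s - l) over l < j.

  (2) Since \<bar>P_j\<bar> \<le> 1, every term 1 - \<lambda>_{2j} lies between 0 and the minimum, which the test
  polynomial \<Sum>_{j \<le> s} (1 - j/(s+1)) dim H_j P_j bounds by O(1/s^2).

  For the convergence no inverse of \<Gamma>_h is needed: P_{2k} \<subseteq> Q_s, and \<lambda>_2 \<rightarrow> 1 says that the
  kernels concentrate at \<plusminus>1, so that \<Gamma>_{h_s} f \<rightarrow> f for every f in P_{2k}.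
*)
theory Submission
  imports Defs
begin

section \<open>Forms and the dimension of the spaces of harmonic forms\<close>

text \<open>Several obstacles shape the development. Forms are functions, so a dimension count
  requires the monomials to be independent as functions. Derivatives are controlled only for
  differentiable functions, so the Laplacian is treated as linear on forms only. The area measure is
  given by volumes of cones, so its rotation invariance has to come from Lebesgue measure. Division
  by high powers of the norm has to produce a form again. The test weights 1 - j/(s+1) in (2) come
  from writing the integral of (1 - t) p^2 as a discrete Dirichlet form in the weights of p. Equal
  small steps down to 0 make it of order 1/s^2 relative to the norm of p, because dim H_j grows by a
  bounded factor when j is doubled. The inclusion of A_s in P_{2k} is where the cubature rules
  enter: for x on the sphere, \<Gamma>_h F (x) is a sum over the nodes y of W(y) F(y) times the even
  part of h at x \<bullet> y, and all these terms are nonnegative.\<close>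

lemma (in vector_space) dim_kernel_plus_dim_image:
  assumes V: "subspace V" and F: "V \<subseteq> span F" "finite F"
    and add: "\<And>x y. x \<in> V \<Longrightarrow> y \<in> V \<Longrightarrow> T (x + y) = T x + T y"
    and hom: "\<And>c x. x \<in> V \<Longrightarrow> T (scale c x) = scale c (T x)"
  shows "dim V = dim {x \<in> V. T x = 0} + dim (T ` V)"
proof -
  \<comment> \<open>Linearity of \<open>T\<close> is assumed on \<open>V\<close> only: it will be
    the Laplacian, and \<open>frechet_derivative\<close> is under control only at points of
    differentiability. Every vector fed to \<open>T\<close> is therefore kept inside
    \<open>V\<close>.\<close>
  have T_sum: "T (\<Sum>v\<in>S. scale (r v) (w v)) = (\<Sum>v\<in>S. scale (r v) (T (w v)))"
    if "finite S" "\<And>v. v \<in> S \<Longrightarrow> w v \<in> V" for S :: "'b set" and r w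
    using that
  proof (induction S)
    case empty
    have "T (scale 0 0) = scale 0 (T 0)" by (rule hom) (use V in \<open>simp add: subspace_0\<close>)
    then show ?case by simp
  next
    case (insert v S)
    have "scale (r v) (w v) \<in> V" "(\<Sum>v\<in>S. scale (r v) (w v)) \<in> V"
      using insert V by (auto intro!: subspace_sum subspace_scale)
    then show ?case using insert by (simp add: add hom)
  qed
  obtain K where K: "K \<subseteq> {x \<in> V. T x = 0}" "independent K" "{x \<in> V. T x = 0} \<subseteq> span K"
    "card K = dim {x \<in> V. T x = 0}" by (rule basis_exists)
  have finK: "finite K" using independent_span_bound[OF F(2) K(2)] K(1) F(1) by auto
  obtain B where B: "B \<subseteq> V" "independent B" "V \<subseteq> span B" by (rule basis_exists)
  have finB: "finite B" using independent_span_bound[OF F(2) B(2)] B(1) F(1) by auto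
  obtain C where C: "C \<subseteq> T ` V" "independent C" "T ` V \<subseteq> span C" "card C = dim (T ` V)"
    by (rule basis_exists)
  have "T ` V \<subseteq> span (T ` B)"
  proof clarify
    fix x assume "x \<in> V"
    then obtain r where "x = (\<Sum>v\<in>B. scale (r v) v)" using B(3) span_finite[OF finB] by auto
    then have "T x = (\<Sum>v\<in>B. scale (r v) (T v))" using T_sum[OF finB, of "\<lambda>v. v" r] B(1) by auto
    then show "T x \<in> span (T ` B)" by (simp add: span_sum span_scale span_base)
  qed
  then have finC: "finite C"
    using independent_span_bound[OF finite_imageI[OF finB, of T] C(2)] C(1) by auto
  \<comment> \<open>Lifts of the basis vectors of the image; together with a basis of the kernel
    they form a basis of \<open>V\<close>.\<close>
  obtain g where g: "\<And>c. c \<in> C \<Longrightarrow> g c \<in> V \<and> T (g c) = c"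
    using C(1) by (metis (no_types, lifting) image_iff subset_iff)
  have inj: "inj_on g C" by (rule inj_onI) (metis g)
  have C0: "0 \<notin> C" using C(2) dependent_zero by blast
  have disj: "K \<inter> g ` C = {}" using K(1) g C0 by auto
  have KV: "K \<subseteq> V" using K(1) by auto
  have "independent (K \<union> g ` C)"
  proof -
    have "u v = 0" if u: "(\<Sum>v\<in>K \<union> g ` C. scale (u v) v) = 0" and v: "v \<in> K \<union> g ` C" for u v
    proof -
      have s: "(\<Sum>v\<in>K. scale (u v) v) + (\<Sum>c\<in>C. scale (u (g c)) (g c)) = 0"
        using u sum.union_disjoint[OF finK finite_imageI[OF finC] disj, of "\<lambda>v. scale (u v) v"]
        by (simp add: sum.reindex[OF inj] o_def)
      have "T ((\<Sum>v\<in>K. scale (u v) v) + (\<Sum>c\<in>C. scale (u (g c)) (g c)))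
          = T (\<Sum>v\<in>K. scale (u v) v) + T (\<Sum>c\<in>C. scale (u (g c)) (g c))"
        using V KV g by (intro add) (auto intro!: subspace_sum subspace_scale)
      also have "T (\<Sum>v\<in>K. scale (u v) v) = (\<Sum>v\<in>K. scale (u v) (T v))"
        using KV by (intro T_sum finK) auto
      also have "\<dots> = 0" using K(1) by (intro sum.neutral) auto
      also have "T (\<Sum>c\<in>C. scale (u (g c)) (g c)) = (\<Sum>c\<in>C. scale (u (g c)) (T (g c)))"
        using g by (intro T_sum finC) auto
      also have "\<dots> = (\<Sum>c\<in>C. scale (u (g c)) c)" using g by (intro sum.cong) auto
      also have "T ((\<Sum>v\<in>K. scale (u v) v) + (\<Sum>c\<in>C. scale (u (g c)) (g c))) = 0"
        unfolding s using T_sum[of "{}"] by simp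
      finally have "(\<Sum>c\<in>C. scale (u (g c)) c) = 0" by simp
      then have uC: "u (g c) = 0" if "c \<in> C" for c
        using independentD[OF C(2) finC order_refl, of "\<lambda>c. u (g c)" c] that by simp
      with s have "(\<Sum>v\<in>K. scale (u v) v) = 0" by simp
      then have "u v = 0" if "v \<in> K" for v
        using independentD[OF K(2) finK order_refl, of u v] that by simp
      with uC v show ?thesis by auto
    qed
    then show ?thesis using dependent_finite[of "K \<union> g ` C"] finK finC by auto
  qed
  moreover have "V \<subseteq> span (K \<union> g ` C)"
  proof
    fix x assume x: "x \<in> V"
    then have "T x \<in> span C" using C(3) by auto
    then obtain r where r: "T x = (\<Sum>c\<in>C. scale (r c) c)" using span_finite[OF finC] by auto
    define y where "y = (\<Sum>c\<in>C. scale (r c) (g c))"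
    have y: "y \<in> V" unfolding y_def using V g by (auto intro!: subspace_sum subspace_scale)
    have "T y = (\<Sum>c\<in>C. scale (r c) (T (g c)))" unfolding y_def using g by (intro T_sum finC) auto
    also have "\<dots> = T x" unfolding r using g by (intro sum.cong) auto
    finally have Ty: "T y = T x" .
    have "T (x - y) = T (x + scale (- 1) y)" by simp
    also have "\<dots> = T x + scale (- 1) (T y)" using x y V add[of x "scale (- 1) y"] hom[of y "- 1"] subspace_scale by metis
    finally have "x - y \<in> {x \<in> V. T x = 0}" using Ty x y V by (simp add: subspace_diff)
    then have "x - y \<in> span (K \<union> g ` C)" using K(3) span_mono[of K "K \<union> g ` C"] by blast
    moreover have "y \<in> span (K \<union> g ` C)"
      unfolding y_def by (intro span_sum span_scale span_base) auto
    ultimately show "x \<in> span (K \<union> g ` C)" using span_add by fastforce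
  qed
  ultimately have "dim V = card (K \<union> g ` C)"
    using KV g by (intro basis_card_eq_dim[symmetric]) auto
  also have "\<dots> = card K + card C"
    using card_Un_disjoint[OF finK finite_imageI[OF finC] disj] card_image[OF inj] by simp
  finally show ?thesis using K(4) C(4) by simp
qed

section \<open>Monomials: their number and their linear independence as functions\<close>

lemma card_exponents:
  "card {m :: 'n::finite \<Rightarrow> nat. sum m UNIV = d} = (d + CARD('n) - 1) choose d"
proof -
  obtain xs :: "'n list" where xs: "set xs = UNIV" "distinct xs"
    using finite_distinct_list[of "UNIV :: 'n set"] by auto
  have len: "length xs = CARD('n)" using xs distinct_card by metis
  \<comment> \<open>An enumeration of the index type identifies exponent functions with lists of
    length n and sum d, which stars and bars counts.\<close>
  have "bij_betw (\<lambda>m. map m xs) {m :: 'n \<Rightarrow> nat. sum m UNIV = d}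
      {l. size l = CARD('n) \<and> sum_list l = d}"
  proof (rule bij_betwI')
    fix m m' :: "'n \<Rightarrow> nat"
    assume "m \<in> {m. sum m UNIV = d}" "m' \<in> {m. sum m UNIV = d}"
    show "map m xs = map m' xs \<longleftrightarrow> m = m'" using xs(1) by (auto simp: fun_eq_iff)
  next
    fix m :: "'n \<Rightarrow> nat" assume "m \<in> {m. sum m UNIV = d}"
    then show "map m xs \<in> {l. size l = CARD('n) \<and> sum_list l = d}"
      using len xs by (simp add: sum_list_distinct_conv_sum_set)
  next
    fix l assume l: "l \<in> {l :: nat list. size l = CARD('n) \<and> sum_list l = d}"
    define m where "m = (\<lambda>i. the (map_of (zip xs l) i))"
    have "map m xs = l"
      by (rule nth_equalityI) (use l len xs in \<open>auto simp: m_def map_of_zip_nth\<close>)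
    moreover from this have "sum m UNIV = d"
      using l xs sum_list_distinct_conv_sum_set[of xs m] by simp
    ultimately show "\<exists>m\<in>{m :: 'n \<Rightarrow> nat. sum m UNIV = d}. l = map m xs" by blast
  qed
  from bij_betw_same_card[OF this] show ?thesis
    using card_length_sum_list[of "CARD('n)" d]
    by (metis add_diff_cancel_left' binomial_eq_0_iff diff_is_0_eq' add.commute)
qed

lemma finite_exponents: "finite {m :: 'n::finite \<Rightarrow> nat. sum m UNIV = d}"
proof -
  have "m \<in> Pi\<^sub>E UNIV (\<lambda>_. {..d})" if "sum m UNIV = d" for m :: "'n \<Rightarrow> nat"
    using that member_le_sum[of _ UNIV m] by auto
  then have "{m :: 'n \<Rightarrow> nat. sum m UNIV = d} \<subseteq> Pi\<^sub>E UNIV (\<lambda>_. {..d})" by blast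
  then show ?thesis by (rule finite_subset) (auto intro: finite_PiE)
qed

text \<open>Induction over the index set. With the other coordinates fixed, the relation is a
  polynomial identity in the coordinate \<open>a\<close>; its coefficient of t^e is a relation among
  the monomials with exponent e at \<open>a\<close>, in one variable fewer. Vanishing of the
  exponents outside \<open>A\<close> ensures that distinct elements of \<open>M\<close> already
  differ on \<open>A\<close>.\<close>

lemma power_products_independent:
  fixes c :: "('a \<Rightarrow> nat) \<Rightarrow> real"
  assumes "finite A" "finite M" "\<And>m i. m \<in> M \<Longrightarrow> i \<notin> A \<Longrightarrow> m i = 0"
    and "\<And>x. (\<Sum>m\<in>M. c m * (\<Prod>i\<in>A. x i ^ m i)) = 0" "m \<in> M"
  shows "c m = 0"
  using assms
proof (induction A arbitrary: M c m rule: finite_induct)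
  case empty
  then have "m' = (\<lambda>_. 0)" if "m' \<in> M" for m' using that by (simp add: fun_eq_iff)
  then have "M = {m}" using empty.prems(4) by auto
  with empty.prems show ?case by simp
next
  case (insert a A)
  define e where "e = m a"
  define M' where "M' = {m \<in> M. m a = e}"
  have fin: "finite M'" using insert.prems(1) by (simp add: M'_def)
  \<comment> \<open>Resetting the exponent at \<open>a\<close> to 0 meets the support condition of
    the induction hypothesis. Nothing is lost, since that exponent is \<open>e\<close> throughout
    \<open>M'\<close>.\<close>
  have inj: "inj_on (\<lambda>m. m(a := 0)) M'"
    by (rule inj_onI) (auto simp: M'_def fun_eq_iff, metis)
  have "(\<Sum>m\<in>M'. c m * (\<Prod>i\<in>A. x i ^ m i)) = 0" for x
  proof -
    define w where "w m = c m * (\<Prod>i\<in>A. x i ^ m i)" for m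
    define p where "p = (\<Sum>m\<in>M. monom (w m) (m a))"
    have "poly p t = 0" for t
    proof -
      have "(\<Prod>i\<in>insert a A. (x(a := t)) i ^ m i) = t ^ m a * (\<Prod>i\<in>A. x i ^ m i)" for m :: "'a \<Rightarrow> nat"
      proof -
        have "(\<Prod>i\<in>A. (x(a := t)) i ^ m i) = (\<Prod>i\<in>A. x i ^ m i)"
          using insert.hyps by (intro prod.cong) auto
        then show ?thesis using insert.hyps by simp
      qed
      then have "poly p t = (\<Sum>m\<in>M. c m * (\<Prod>i\<in>insert a A. (x(a := t)) i ^ m i))"
        by (simp add: p_def w_def poly_sum poly_monom mult_ac)
      then show ?thesis using insert.prems(3) by simp
    qed
    then have "coeff p e = 0" using poly_all_0_iff_0[of p] by simp
    then show ?thesis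
      using insert.prems(1) by (simp add: p_def coeff_sum M'_def w_def sum.If_cases Int_def)
  qed
  then have "(\<Sum>m\<in>(\<lambda>m. m(a := 0)) ` M'. c (m(a := e)) * (\<Prod>i\<in>A. x i ^ m i)) = 0" for x
  proof -
    have "(\<Sum>m\<in>(\<lambda>m. m(a := 0)) ` M'. c (m(a := e)) * (\<Prod>i\<in>A. x i ^ m i))
        = (\<Sum>m\<in>M'. c (m(a := 0, a := e)) * (\<Prod>i\<in>A. x i ^ (m(a := 0)) i))"
      by (subst sum.reindex[OF inj]) simp
    also have "\<dots> = (\<Sum>m\<in>M'. c m * (\<Prod>i\<in>A. x i ^ m i))"
      using insert.hyps by (intro sum.cong arg_cong2[of _ _ _ _ "(*)"] prod.cong) (auto simp: M'_def)
    finally show ?thesis using \<open>\<And>x. (\<Sum>m\<in>M'. c m * (\<Prod>i\<in>A. x i ^ m i)) = 0\<close> by simp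
  qed
  moreover have "m(a := 0) \<in> (\<lambda>m. m(a := 0)) ` M'"
    using insert.prems(4) by (auto simp: M'_def e_def)
  moreover have "m i = 0" if "m \<in> (\<lambda>m. m(a := 0)) ` M'" "i \<notin> A" for m i
    using that insert.prems(2) by (auto simp: M'_def)
  ultimately have "c ((m(a := 0))(a := e)) = 0"
    using insert.IH[of "(\<lambda>m. m(a := 0)) ` M'" "\<lambda>m. c (m(a := e))" "m(a := 0)"] fin by blast
  then show ?case by (simp add: e_def)
qed

section \<open>Forms as real functions: closure properties, continuity, dimension\<close>

definition power_product :: "('n::finite \<Rightarrow> nat) \<Rightarrow> real^'n \<Rightarrow> real" where
  "power_product m x = (\<Prod>i\<in>UNIV. (x $ i) ^ m i)"

lemma forms_eq: "forms d = real_fun.span (power_product ` {m. sum m UNIV = d})"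
  unfolding forms_def power_product_def by (rule arg_cong[of _ _ real_fun.span]) auto

lemma power_product_in_forms: "sum m UNIV = d \<Longrightarrow> power_product m \<in> forms d"
  unfolding forms_eq by (rule real_fun.span_base) auto

lemma forms_add: "f \<in> forms d \<Longrightarrow> g \<in> forms d \<Longrightarrow> (\<lambda>x. f x + g x) \<in> forms d"
  using real_fun.span_add unfolding forms_def plus_fun_def by blast

lemma forms_scale: "f \<in> forms d \<Longrightarrow> (\<lambda>x. c * f x) \<in> forms d"
  using real_fun.span_scale unfolding forms_def fun_scale_def by blast

lemma forms_zero: "(\<lambda>x. 0) \<in> forms d"
  using real_fun.span_zero unfolding forms_def zero_fun_def by blast

lemma forms_sum: "(\<And>j. j \<in> J \<Longrightarrow> f j \<in> forms d) \<Longrightarrow> (\<lambda>x. \<Sum>j\<in>J. f j x) \<in> forms d"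
  by (induction J rule: infinite_finite_induct) (auto intro: forms_zero forms_add)

text \<open>Adapted to properties that are linear in \<open>f\<close>: a form is built by adding one
  scaled monomial at a time. The premise \<open>g \<in> forms d\<close> is carried along because the
  steps need g to be differentiable or integrable.\<close>

lemma forms_induct [consumes 1, case_names zero add]:
  assumes "f \<in> forms d" "P (\<lambda>x. 0)"
    and "\<And>c m g. sum m UNIV = d \<Longrightarrow> g \<in> forms d \<Longrightarrow> P g \<Longrightarrow> P (\<lambda>x. c * power_product m x + g x)"
  shows "P f"
proof -
  have "f \<in> forms d \<and> P f"
    using assms(1)[unfolded forms_eq]
  proof (induction rule: real_fun.span_induct_alt)
    case base
    then show ?case using assms(2) forms_zero by (simp add: zero_fun_def)
  next
    case (step c x y)
    then show ?case using assms(3)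
      by (auto simp: plus_fun_def fun_scale_def intro!: forms_add forms_scale power_product_in_forms)
  qed
  then show ?thesis ..
qed

lemma forms_mult:
  assumes "f \<in> forms d" "g \<in> forms e"
  shows "(\<lambda>x. f x * g x) \<in> forms (d + e)"
  using assms(1)
proof (induction rule: forms_induct)
  case zero
  then show ?case by (simp add: forms_zero)
next
  case (add c m f)
  have "(\<lambda>x. power_product m x * g x) \<in> forms (d + e)"
    using assms(2)
  proof (induction rule: forms_induct)
    case zero
    then show ?case by (simp add: forms_zero)
  next
    case (add c m' g)
    have eq: "power_product m x * power_product m' x = power_product (\<lambda>i. m i + m' i) x" for x :: "real^'a"
      by (simp add: power_product_def power_add prod.distrib)
    moreover have "power_product (\<lambda>i. m i + m' i) \<in> forms (d + e)"
      using \<open>sum m UNIV = d\<close> add by (intro power_product_in_forms) (simp add: sum.distrib)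
    ultimately have "(\<lambda>x. c * power_product (\<lambda>i. m i + m' i) x + power_product m x * g x) \<in> forms (d + e)"
      using add by (intro forms_add forms_scale)
    then show ?case
      unfolding eq[symmetric] by (simp add: algebra_simps)
  qed
  then have "(\<lambda>x. c * (power_product m x * g x) + f x * g x) \<in> forms (d + e)"
    using add by (intro forms_add forms_scale)
  then show ?case by (simp add: algebra_simps)
qed

lemma coordinate_in_forms: "(\<lambda>x. x $ i) \<in> forms 1"
proof -
  have "power_product (\<lambda>j. if j = i then 1 else 0) x = x $ i" for x
    by (simp add: power_product_def if_distrib[of "\<lambda>k. _ ^ k"] cong: if_cong)
  moreover have "power_product (\<lambda>j. if j = i then 1 else 0) \<in> forms 1"
    by (rule power_product_in_forms) simp
  ultimately show ?thesis by (metis (no_types, lifting) ext)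
qed

lemma constant_in_forms: "(\<lambda>x. c) \<in> forms 0"
  using forms_scale[OF power_product_in_forms[of "\<lambda>_. 0" 0], of c] by (simp add: power_product_def)

lemma forms_power: "f \<in> forms d \<Longrightarrow> (\<lambda>x. f x ^ e) \<in> forms (e * d)"
  by (induction e) (auto intro: constant_in_forms forms_mult)

lemma inner_in_forms: "(\<lambda>y. x \<bullet> y) \<in> forms 1"
  unfolding inner_vec_def inner_real_def by (intro forms_sum forms_scale coordinate_in_forms)

lemma inner_self_in_forms: "(\<lambda>y :: real^'n::finite. y \<bullet> y) \<in> forms 2"
  unfolding inner_vec_def inner_real_def
  by (intro forms_sum) (metis forms_mult[OF coordinate_in_forms coordinate_in_forms] one_add_one)

lemma forms_homogeneous: "f \<in> forms d \<Longrightarrow> f (c *\<^sub>R x) = c ^ d * f x"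
proof (induction rule: forms_induct)
  case (add a m g)
  have "power_product m (c *\<^sub>R x) = c ^ d * power_product m x"
    using add(1) by (auto simp: power_product_def power_mult_distrib prod.distrib power_sum)
  then show ?case using add by (simp add: algebra_simps)
qed simp

lemma forms_continuous: "f \<in> forms d \<Longrightarrow> continuous_on S f"
proof (induction rule: forms_induct)
  case (add a m g)
  then show ?case unfolding power_product_def by (intro continuous_intros) auto
qed simp

lemma sum_fun_apply: "(\<Sum>v\<in>S. f v) x = (\<Sum>v\<in>S. f v x)"
  by (induction S rule: infinite_finite_induct) auto

lemma dim_forms:
  "real_fun.dim (forms d :: (real^'n::finite \<Rightarrow> real) set) = (d + CARD('n) - 1) choose d"
proof -
  let ?M = "{m :: 'n \<Rightarrow> nat. sum m UNIV = d}"
  have c0: "c m = 0" if "\<And>x. (\<Sum>m\<in>?M. c m * power_product m x) = 0" "m \<in> ?M" for c m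
  proof (rule power_products_independent[of UNIV ?M c m])
    fix x :: "'n \<Rightarrow> real"
    show "(\<Sum>m\<in>?M. c m * (\<Prod>i\<in>UNIV. x i ^ m i)) = 0"
      using that(1)[of "\<chi> i. x i"] by (simp add: power_product_def)
  qed (use that finite_exponents in auto)
  have inj: "inj_on power_product ?M"
  proof (rule inj_onI, rule ccontr)
    fix m m' assume m: "m \<in> ?M" "m' \<in> ?M" "power_product m = power_product m'" "m \<noteq> m'"
    \<comment> \<open>Two distinct exponents with the same monomial function would give a nontrivial
      relation with coefficients 1 and -1.\<close>
    define c where "c k = (if k = m then 1 else if k = m' then - 1 else 0 :: real)" for k
    have "(\<Sum>k\<in>?M. c k * power_product k x) = 0" for x
    proof -
      have "(\<Sum>k\<in>?M. c k * power_product k x)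
          = (\<Sum>k\<in>?M. (if k = m then power_product m x else 0) - (if k = m' then power_product m' x else 0))"
        using m by (intro sum.cong) (auto simp: c_def)
      also have "\<dots> = power_product m x - power_product m' x"
        using m finite_exponents[where 'n='n] by (simp add: sum_subtractf)
      finally show ?thesis using m by simp
    qed
    from c0[OF this m(1)] show False by (simp add: c_def)
  qed
  have "real_fun.independent (power_product ` ?M)"
  proof -
    have "u v = 0" if u: "(\<Sum>v\<in>power_product ` ?M. fun_scale (u v) v) = 0" and v: "v \<in> power_product ` ?M" for u v
    proof -
      have "(\<Sum>m\<in>?M. u (power_product m) * power_product m x) = 0" for x
      proof -
        have "(\<Sum>m\<in>?M. u (power_product m) * power_product m x)
            = (\<Sum>m\<in>?M. fun_scale (u (power_product m)) (power_product m)) x"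
          by (simp add: sum_fun_apply fun_scale_def)
        also have "\<dots> = 0" using u by (simp add: sum.reindex[OF inj])
        finally show ?thesis .
      qed
      from c0[OF this] v show ?thesis by auto
    qed
    then show ?thesis using real_fun.dependent_finite[OF finite_imageI[OF finite_exponents]] by blast
  qed
  then show ?thesis
    using card_image[OF inj] card_exponents[where 'n='n, of d]
    by (simp add: forms_eq real_fun.dim_eq_card_independent)
qed

section \<open>Derivatives of forms\<close>

lemma power_product_has_derivative:
  "(power_product m has_derivative
     (\<lambda>v. \<Sum>i\<in>UNIV. v $ i * (real (m i) * power_product (m(i := m i - 1)) x))) (at x)"
proof -
  have "((\<lambda>x. \<Prod>i\<in>UNIV. (x $ i) ^ m i) has_derivative
      (\<lambda>v. \<Sum>i\<in>UNIV. of_nat (m i) * v $ i * (x $ i) ^ (m i - 1) * (\<Prod>j\<in>UNIV - {i}. (x $ j) ^ m j))) (at x)"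
    by (intro has_derivative_prod has_derivative_power bounded_linear.has_derivative[OF bounded_linear_vec_nth]
        has_derivative_ident)
  \<comment> \<open>The identity also holds for \<open>m i = 0\<close>, where truncated subtraction
    gives the exponent 0; the factor \<open>real (m i)\<close> then removes the term.\<close>
  moreover have "power_product (m(i := m i - 1)) x = (x $ i) ^ (m i - 1) * (\<Prod>j\<in>UNIV - {i}. (x $ j) ^ m j)" for i
  proof -
    have "power_product (m(i := m i - 1)) x
        = (x $ i) ^ (m i - 1) * (\<Prod>j\<in>UNIV - {i}. (x $ j) ^ (m(i := m i - 1)) j)"
      unfolding power_product_def by (subst prod.remove[of _ i]) auto
    also have "(\<Prod>j\<in>UNIV - {i}. (x $ j) ^ (m(i := m i - 1)) j) = (\<Prod>j\<in>UNIV - {i}. (x $ j) ^ m j)"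
      by (intro prod.cong) auto
    finally show ?thesis .
  qed
  ultimately show ?thesis by (simp add: power_product_def[abs_def] mult_ac)
qed

lemma forms_differentiable: "f \<in> forms d \<Longrightarrow> f differentiable (at x)"
proof (induction rule: forms_induct)
  case (add a m g)
  then show ?case using power_product_has_derivative
    by (intro differentiable_add differentiable_mult) (auto simp: differentiable_def)
qed simp

lemma partial_deriv_eqI: "(f has_derivative D) (at x) \<Longrightarrow> partial_deriv i f x = D (axis i 1)"
  unfolding partial_deriv_def by (simp flip: frechet_derivative_at)

lemma partial_deriv_power_product:
  "partial_deriv i (power_product m) = (\<lambda>x. real (m i) * power_product (m(i := m i - 1)) x)"
proof
  fix x
  have "partial_deriv i (power_product m) x
      = (\<Sum>j\<in>UNIV. axis i 1 $ j * (real (m j) * power_product (m(j := m j - 1)) x))"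
    by (rule partial_deriv_eqI[OF power_product_has_derivative])
  also have "\<dots> = (\<Sum>j\<in>UNIV. if j = i then real (m j) * power_product (m(j := m j - 1)) x else 0)"
    by (intro sum.cong) (auto simp: axis_def)
  finally show "partial_deriv i (power_product m) x = real (m i) * power_product (m(i := m i - 1)) x"
    by simp
qed

lemma partial_deriv_zero: "partial_deriv i (\<lambda>x. 0) = (\<lambda>x. 0)"
  by (rule ext) (rule partial_deriv_eqI[OF has_derivative_const])

lemma partial_deriv_lincomb:
  assumes "f \<in> forms d" "g \<in> forms e"
  shows "partial_deriv i (\<lambda>x. c * f x + g x) = (\<lambda>x. c * partial_deriv i f x + partial_deriv i g x)"
proof
  fix x
  obtain F G where FG: "(f has_derivative F) (at x)" "(g has_derivative G) (at x)"
    using assms forms_differentiable unfolding differentiable_def by blast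
  then have "((\<lambda>x. c * f x + g x) has_derivative (\<lambda>v. c * F v + G v)) (at x)"
    by (auto intro!: derivative_eq_intros)
  then show "partial_deriv i (\<lambda>x. c * f x + g x) x = c * partial_deriv i f x + partial_deriv i g x"
    using FG by (simp add: partial_deriv_eqI)
qed

text \<open>For d = 0 the derivative is the zero function, so the truncated degree d - 1 is still
  correct.\<close>

lemma partial_deriv_in_forms: "f \<in> forms d \<Longrightarrow> partial_deriv i f \<in> forms (d - 1)"
proof (induction rule: forms_induct)
  case zero
  then show ?case by (simp add: partial_deriv_zero forms_zero)
next
  case (add c m g)
  have "(\<lambda>x. real (m i) * power_product (m(i := m i - 1)) x) \<in> forms (d - 1)"
  proof (cases "m i = 0")
    case False
    have "sum m UNIV = m i + sum m (UNIV - {i})" by (subst sum.remove[of _ i]) auto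
    moreover have "sum (m(i := m i - 1)) UNIV = (m i - 1) + sum m (UNIV - {i})"
      by (subst sum.remove[of _ i]) (auto intro!: sum.cong)
    ultimately show ?thesis using add(1) False by (intro forms_scale power_product_in_forms) simp
  qed (simp add: forms_zero)
  then show ?case
    using add partial_deriv_lincomb[OF power_product_in_forms[OF add(1)] add(2), of i c]
    by (simp add: partial_deriv_power_product forms_add forms_scale)
qed

lemma partial_deriv_forms_0: "f \<in> forms 0 \<Longrightarrow> partial_deriv i f = (\<lambda>x. 0)"
proof (induction rule: forms_induct)
  case zero
  then show ?case by (simp add: partial_deriv_zero)
next
  case (add c m g)
  then show ?case
    using partial_deriv_lincomb[OF power_product_in_forms[OF add(1)] add(2), of i c]
    by (simp add: partial_deriv_power_product)
qed

lemma laplacian_in_forms: "f \<in> forms d \<Longrightarrow> laplacian f \<in> forms (d - 2)"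
  unfolding laplacian_def[abs_def]
  by (rule forms_sum) (metis partial_deriv_in_forms diff_diff_left one_add_one)

lemma laplacian_lincomb:
  assumes "f \<in> forms d" "g \<in> forms e"
  shows "laplacian (\<lambda>x. c * f x + g x) = (\<lambda>x. c * laplacian f x + laplacian g x)"
  by (simp add: laplacian_def[abs_def] partial_deriv_lincomb[OF assms]
      partial_deriv_lincomb[OF assms[THEN partial_deriv_in_forms]] sum.distrib sum_distrib_left)

section \<open>Surjectivity of the Laplacian and the dimensions of its kernels\<close>

lemma laplacian_power_product:
  "laplacian (power_product m) = (\<lambda>x. \<Sum>i\<in>UNIV. real (m i * (m i - 1)) * power_product (m(i := m i - 2)) x)"
proof -
  have "partial_deriv i (partial_deriv i (power_product m))
      = (\<lambda>x. real (m i * (m i - 1)) * power_product (m(i := m i - 2)) x)" for i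
  proof -
    let ?m = "m(i := m i - 1)"
    have "partial_deriv i (\<lambda>x. real (m i) * power_product ?m x + 0)
        = (\<lambda>x. real (m i) * partial_deriv i (power_product ?m) x + partial_deriv i (\<lambda>x. 0) x)"
      by (rule partial_deriv_lincomb[OF power_product_in_forms[OF refl] forms_zero])
    then show ?thesis
      by (simp add: partial_deriv_power_product partial_deriv_zero mult_ac numeral_2_eq_2)
  qed
  then show ?thesis by (simp add: laplacian_def[abs_def])
qed

text \<open>Induction on the degree of m in the variables other than a fixed \<open>a\<close>. The
  Laplacian of x_a^2 x^m is a positive multiple of x^m plus terms in which some other variable has
  lost two degrees, and those lie in the image by the induction hypothesis.\<close>

lemma laplacian_onto_power_product:
  assumes "sum m UNIV = d"
  shows "\<exists>g \<in> forms (d + 2). laplacian g = power_product (m :: 'n::finite \<Rightarrow> nat)"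
proof -
  fix a :: 'n
  show ?thesis using assms
  proof (induction "sum m (UNIV - {a})" arbitrary: m rule: less_induct)
    case less
    define m' where "m' = m(a := m a + 2)"
    define R where "R = {f. \<exists>g \<in> forms (d + 2). laplacian g = (f :: real^'n \<Rightarrow> real)}"
    have R_add: "(\<lambda>x. c * f x + g x) \<in> R" if fg: "f \<in> R" "g \<in> R" for c f g
    proof -
      obtain f' g' where "f' \<in> forms (d + 2)" "laplacian f' = f" "g' \<in> forms (d + 2)" "laplacian g' = g"
        using fg unfolding R_def by auto
      then show ?thesis unfolding R_def
        using laplacian_lincomb[of f' "d+2" g' "d+2" c] forms_add[OF forms_scale] by blast
    qed
    have R_zero: "(\<lambda>x. 0) \<in> R"
      unfolding R_def using forms_zero
      by (auto intro!: bexI[of _ "\<lambda>x. 0"] simp: laplacian_def[abs_def] partial_deriv_zero)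
    have split: "sum h UNIV = h a + sum h (UNIV - {a})" for h :: "'n \<Rightarrow> nat"
      by (subst sum.remove[of _ a]) auto
    have m'_other: "sum m' (UNIV - {a}) = sum m (UNIV - {a})" by (auto simp: m'_def intro!: sum.cong)
    have summ': "sum m' UNIV = d + 2" using less(2) by (simp add: split m'_other) (simp add: m'_def)
    define t where "t i = (\<lambda>x. real (m' i * (m' i - 1)) * power_product (m'(i := m' i - 2)) x)" for i
    have T: "t i \<in> R" if "i \<noteq> a" for i
    proof (cases "m' i \<ge> 2")
      case True
      let ?h = "m'(i := m' i - 2)"
      have "sum m' (UNIV - {a}) = m' i + sum m' (UNIV - {a} - {i})"
        using that by (subst sum.remove[of _ i]) auto
      moreover have "sum ?h (UNIV - {a}) = (m' i - 2) + sum m' (UNIV - {a} - {i})"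
        using that by (subst sum.remove[of _ i]) (auto intro!: sum.cong)
      ultimately have *: "sum ?h (UNIV - {a}) + 2 = sum m' (UNIV - {a})" using True by simp
      moreover have "sum ?h UNIV = d"
        using * summ' split[of ?h] split[of m'] that by simp
      ultimately have "power_product ?h \<in> R" using less(1)[of ?h] m'_other by (simp add: R_def)
      from R_add[OF this R_zero] show ?thesis by (simp add: t_def)
    next
      case False
      then have "m' i * (m' i - 1) = 0" by auto
      then show ?thesis using R_zero by (simp only: t_def of_nat_0 mult_zero_left)
    qed
    have "(\<lambda>x. \<Sum>i\<in>J. t i x) \<in> R"
      if "finite J" "J \<subseteq> UNIV - {a}" for J
      using that
    proof (induction J)
      case empty
      then show ?case using R_zero by simp
    next
      case (insert i J)
      then show ?case using R_add[OF T[of i], of _ 1] by simp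
    qed
    from this[of "UNIV - {a}"]
    have rest: "(\<lambda>x. \<Sum>i\<in>UNIV - {a}. t i x) \<in> R"
      (is "?rest \<in> R") by simp
    define w where "w = real ((m a + 2) * (m a + 1))"
    have "laplacian (power_product m') = (\<lambda>x. w * power_product m x + ?rest x)"
      unfolding laplacian_power_product
      by (rule ext, subst sum.remove[of _ a]) (auto simp: w_def m'_def t_def)
    moreover have "laplacian (power_product m') \<in> R"
      unfolding R_def using power_product_in_forms[OF summ'] by auto
    ultimately have "(\<lambda>x. w * power_product m x + ?rest x) \<in> R" by simp
    from R_add[OF rest this, of "- 1"] have "(\<lambda>x. w * power_product m x) \<in> R" by simp
    moreover have "w \<noteq> 0" unfolding w_def of_nat_eq_0_iff by simp
    ultimately have "power_product m \<in> R" using R_add[OF _ R_zero, of "\<lambda>x. w * power_product m x" "1 / w"] by simp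
    then show ?case by (simp add: R_def)
  qed
qed

lemma laplacian_image_forms: "laplacian ` forms (d + 2) = forms d"
proof
  show "laplacian ` forms (d + 2) \<subseteq> forms d" using laplacian_in_forms by fastforce
  show "forms d \<subseteq> laplacian ` forms (d + 2)"
  proof
    fix f :: "real^'n \<Rightarrow> real" assume "f \<in> forms d"
    then show "f \<in> laplacian ` forms (d + 2)"
    proof (induction rule: forms_induct)
      case zero
      then show ?case using forms_zero
        by (auto intro!: image_eqI[of _ _ "\<lambda>x. 0"] simp: laplacian_def[abs_def] partial_deriv_zero)
    next
      case (add c m g)
      from laplacian_onto_power_product[OF add(1)]
      obtain f' where f': "f' \<in> forms (d + 2)" "laplacian f' = power_product m" by auto
      obtain g' where g': "g' \<in> forms (d + 2)" "laplacian g' = g" using add(3) by auto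
      show ?case
        using laplacian_lincomb[OF f'(1) g'(1), of c] f' g' forms_add[OF forms_scale[OF f'(1)] g'(1), of c]
        by (intro image_eqI[of _ _ "\<lambda>x. c * f' x + g' x"]) auto
    qed
  qed
qed

lemma harmonic_forms_eq: "harmonic_forms d = {f \<in> forms d. laplacian f = 0}"
  by (auto simp: harmonic_forms_def fun_eq_iff)

text \<open>Rank-nullity for the Laplacian from degree d + 2 onto degree d, written additively to
  avoid subtraction of natural numbers.\<close>

lemma dim_harmonic_add_2:
  "dim_harmonic TYPE('n::finite) (d + 2) + ((d + CARD('n) - 1) choose d) = (d + CARD('n) + 1) choose (d + 2)"
proof -
  have "real_fun.dim (forms (d + 2) :: (real^'n \<Rightarrow> real) set)
      = real_fun.dim {f :: real^'n \<Rightarrow> real. f \<in> forms (d + 2) \<and> laplacian f = 0}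
        + real_fun.dim (laplacian ` (forms (d + 2) :: (real^'n \<Rightarrow> real) set))"
  proof (rule real_fun.dim_kernel_plus_dim_image)
    show "real_fun.subspace (forms (d + 2))" unfolding forms_def by (rule real_fun.subspace_span)
    show "forms (d + 2) \<subseteq> real_fun.span (power_product ` {m :: 'n \<Rightarrow> nat. sum m UNIV = d + 2})"
      by (simp add: forms_eq)
    show "finite (power_product ` {m :: 'n \<Rightarrow> nat. sum m UNIV = d + 2})" using finite_exponents by blast
    fix f g :: "real^'n \<Rightarrow> real" assume f: "f \<in> forms (d + 2)" and g: "g \<in> forms (d + 2)"
    show "laplacian (f + g) = laplacian f + laplacian g"
      using laplacian_lincomb[OF f g, of 1] by (simp add: plus_fun_def)
  next
    fix c and f :: "real^'n \<Rightarrow> real" assume f: "f \<in> forms (d + 2)"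
    show "laplacian (fun_scale c f) = fun_scale c (laplacian f)"
      using laplacian_lincomb[OF f forms_zero, of c]
      by (simp add: fun_scale_def laplacian_def[abs_def] partial_deriv_zero)
  qed
  then show ?thesis
    by (simp only: laplacian_image_forms dim_forms dim_harmonic_def harmonic_forms_eq) (simp add: add_ac)
qed

lemma dim_harmonic_small:
  assumes "d < 2"
  shows "dim_harmonic TYPE('n::finite) d = (d + CARD('n) - 1) choose d"
proof -
  have "laplacian f = 0" if "f \<in> forms d" for f :: "real^'n \<Rightarrow> real"
  proof -
    have "d - 1 = 0" using assms by simp
    then have "partial_deriv i f \<in> forms 0" for i
      using partial_deriv_in_forms[OF that, of i] by simp
    then show ?thesis by (simp add: laplacian_def[abs_def] partial_deriv_forms_0 zero_fun_def)
  qed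
  then have "harmonic_forms d = (forms d :: (real^'n \<Rightarrow> real) set)" by (auto simp: harmonic_forms_eq)
  then show ?thesis by (simp add: dim_harmonic_def dim_forms)
qed

text \<open>The last factor is the Gegenbauer value C_d(1). In this form the quotients of
  consecutive dimensions are rational functions of d, which is what the comparison with the square
  norms of the zonal polynomials requires.\<close>

lemma dim_harmonic_eq:
  assumes "CARD('n::finite) \<ge> 3"
  shows "real (dim_harmonic TYPE('n) d) = (2 * real d + real CARD('n) - 2) / (real CARD('n) - 2)
    * (pochhammer (real CARD('n) - 2) d / fact d)"
proof -
  define n where "n = real CARD('n)"
  have n: "n \<ge> 3" using assms by (simp add: n_def)
  have b: "real ((e + CARD('n) - 1) choose e) = pochhammer n e / fact e" for e
  proof -
    have "real ((e + CARD('n) - 1) choose e) = (n + e - 1) gchoose e"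
      using assms by (simp add: binomial_gbinomial n_def of_nat_diff algebra_simps)
    then show ?thesis by (simp add: gbinomial_pochhammer' algebra_simps)
  qed
  have r: "pochhammer (n - 2) (e + 2) = (n - 2) * (n - 1) * pochhammer n e" for e
    by (simp add: pochhammer_rec numeral_2_eq_2 algebra_simps)
  consider "d = 0" | "d = 1" | e where "d = e + 2"
    by (metis One_nat_def add_2_eq_Suc' not0_implies_Suc)
  then show ?thesis
  proof cases
    case 3
    define P F where "P = pochhammer n e" and "F = (fact e :: real)"
    have F: "F \<noteq> 0" "real e + 1 \<noteq> 0" "real e + 2 \<noteq> 0" by (auto simp: F_def)
    have P2: "pochhammer n (e + 2) = P * ((n + e) * (n + e + 1))"
      by (simp add: pochhammer_Suc P_def numeral_2_eq_2 mult_ac)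
    have F2: "fact (e + 2) = F * ((real e + 1) * (real e + 2))"
      by (simp add: F_def numeral_2_eq_2 algebra_simps)
    have "real (dim_harmonic TYPE('n) d) = pochhammer n (e + 2) / fact (e + 2) - P / F"
      using arg_cong[OF dim_harmonic_add_2[where 'n='n, of e], of real] b[of e] b[of "e + 2"] 3
      by (simp add: algebra_simps P_def F_def)
    also have "\<dots> = P / F * ((n + e) * (n + e + 1) / ((real e + 1) * (real e + 2)) - 1)"
      unfolding P2 F2 by (simp only: right_diff_distrib times_divide_times_eq mult_1_right)
    also have "(n + e) * (n + e + 1) / ((real e + 1) * (real e + 2)) - 1
        = (n - 1) * (2 * real d + n - 2) / ((real e + 1) * (real e + 2))"
      using F by (simp add: 3 divide_simps) (simp add: algebra_simps)
    also have "P / F * \<dots> = (2 * real d + n - 2) / (n - 2) * (pochhammer (n - 2) d / fact d)"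
      unfolding 3 r F2 P_def[symmetric] using n F by simp
    finally show ?thesis by (simp add: n_def)
  qed (use assms n b in \<open>auto simp: dim_harmonic_small n_def field_simps\<close>)
qed

section \<open>Integration over the sphere\<close>

lemma sphere_cone_eq: "{x :: real^'n::finite. x \<noteq> 0 \<and> norm x \<le> 1 \<and> sgn x \<in> sphere 0 1} = cball 0 1 - {0}"
  by (auto simp: norm_sgn)

lemma emeasure_sphere: "emeasure sphere_area (sphere 0 1 :: (real^'n::finite) set)
    = of_nat CARD('n) * emeasure lborel (cball 0 1 :: (real^'n) set)"
proof -
  have "sphere 0 1 \<in> sets (sphere_area :: (real^'n) measure)"
    using sets.top[of "sphere_area :: (real^'n) measure"] by simp
  then have "emeasure sphere_area (sphere 0 1 :: (real^'n) set)
      = of_nat CARD('n) * emeasure lborel (cball 0 1 - {0} :: (real^'n) set)"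
    by (simp only: emeasure_sphere_area sphere_cone_eq)
  also have "emeasure lborel (cball 0 1 - {0} :: (real^'n) set) = emeasure lborel (cball 0 1 :: (real^'n) set)"
    by (subst emeasure_Diff) auto
  finally show ?thesis .
qed

lemma emeasure_lborel_cball_finite: "emeasure lborel (cball 0 1 :: (real^'n::finite) set) < \<infinity>"
  by (intro emeasure_bounded_finite) simp

lemma finite_measure_sphere_area: "finite_measure (sphere_area :: (real^'n::finite) measure)"
  using emeasure_lborel_cball_finite[where 'n='n]
  by (intro finite_measureI) (simp add: emeasure_sphere ennreal_mult_eq_top_iff less_top[symmetric])

lemma measure_sphere_pos: "measure sphere_area (sphere 0 1 :: (real^'n::finite) set) > 0"
proof -
  have "measure sphere_area (sphere 0 1 :: (real^'n) set) = real CARD('n) * measure lborel (cball 0 1 :: (real^'n) set)"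
    unfolding measure_def emeasure_sphere enn2real_mult by (simp add: ennreal_of_nat_eq_real_of_nat)
  then show ?thesis using content_cball_pos[of 1 "0 :: real^'n"] by simp
qed

lemma integrable_sphere_area:
  fixes f :: "real^'n::finite \<Rightarrow> real"
  assumes "continuous_on (sphere 0 1) f"
  shows "integrable sphere_area f"
proof -
  interpret finite_measure "sphere_area :: (real^'n) measure" by (rule finite_measure_sphere_area)
  have "bounded (f ` sphere 0 1)" by (intro compact_imp_bounded compact_continuous_image assms) simp
  then obtain B where "\<forall>x\<in>sphere 0 1. norm (f x) \<le> B" unfolding bounded_iff by auto
  then have "AE x in sphere_area. norm (f x) \<le> B" by (intro AE_I2) simp
  moreover have "f \<in> borel_measurable sphere_area"
    using borel_measurable_continuous_on_restrict[OF assms] measurable_cong_sets[OF sets_sphere_area refl]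
    by blast
  ultimately show ?thesis by (rule integrable_const_bound)
qed

section \<open>Rotation invariance of the area measure\<close>

lemma nn_integral_lborel_shift:
  fixes f :: "'a::euclidean_space \<Rightarrow> ennreal"
  assumes [measurable]: "f \<in> borel_measurable borel"
  shows "(\<integral>\<^sup>+x. f (c + x) \<partial>lborel) = (\<integral>\<^sup>+x. f x \<partial>lborel)"
proof -
  have "(\<integral>\<^sup>+x. f x \<partial>lborel) = (\<integral>\<^sup>+x. f x \<partial>distr lborel borel ((+) c))"
    by (simp add: lborel_distr_plus)
  then show ?thesis by (simp add: nn_integral_distr)
qed

lemma nn_integral_lborel_reflect:
  fixes f :: "'a::euclidean_space \<Rightarrow> ennreal"
  assumes [measurable]: "f \<in> borel_measurable borel"
  shows "(\<integral>\<^sup>+x. f (c - x) \<partial>lborel) = (\<integral>\<^sup>+x. f x \<partial>lborel)"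
proof -
  have "lborel = distr lborel borel (\<lambda>x::'a. c - x)"
    using lborel_affine[of "- 1" c] by (simp add: density_1)
  then have "(\<integral>\<^sup>+x. f x \<partial>lborel) = (\<integral>\<^sup>+x. f x \<partial>distr lborel borel (\<lambda>x. c - x))" by simp
  then show ?thesis by (simp add: nn_integral_distr)
qed

text \<open>Both sides of the identity \<open>\<lambda>(T\<^sup>-\<^sup>1 A) \<lambda>(B) = \<lambda>(A) \<lambda>(T\<^sup>-\<^sup>1 B)\<close> are rearrangements of one double
  integral, by translation invariance; taking the unit ball for \<open>B\<close> shows that \<open>T\<close> preserves
  the measure.\<close>

lemma emeasure_orthogonal_vimage:
  fixes T :: "'a::euclidean_space \<Rightarrow> 'a"
  assumes T: "orthogonal_transformation T" and A [measurable]: "A \<in> sets borel"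
  shows "emeasure lborel (T -` A) = emeasure lborel A"
proof -
  have lin: "linear T" and nrm: "\<And>x. norm (T x) = norm x"
    using T by (auto simp: orthogonal_transformation)
  have [measurable]: "T \<in> borel_measurable borel"
    using linear_continuous_on[of T UNIV] lin
    by (intro borel_measurable_continuous_onI) (simp add: linear_conv_bounded_linear)
  obtain T' where T': "\<And>y. T (T' y) = y"
    using orthogonal_transformation_surj[OF T] by (metis surjD)
  define B where "B = cball (0 :: 'a) 1"
  have [measurable]: "B \<in> sets borel" by (simp add: B_def)
  have sets: "T -` A \<in> sets lborel" "T -` B \<in> sets lborel"
    using measurable_sets[of T borel borel A] measurable_sets[of T borel borel B] by simp_all
  let ?I = "indicator :: 'a set \<Rightarrow> 'a \<Rightarrow> ennreal"
  have "emeasure lborel (T -` A) * emeasure lborel B = (\<integral>\<^sup>+x. ?I A (T x) * emeasure lborel B \<partial>lborel)"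
    using sets by (simp add: nn_integral_multc indicator_vimage[symmetric])
  also have "\<dots> = (\<integral>\<^sup>+x. \<integral>\<^sup>+y. ?I A (T x) * ?I B (T x + y) \<partial>lborel \<partial>lborel)"
    by (simp add: nn_integral_cmult nn_integral_lborel_shift)
  also have "\<dots> = (\<integral>\<^sup>+y. \<integral>\<^sup>+x. ?I A (T x) * ?I B (T x + y) \<partial>lborel \<partial>lborel)"
    by (rule lborel_pair.Fubini') measurable
  also have "\<dots> = (\<integral>\<^sup>+y. \<integral>\<^sup>+x. ?I A (T x - y) * ?I B (T x) \<partial>lborel \<partial>lborel)"
  proof (rule nn_integral_cong)
    fix y :: 'a
    \<comment> \<open>A preimage of -y under T: translating x by it moves y from the factor of B to
      the factor of A.\<close>
    have "T (- T' y + x) = T x - y" for x by (simp add: linear_diff[OF lin] T')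
    then show "(\<integral>\<^sup>+x. ?I A (T x) * ?I B (T x + y) \<partial>lborel) = (\<integral>\<^sup>+x. ?I A (T x - y) * ?I B (T x) \<partial>lborel)"
      using nn_integral_lborel_shift[of "\<lambda>x. ?I A (T x) * ?I B (T x + y)" "- T' y"] by simp
  qed
  also have "\<dots> = (\<integral>\<^sup>+x. \<integral>\<^sup>+y. ?I A (T x - y) * ?I B (T x) \<partial>lborel \<partial>lborel)"
    by (rule lborel_pair.Fubini'[symmetric]) measurable
  also have "\<dots> = (\<integral>\<^sup>+x. emeasure lborel A * ?I B (T x) \<partial>lborel)"
    by (simp add: nn_integral_multc nn_integral_lborel_reflect)
  also have "\<dots> = emeasure lborel A * emeasure lborel (T -` B)"
    using sets by (simp add: nn_integral_cmult indicator_vimage[symmetric])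
  also have "T -` B = B" by (auto simp: B_def nrm)
  finally have "emeasure lborel (T -` A) * emeasure lborel B = emeasure lborel A * emeasure lborel B" .
  moreover have "emeasure lborel B \<noteq> top"
    using emeasure_bounded_finite[of B] by (simp add: B_def less_top[symmetric])
  moreover have "emeasure lborel B \<noteq> 0"
    using content_cball_pos[of 1 "0 :: 'a"] unfolding B_def measure_def by (auto simp del: content_cball_pos)
  ultimately show ?thesis by (metis mult_divide_eq_ennreal)
qed

text \<open>T commutes with \<open>sgn\<close>, so the cone over the preimage of A is the preimage
  of the cone over A, and the invariance of Lebesgue measure passes to the area measure.\<close>

lemma integral_sphere_area_orthogonal:
  fixes T :: "real^'n::finite \<Rightarrow> real^'n" and f :: "real^'n \<Rightarrow> real"
  assumes T: "orthogonal_transformation T" and f: "continuous_on (sphere 0 1) f"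
  shows "(LINT y|sphere_area. f (T y)) = (LINT y|sphere_area. f y)"
proof -
  let ?M = "sphere_area :: (real^'n) measure"
  have lin: "linear T" and nrm: "\<And>x. norm (T x) = norm x"
    using T by (auto simp: orthogonal_transformation)
  have cont: "continuous_on S T" for S using linear_continuous_on lin linear_conv_bounded_linear by blast
  have TM: "T \<in> measurable ?M ?M"
  proof -
    have "T \<in> measurable (restrict_space borel (sphere 0 1)) (restrict_space borel (sphere 0 1))"
      by (rule measurable_restrict_space2)
        (auto simp: nrm space_restrict_space intro: borel_measurable_continuous_on_restrict cont)
    then show ?thesis using measurable_cong_sets[OF sets_sphere_area sets_sphere_area] by blast
  qed
  have "distr ?M ?M T = ?M"
  proof (rule measure_eqI)
    fix A assume "A \<in> sets (distr ?M ?M T)"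
    then have A: "A \<in> sets ?M" by simp
    then have AS: "A \<subseteq> sphere 0 1" using sets.sets_into_space by fastforce
    define B where "B = {x :: real^'n. x \<noteq> 0 \<and> norm x \<le> 1 \<and> sgn x \<in> A}"
    have "A \<in> sets borel"
      using A unfolding sets_sphere_area by (auto simp: sets_restrict_space)
    have "B = sgn -` A \<inter> (cball 0 1 - {0})" by (auto simp: B_def)
    moreover have "sgn \<in> borel_measurable (borel :: (real^'n) measure)"
      unfolding sgn_div_norm by measurable
    ultimately have "B \<in> sets borel" using measurable_sets[OF _ \<open>A \<in> sets borel\<close>, of sgn borel] by auto
    have sgnT: "sgn (T x) = T (sgn x)" for x by (simp add: sgn_div_norm nrm linear_scale[OF lin])
    have T0: "T x = 0 \<longleftrightarrow> x = 0" for x using nrm[of x] by auto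
    have "{x :: real^'n. x \<noteq> 0 \<and> norm x \<le> 1 \<and> sgn x \<in> T -` A \<inter> space ?M} = T -` B"
      by (auto simp: B_def nrm sgnT T0 norm_sgn)
    moreover have "emeasure (distr ?M ?M T) A = emeasure ?M (T -` A \<inter> space ?M)"
      by (rule emeasure_distr[OF TM A])
    ultimately show "emeasure (distr ?M ?M T) A = emeasure ?M A"
      using emeasure_sphere_area[OF measurable_sets[OF TM A]] emeasure_sphere_area[OF A]
        emeasure_orthogonal_vimage[OF T \<open>B \<in> sets borel\<close>]
      by (simp add: B_def)
  qed simp
  then have "(LINT y|?M. f y) = (LINT y|distr ?M ?M T. f y)" by simp
  also have "\<dots> = (LINT y|?M. f (T y))"
    by (rule integral_distr[OF TM]) (use integrable_sphere_area[OF f] in auto)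
  finally show ?thesis by simp
qed

text \<open>A rotation takes x to the i-th axis. In this way the one fixed coordinate represents all
  points x of the sphere.\<close>

lemma integral_sphere_area_inner:
  fixes x :: "real^'n::finite" and \<phi> :: "real \<Rightarrow> real"
  assumes x: "norm x = 1" and \<phi>: "continuous_on UNIV \<phi>"
  shows "(LINT y|sphere_area. \<phi> (x \<bullet> y)) = (LINT y|(sphere_area :: (real^'n) measure). \<phi> (y $ i))"
proof -
  obtain T :: "real^'n \<Rightarrow> real^'n" where T: "orthogonal_transformation T" "T x = axis i 1"
    using orthogonal_transformation_exists_1[OF x, of "axis i 1"] by (auto simp: norm_axis_1)
  have "x \<bullet> y = T y $ i" for y
  proof -
    have "x \<bullet> y = T x \<bullet> T y" using T(1) by (simp add: orthogonal_transformation_def)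
    then show ?thesis by (simp add: T(2) inner_axis')
  qed
  moreover have "continuous_on (sphere 0 1) (\<lambda>y :: real^'n. \<phi> (y $ i))"
    by (rule continuous_on_compose2[OF \<phi>]) (auto intro: continuous_intros)
  ultimately show ?thesis
    using integral_sphere_area_orthogonal[OF T(1), of "\<lambda>y. \<phi> (y $ i)"] by simp
qed

lemma integral_sphere_area_power:
  fixes x :: "real^'n::finite"
  shows "(LINT y|sphere_area. (x \<bullet> y) ^ (2 * s)) =
    (x \<bullet> x) ^ s * (LINT y|(sphere_area :: (real^'n) measure). (y $ i) ^ (2 * s))"
proof (cases "x = 0")
  case True
  then show ?thesis by (cases s) (auto intro!: Bochner_Integration.integral_cong)
next
  case False
  have "x \<bullet> y = norm x * (sgn x \<bullet> y)" for y using False by (simp add: sgn_div_norm)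
  then have "(LINT y|sphere_area. (x \<bullet> y) ^ (2 * s)) = (LINT y|sphere_area. norm x ^ (2 * s) * (sgn x \<bullet> y) ^ (2 * s))"
    by (simp add: power_mult_distrib)
  also have "\<dots> = norm x ^ (2 * s) * (LINT y|sphere_area. (sgn x \<bullet> y) ^ (2 * s))" by simp
  also have "(LINT y|sphere_area. (sgn x \<bullet> y) ^ (2 * s)) = (LINT y|(sphere_area :: (real^'n) measure). (y $ i) ^ (2 * s))"
    by (rule integral_sphere_area_inner) (use False in \<open>auto simp: norm_sgn intro: continuous_intros\<close>)
  also have "norm x ^ (2 * s) = (x \<bullet> x) ^ s" by (simp add: power_mult power2_norm_eq_inner)
  finally show ?thesis .
qed

lemma integral_sphere_area_odd:
  fixes f :: "real^'n::finite \<Rightarrow> real"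
  assumes "continuous_on (sphere 0 1) f" "\<And>y. f (- y) = - f y"
  shows "(LINT y|sphere_area. f y) = 0"
proof -
  have "orthogonal_transformation (\<lambda>y :: real^'n. - y)"
    by (simp add: orthogonal_transformation_def linear_iff)
  from integral_sphere_area_orthogonal[OF this assms(1)] show ?thesis by (simp add: assms(2))
qed

section \<open>Differentiation in the parameter x: moments and divisibility\<close>

text \<open>Differentiation under the integral sign is an instance of the binomial theorem.\<close>

lemma DERIV_sphere_integral:
  fixes x v :: "real^'n::finite"
  assumes g: "continuous_on (sphere 0 1) g"
  shows "((\<lambda>e. LINT y|sphere_area. ((x + e *\<^sub>R v) \<bullet> y) ^ Suc M * g y) has_real_derivative
    real (Suc M) * (LINT y|sphere_area. (x \<bullet> y) ^ M * ((v \<bullet> y) * g y))) (at 0)"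
proof -
  define c where "c k = real (Suc M choose k) * (LINT y|sphere_area. (v \<bullet> y) ^ k * (x \<bullet> y) ^ (Suc M - k) * g y)" for k
  have int: "integrable sphere_area (\<lambda>y. (v \<bullet> y) ^ k * (x \<bullet> y) ^ l * g y)" for k l
    by (intro integrable_sphere_area continuous_intros g)
  have "(LINT y|sphere_area. ((x + e *\<^sub>R v) \<bullet> y) ^ Suc M * g y) = (\<Sum>k\<le>Suc M. c k * e ^ k)" for e
  proof -
    have "((x + e *\<^sub>R v) \<bullet> y) ^ Suc M * g y
        = (\<Sum>k\<le>Suc M. real (Suc M choose k) * e ^ k * ((v \<bullet> y) ^ k * (x \<bullet> y) ^ (Suc M - k) * g y))" for y
    proof -
      have "(x + e *\<^sub>R v) \<bullet> y = e * (v \<bullet> y) + x \<bullet> y" by (simp add: inner_add_left)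
      then show ?thesis unfolding binomial_ring[of "e * (v \<bullet> y)"]
        by (simp only: binomial_ring sum_distrib_right power_mult_distrib) (simp only: mult_ac)
    qed
    then have "(LINT y|sphere_area. ((x + e *\<^sub>R v) \<bullet> y) ^ Suc M * g y) = (LINT y|sphere_area.
        (\<Sum>k\<le>Suc M. real (Suc M choose k) * e ^ k * ((v \<bullet> y) ^ k * (x \<bullet> y) ^ (Suc M - k) * g y)))"
      by (simp only:)
    also have "\<dots> = (\<Sum>k\<le>Suc M. LINT y|sphere_area.
        real (Suc M choose k) * e ^ k * ((v \<bullet> y) ^ k * (x \<bullet> y) ^ (Suc M - k) * g y))"
      by (intro Bochner_Integration.integral_sum integrable_mult_right int)
    also have "\<dots> = (\<Sum>k\<le>Suc M. c k * e ^ k)"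
      unfolding c_def Bochner_Integration.integral_mult_right_zero by (simp only: mult_ac)
    finally show ?thesis .
  qed
  moreover have "((\<lambda>e. \<Sum>k\<le>Suc M. c k * e ^ k) has_real_derivative (\<Sum>k\<le>Suc M. c k * (real k * 0 ^ (k - 1)))) (at 0)"
    by (auto intro!: derivative_eq_intros sum.cong simp del: sum.atMost_Suc)
  moreover have "(\<Sum>k\<le>Suc M. c k * (real k * 0 ^ (k - 1))) = (\<Sum>k\<le>Suc M. if k = 1 then c 1 else 0)"
  proof (rule sum.cong)
    fix k :: nat
    show "c k * (real k * 0 ^ (k - 1)) = (if k = 1 then c 1 else 0)"
      by (cases k) (auto simp: power_0_left)
  qed simp
  moreover have "(\<Sum>k\<le>Suc M. if k = 1 then c 1 else 0) = c 1" by (subst sum.delta) auto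
  moreover have "c 1 = real (Suc M) * (LINT y|sphere_area. (x \<bullet> y) ^ M * ((v \<bullet> y) * g y))"
    by (simp add: c_def mult_ac)
  ultimately show ?thesis by (simp only:)
qed

lemma DERIV_inner_power:
  "((\<lambda>e. ((x + e *\<^sub>R v) \<bullet> (x + e *\<^sub>R v)) ^ s) has_real_derivative
     real s * (x \<bullet> x) ^ (s - 1) * (2 * (x \<bullet> v))) (at 0)"
proof -
  have "(x + e *\<^sub>R v) \<bullet> (x + e *\<^sub>R v) = x \<bullet> x + 2 * e * (x \<bullet> v) + e * e * (v \<bullet> v)" for e
    by (simp add: inner_add_left inner_add_right inner_commute algebra_simps)
  then show ?thesis by (auto intro!: derivative_eq_intros)
qed

text \<open>The moments come from differentiating \<open>\<integral> (x \<bullet> y)\<^bsup>2s+2\<^esup> d\<mu>(y) = c (x \<bullet> x)\<^bsup>s+1\<^esup>\<close> twice in \<open>x\<close> and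
  taking the trace.\<close>

lemma moment_recurrence:
  fixes i :: "'n::finite"
  defines "m \<equiv> \<lambda>s. LINT y|(sphere_area :: (real^'n) measure). (y $ i) ^ (2 * s)"
  shows "(2 * real s + real CARD('n)) * m (Suc s) = (2 * real s + 1) * m s"
proof -
  define c where "c = m (Suc s)"
  have A: "(LINT y|sphere_area. (x \<bullet> y) ^ Suc (2 * s + 1) * 1) = (x \<bullet> x) ^ Suc s * c" for x :: "real^'n"
    using integral_sphere_area_power[of x "Suc s" i] by (simp add: c_def m_def)
  \<comment> \<open>The derivative of A in the direction v, at every x because it is differentiated
    once more.\<close>
  have B: "(LINT y|sphere_area. (x \<bullet> y) ^ Suc (2 * s) * (v \<bullet> y)) = c * (x \<bullet> x) ^ s * (x \<bullet> v)" for x v :: "real^'n"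
  proof -
    have "((\<lambda>e. ((x + e *\<^sub>R v) \<bullet> (x + e *\<^sub>R v)) ^ Suc s * c) has_real_derivative
        real (Suc s) * (x \<bullet> x) ^ s * (2 * (x \<bullet> v)) * c) (at 0)"
      using DERIV_cmult_right[OF DERIV_inner_power[of x v "Suc s"], of c] by simp
    then have "((\<lambda>e. LINT y|sphere_area. ((x + e *\<^sub>R v) \<bullet> y) ^ Suc (2 * s + 1) * 1) has_real_derivative
        real (Suc s) * (x \<bullet> x) ^ s * (2 * (x \<bullet> v)) * c) (at 0)"
      unfolding A .
    from DERIV_unique[OF this DERIV_sphere_integral[OF continuous_on_const]]
    have "real (Suc s) * (x \<bullet> x) ^ s * (2 * (x \<bullet> v)) * c
        = real (Suc (2 * s + 1)) * (LINT y|sphere_area. (x \<bullet> y) ^ (2 * s + 1) * ((v \<bullet> y) * 1))" .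
    then have "(2 * real (Suc s)) * (c * (x \<bullet> x) ^ s * (x \<bullet> v))
        = (2 * real (Suc s)) * (LINT y|sphere_area. (x \<bullet> y) ^ Suc (2 * s) * (v \<bullet> y))"
      by (simp add: algebra_simps)
    then show ?thesis by (simp only: mult_cancel_left) simp
  qed
  define x :: "real^'n" where "x = axis i 1"
  have xx: "x \<bullet> x = 1" by (simp add: x_def inner_axis_axis)
  \<comment> \<open>The derivative of B in the direction v, now only at the unit vector x on the
    i-th axis.\<close>
  have C: "(2 * real s + 1) * (LINT y|sphere_area. (x \<bullet> y) ^ (2 * s) * ((v \<bullet> y) * (v \<bullet> y)))
      = c * (2 * real s * (x \<bullet> v)\<^sup>2 + v \<bullet> v)" for v
  proof -
    have "((\<lambda>e. c * ((x + e *\<^sub>R v) \<bullet> (x + e *\<^sub>R v)) ^ s * ((x + e *\<^sub>R v) \<bullet> v)) has_real_derivative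
        c * (real s * (2 * (x \<bullet> v))) * (x \<bullet> v) + (v \<bullet> v) * c) (at 0)"
    proof -
      have "((\<lambda>e. (x + e *\<^sub>R v) \<bullet> v) has_real_derivative v \<bullet> v) (at 0)"
        by (auto intro!: derivative_eq_intros simp: inner_add_left)
      from DERIV_mult[OF DERIV_cmult[OF DERIV_inner_power[of x v s], of c] this]
      show ?thesis by (simp add: xx)
    qed
    then have "((\<lambda>e. LINT y|sphere_area. ((x + e *\<^sub>R v) \<bullet> y) ^ Suc (2 * s) * (v \<bullet> y)) has_real_derivative
        c * (real s * (2 * (x \<bullet> v))) * (x \<bullet> v) + (v \<bullet> v) * c) (at 0)"
      unfolding B .
    from DERIV_unique[OF this DERIV_sphere_integral]
    show ?thesis by (simp add: continuous_intros algebra_simps power2_eq_square)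
  qed
  have int: "integrable sphere_area (\<lambda>y. (x \<bullet> y) ^ (2 * s) * ((v \<bullet> y) * (v \<bullet> y)))" for v
    by (intro integrable_sphere_area continuous_intros)
  \<comment> \<open>The trace: the squared coordinates of y add up to 1 on the sphere, and the
    right-hand sides of C, summed over the coordinate directions, give c (2 s + n).\<close>
  have "(2 * real s + 1) * m s = (2 * real s + 1) * (LINT y|sphere_area. (\<Sum>j\<in>UNIV. (x \<bullet> y) ^ (2 * s) * ((axis j 1 \<bullet> y) * (axis j 1 \<bullet> y))))"
  proof -
    have "(x \<bullet> y) ^ (2 * s) = (\<Sum>j\<in>UNIV. (x \<bullet> y) ^ (2 * s) * ((axis j 1 \<bullet> y) * (axis j 1 \<bullet> y)))"
      if "norm y = 1" for y :: "real^'n"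
    proof -
      have "(\<Sum>j\<in>UNIV. (axis j 1 \<bullet> y) * (axis j 1 \<bullet> y)) = (\<Sum>j\<in>UNIV. y $ j * y $ j)"
        by (simp add: inner_axis')
      also have "\<dots> = y \<bullet> y" by (simp add: inner_vec_def)
      finally have "(\<Sum>j\<in>UNIV. (axis j 1 \<bullet> y) * (axis j 1 \<bullet> y)) = y \<bullet> y" .
      then show ?thesis using that by (simp add: sum_distrib_left[symmetric] dot_square_norm)
    qed
    then have "m s = (LINT y|sphere_area. (\<Sum>j\<in>UNIV. (x \<bullet> y) ^ (2 * s) * ((axis j 1 \<bullet> y) * (axis j 1 \<bullet> y))))"
      unfolding m_def by (intro Bochner_Integration.integral_cong) (auto simp: x_def inner_axis')
    then show ?thesis by simp
  qed
  also have "\<dots> = (\<Sum>j\<in>UNIV. c * (2 * real s * (x \<bullet> axis j 1)\<^sup>2 + axis j 1 \<bullet> (axis j 1 :: real^'n)))"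
    using int by (simp add: sum_distrib_left C)
  also have "\<dots> = c * (2 * real s * (\<Sum>j\<in>UNIV. (x \<bullet> axis j 1)\<^sup>2) + real CARD('n))"
    by (simp add: sum_distrib_left sum.distrib inner_axis_axis algebra_simps)
  also have "(\<Sum>j\<in>UNIV. (x \<bullet> axis j 1)\<^sup>2) = (\<Sum>j\<in>UNIV. if j = i then 1 else 0)"
    by (intro sum.cong) (auto simp: x_def inner_axis_axis)
  finally show ?thesis by (simp add: c_def)
qed

lemma forms_DERIV:
  assumes "f \<in> forms d"
  shows "((\<lambda>e. f (x + e *\<^sub>R axis i 1)) has_real_derivative partial_deriv i f x) (at 0)"
proof -
  have "(f has_derivative frechet_derivative f (at x)) (at x)"
    using forms_differentiable[OF assms] frechet_derivative_works by blast
  then have "(f has_derivative frechet_derivative f (at x)) (at (x + 0 *\<^sub>R axis i 1))" by simp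
  moreover have "((\<lambda>e. x + e *\<^sub>R axis i 1) has_derivative (\<lambda>e. e *\<^sub>R axis i 1)) (at (0::real))"
    by (auto intro!: derivative_eq_intros)
  ultimately have "((\<lambda>e. f (x + e *\<^sub>R axis i 1)) has_derivative
      (\<lambda>e. frechet_derivative f (at x) (e *\<^sub>R axis i 1))) (at 0)"
    by (rule has_derivative_compose[rotated])
  moreover have "frechet_derivative f (at x) (e *\<^sub>R axis i 1) = partial_deriv i f x * e" for e
    using linear_frechet_derivative[OF forms_differentiable[OF assms]]
    by (simp add: partial_deriv_def linear_scale)
  ultimately show ?thesis by (simp add: has_field_derivative_def mult_commute_abs)
qed

text \<open>One factor x \<bullet> y is expanded in coordinates and y_i is absorbed into the weight;
  hence the arbitrary continuous g in the induction.\<close>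

lemma sphere_integral_in_forms:
  assumes "continuous_on (sphere 0 1) g"
  shows "(\<lambda>x :: real^'n::finite. LINT y|sphere_area. (x \<bullet> y) ^ M * g y) \<in> forms M"
  using assms
proof (induction M arbitrary: g)
  case 0
  then show ?case by (simp add: constant_in_forms)
next
  case (Suc M)
  have "(LINT y|sphere_area. (x \<bullet> y) ^ Suc M * g y)
      = (\<Sum>i\<in>UNIV. x $ i * (LINT y|sphere_area. (x \<bullet> y) ^ M * (y $ i * g y)))" for x :: "real^'n"
  proof -
    have "(x \<bullet> y) ^ Suc M * g y = (\<Sum>i\<in>UNIV. x $ i * ((x \<bullet> y) ^ M * (y $ i * g y)))" for y
    proof -
      have eq: "x \<bullet> y = (\<Sum>i\<in>UNIV. x $ i * y $ i)" by (simp add: inner_vec_def)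
      have "(x \<bullet> y) ^ Suc M * g y = (x \<bullet> y) * ((x \<bullet> y) ^ M * g y)" by simp
      also have "\<dots> = (\<Sum>i\<in>UNIV. x $ i * y $ i) * ((x \<bullet> y) ^ M * g y)"
        by (rule arg_cong[OF eq])
      also have "\<dots> = (\<Sum>i\<in>UNIV. x $ i * ((x \<bullet> y) ^ M * (y $ i * g y)))"
        unfolding sum_distrib_right by (simp only: mult_ac)
      finally show ?thesis .
    qed
    then have "(LINT y|sphere_area. (x \<bullet> y) ^ Suc M * g y)
        = (LINT y|sphere_area. (\<Sum>i\<in>UNIV. x $ i * ((x \<bullet> y) ^ M * (y $ i * g y))))" by (simp only:)
    also have "\<dots> = (\<Sum>i\<in>UNIV. LINT y|sphere_area. x $ i * ((x \<bullet> y) ^ M * (y $ i * g y)))"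
      by (intro Bochner_Integration.integral_sum integrable_sphere_area continuous_intros Suc)
    finally show ?thesis by simp
  qed
  moreover have "(\<lambda>x :: real^'n. \<Sum>i\<in>UNIV. x $ i * (LINT y|sphere_area. (x \<bullet> y) ^ M * (y $ i * g y))) \<in> forms (1 + M)"
    by (intro forms_sum forms_mult coordinate_in_forms Suc.IH continuous_intros Suc.prems)
  ultimately show ?case by simp
qed

text \<open>This is where high powers of \<open>\<parallel>x\<parallel>\<close> divide the integral: each differentiation in \<open>x\<close> produces
  one more factor \<open>y\<^sub>i\<close> and costs one factor \<open>x \<bullet> x\<close>.\<close>

lemma sphere_integral_divisible:
  assumes "g \<in> forms d"
  shows "\<exists>G \<in> forms d. \<forall>x :: real^'n::finite. (LINT y|sphere_area. (x \<bullet> y) ^ (d + 2 * e) * g y) = (x \<bullet> x) ^ e * G x"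
  using assms
proof (induction d arbitrary: e g)
  case 0
  have const: "g y = g 0" for y using forms_homogeneous[OF 0, of 0 y] by simp
  fix i :: 'n
  have "(LINT y|sphere_area. (x \<bullet> y) ^ (0 + 2 * e) * g y)
      = (x \<bullet> x) ^ e * ((LINT y|(sphere_area :: (real^'n) measure). (y $ i) ^ (2 * e)) * g 0)" for x
    using integral_sphere_area_power[of x e i] by (subst const) simp
  then show ?case by (intro bexI[OF _ constant_in_forms] allI)
next
  case (Suc d)
  from Suc.prems show ?case
  proof (induction rule: forms_induct)
    case zero
    then show ?case by (intro bexI[of _ "\<lambda>x. 0"]) (auto simp: forms_zero)
  next
    case (add c m g)
    have "\<exists>i. m i \<noteq> 0" using add(1) by (metis sum.neutral nat.distinct(1))
    then obtain i where i: "m i \<noteq> 0" ..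
    define m' where "m' = m(i := m i - 1)"
    have m: "power_product m y = y $ i * power_product m' y" for y :: "real^'n"
    proof -
      have "power_product m y = (y $ i) ^ m i * (\<Prod>j\<in>UNIV - {i}. (y $ j) ^ m j)"
        unfolding power_product_def by (subst prod.remove[of _ i]) auto
      also have "(y $ i) ^ m i = y $ i * (y $ i) ^ (m i - 1)" using i by (simp add: power_eq_if)
      also have "(\<Prod>j\<in>UNIV - {i}. (y $ j) ^ m j) = (\<Prod>j\<in>UNIV - {i}. (y $ j) ^ m' j)"
        by (intro prod.cong) (auto simp: m'_def)
      also have "y $ i * (y $ i) ^ (m i - 1) * \<dots> = y $ i * power_product m' y"
        unfolding power_product_def by (subst (2) prod.remove[of _ i]) (auto simp: m'_def)
      finally show ?thesis .
    qed
    have "sum m UNIV = m i + sum m (UNIV - {i})" by (subst sum.remove[of _ i]) auto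
    moreover have "sum m' UNIV = (m i - 1) + sum m (UNIV - {i})"
      by (subst sum.remove[of _ i]) (auto simp: m'_def intro!: sum.cong)
    ultimately have "sum m' UNIV = d" using add(1) i by simp
    then have m'f: "power_product m' \<in> forms d" by (rule power_product_in_forms)
    \<comment> \<open>The exponent d + 2 (e + 1) is one more than (d + 1) + 2 e, so one
      differentiation in x_i leads to the wanted power of x \<bullet> y and supplies the missing
      factor y_i.\<close>
    from Suc.IH[OF this, of "Suc e"] obtain G where G: "G \<in> forms d"
      "\<And>x. (LINT y|sphere_area. (x \<bullet> y) ^ (d + 2 * Suc e) * power_product m' y) = (x \<bullet> x) ^ Suc e * G x"
      by blast
    define w where "w = real (Suc (Suc d + 2 * e))"
    have w: "w \<noteq> 0" by (simp add: w_def)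
    \<comment> \<open>What remains of the derivative of (x \<bullet> x)^(e+1) G(x) once (x \<bullet>
      x)^e and the constant w are divided out.\<close>
    define H where "H x = 1 / w * (2 * real (Suc e) * (x $ i * G x) + (x \<bullet> x) * partial_deriv i G x)" for x
    have "(LINT y|sphere_area. (x \<bullet> y) ^ (Suc d + 2 * e) * power_product m y) = (x \<bullet> x) ^ e * H x" for x
    proof -
      have "((\<lambda>t. ((x + t *\<^sub>R axis i 1) \<bullet> (x + t *\<^sub>R axis i 1)) ^ Suc e * G (x + t *\<^sub>R axis i 1)) has_real_derivative
          real (Suc e) * (x \<bullet> x) ^ e * (2 * (x \<bullet> axis i 1)) * G x + partial_deriv i G x * (x \<bullet> x) ^ Suc e) (at 0)"
        using DERIV_mult[OF DERIV_inner_power[of x "axis i 1" "Suc e"] forms_DERIV[OF G(1), of x i]] by simp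
      then have "((\<lambda>t. LINT y|sphere_area. ((x + t *\<^sub>R axis i 1) \<bullet> y) ^ Suc (Suc d + 2 * e) * power_product m' y) has_real_derivative
          real (Suc e) * (x \<bullet> x) ^ e * (2 * (x \<bullet> axis i 1)) * G x + partial_deriv i G x * (x \<bullet> x) ^ Suc e) (at 0)"
        using G(2) by simp
      from DERIV_unique[OF this DERIV_sphere_integral[OF forms_continuous[OF m'f]]]
      have "w * (LINT y|sphere_area. (x \<bullet> y) ^ (Suc d + 2 * e) * power_product m y)
          = real (Suc e) * (x \<bullet> x) ^ e * (2 * (x \<bullet> axis i 1)) * G x + partial_deriv i G x * (x \<bullet> x) ^ Suc e"
        by (simp add: w_def m inner_axis')
      also have "\<dots> = w * ((x \<bullet> x) ^ e * H x)"
        using w by (simp add: H_def inner_axis algebra_simps)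
      finally show ?thesis using w by simp
    qed
    moreover have "H \<in> forms (Suc d)"
    proof -
      have "(\<lambda>x. x $ i * G x) \<in> forms (1 + d)" by (intro forms_mult coordinate_in_forms G)
      moreover have "(\<lambda>x. (x \<bullet> x) * partial_deriv i G x) \<in> forms (Suc d)"
      \<comment> \<open>For d = 0 the degree d - 1 is truncated and the general count would give
        degree 2 instead of 1; there the derivative of G vanishes.\<close>
      proof (cases d)
        case 0
        then show ?thesis using partial_deriv_forms_0[of G i] G(1) by (simp add: forms_zero)
      next
        case (Suc d')
        have "(\<lambda>x. (x \<bullet> x) * partial_deriv i G x) \<in> forms (2 + (d - 1))"
          by (intro forms_mult inner_self_in_forms partial_deriv_in_forms G)
        then show ?thesis using Suc by simp
      qed
      ultimately show ?thesis unfolding H_def[abs_def] by (intro forms_scale forms_add) auto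
    qed
    moreover obtain G' where G': "G' \<in> forms (Suc d)"
      "\<And>x. (LINT y|sphere_area. (x \<bullet> y) ^ (Suc d + 2 * e) * g y) = (x \<bullet> x) ^ e * G' x"
      using add(3) by blast
    moreover have "(LINT y|sphere_area. (x \<bullet> y) ^ (Suc d + 2 * e) * (c * power_product m y + g y))
        = c * (LINT y|sphere_area. (x \<bullet> y) ^ (Suc d + 2 * e) * power_product m y)
          + (LINT y|sphere_area. (x \<bullet> y) ^ (Suc d + 2 * e) * g y)" for x
    proof -
      have "integrable sphere_area (\<lambda>y. c * ((x \<bullet> y) ^ (Suc d + 2 * e) * power_product m y))"
        "integrable sphere_area (\<lambda>y. (x \<bullet> y) ^ (Suc d + 2 * e) * g y)"
        using forms_continuous[OF power_product_in_forms[OF refl]] forms_continuous[OF add(2)]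
        by (intro integrable_sphere_area continuous_intros; blast)+
      from Bochner_Integration.integral_add[OF this] show ?thesis
        by (simp add: distrib_left mult.left_commute)
    qed
    ultimately show ?case
      by (intro bexI[of _ "\<lambda>x. c * H x + G' x"] forms_add forms_scale) (auto simp: algebra_simps)
  qed
qed

text \<open>The terms with j \<le> k are products of forms. For j > k the divisibility lemma applies
  with e = j - k, since 2 j = 2 k + 2 (j - k). At x = 0 the default value of the negative power is
  0, and so is the value of the quotient form, whose degree 2 k is positive.\<close>

lemma gamma_hat_in_forms:
  assumes f: "f \<in> forms (2 * k)" and k: "k \<ge> 1"
  shows "gamma_hat k h f \<in> forms (2 * k)"
proof -
  have "(\<lambda>x. norm x powi (2 * (int k - int j)) * (LINT y|sphere_area. (x \<bullet> y) ^ (2 * j) * f y)) \<in> forms (2 * k)"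
    (is "?F \<in> _") for j
  proof (cases "j \<le> k")
    case True
    have "norm x powi (2 * (int k - int j)) = (x \<bullet> x) ^ (k - j)" for x :: "real^'a"
    proof -
      have "2 * (int k - int j) = int (2 * (k - j))" using True by simp
      then show ?thesis by (simp only: power_int_of_nat power_mult power2_norm_eq_inner)
    qed
    moreover have "(\<lambda>x. (x \<bullet> x) ^ (k - j) * (LINT y|sphere_area. (x \<bullet> y) ^ (2 * j) * f y)) \<in> forms ((k - j) * 2 + 2 * j)"
      by (intro forms_mult forms_power inner_self_in_forms sphere_integral_in_forms forms_continuous[OF f])
    ultimately show ?thesis using True by (simp add: algebra_simps)
  next
    case False
    then have j: "2 * j = 2 * k + 2 * (j - k)" by simp
    obtain G where G: "G \<in> forms (2 * k)"
      "\<And>x. (LINT y|sphere_area. (x \<bullet> y) ^ (2 * j) * f y) = (x \<bullet> x) ^ (j - k) * G x"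
      using sphere_integral_divisible[OF f, of "j - k"] unfolding j by blast
    have "?F x = G x" for x
    proof (cases "x = 0")
      case True
      have "G 0 = 0" using forms_homogeneous[OF G(1), of 0 0] k by (auto simp: power_0_left)
      moreover have "norm x powi (2 * (int k - int j)) = 0" using True False by (simp add: power_int_0_left_if)
      ultimately show ?thesis using True by simp
    next
      case nz: False
      have "2 * (int k - int j) = - int (2 * (j - k))" using False by simp
      then have "norm x powi (2 * (int k - int j)) = inverse ((x \<bullet> x) ^ (j - k))"
        by (simp only: power_int_minus power_int_of_nat power_mult power2_norm_eq_inner)
      then show ?thesis using nz by (simp add: G(2))
    qed
    then show ?thesis using G(1) by (metis (no_types, lifting) ext)
  qed
  then show ?thesis unfolding gamma_hat_def[abs_def] by (intro forms_sum) (simp add: forms_scale mult.assoc)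
qed

text \<open>The range j \<le> D runs past half the degree in order to match the summation range in
  \<open>gamma_hat\<close>; the additional coefficients are 0.\<close>

lemma poly_eq_even_odd_sum:
  fixes h :: "real poly"
  assumes "degree h \<le> D"
  shows "poly h t = (\<Sum>j\<le>D. coeff h (2 * j) * t ^ (2 * j) + coeff h (Suc (2 * j)) * t ^ Suc (2 * j))"
proof -
  have "poly h t = (\<Sum>l\<le>Suc (2 * D). coeff h l * t ^ l)"
    unfolding poly_altdef using assms by (intro sum.mono_neutral_left) (auto simp: coeff_eq_0)
  also have "\<dots> = (\<Sum>j\<le>D. coeff h (2 * j) * t ^ (2 * j) + coeff h (Suc (2 * j)) * t ^ Suc (2 * j))"
    by (induction D) (auto simp: algebra_simps)
  finally show ?thesis .
qed

text \<open>A form of even degree is an even function, so the odd powers of x \<bullet> y integrate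
  to 0 and the whole kernel h may be inserted. The positivity and the concentration of h can then be
  used directly.\<close>

lemma gamma_hat_on_sphere:
  assumes f: "f \<in> forms (2 * k)" and x: "norm (x :: real^'n::finite) = 1"
  shows "gamma_hat k h f x = (LINT y|sphere_area. poly h (x \<bullet> y) * f y)"
proof -
  let ?E = "\<lambda>j y. coeff h (2 * j) * ((x \<bullet> y) ^ (2 * j) * f y)"
  let ?O = "\<lambda>j y. coeff h (Suc (2 * j)) * ((x \<bullet> y) ^ Suc (2 * j) * f y)"
  have int: "integrable sphere_area (?E j)" "integrable sphere_area (?O j)" for j
    by (intro integrable_sphere_area continuous_intros forms_continuous[OF f])+
  have "f (- y) = f y" for y using forms_homogeneous[OF f, of "- 1" y] by simp
  then have odd: "(LINT y|sphere_area. ?O j y) = 0" for j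
    by (intro integral_sphere_area_odd continuous_intros forms_continuous[OF f]) simp
  have "(LINT y|sphere_area. poly h (x \<bullet> y) * f y) = (LINT y|sphere_area. (\<Sum>j\<le>degree h. ?E j y + ?O j y))"
    unfolding poly_eq_even_odd_sum[OF order_refl] sum_distrib_right by (simp only: distrib_right mult.assoc)
  also have "\<dots> = (\<Sum>j\<le>degree h. LINT y|sphere_area. ?E j y + ?O j y)"
    by (intro Bochner_Integration.integral_sum Bochner_Integration.integrable_add int)
  also have "\<dots> = (\<Sum>j\<le>degree h. LINT y|sphere_area. ?E j y)"
    by (intro sum.cong refl) (simp only: Bochner_Integration.integral_add[OF int] odd add_0_right)
  also have "\<dots> = gamma_hat k h f x" by (simp add: gamma_hat_def x)
  finally show ?thesis ..
qed

section \<open>Zonal polynomials\<close>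

text \<open>Gegenbauer polynomials normalized to the value 1 at 1, hence Legendre polynomials for n
  = 3. The recurrence is that of C_j after division by C_j(1) = (n-2)_j / j!.\<close>

fun zonal :: "real \<Rightarrow> nat \<Rightarrow> real poly" where
  "zonal n 0 = 1"
| "zonal n (Suc 0) = [:0, 1:]"
| "zonal n (Suc (Suc j)) = smult (1 / (n + real j - 1))
     (smult (2 * real j + n) ([:0, 1:] * zonal n (Suc j)) - smult (real j + 1) (zonal n j))"

lemma gegenbauer_eq_zonal:
  assumes "n > 2"
  shows "gegenbauer ((n - 2) / 2) j = smult (pochhammer (n - 2) j / fact j) (zonal n j)"
proof (induction "(n - 2) / 2" j rule: gegenbauer.induct)
  case 2
  show ?case by simp
next
  case (3 j)
  define P F where "P = pochhammer (n - 2) j" and "F = (fact j :: real)"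
  have nz: "n + real j - 2 \<noteq> 0" "n + real j - 1 \<noteq> 0" "real j + 1 \<noteq> 0" "real j + 2 \<noteq> 0" "F \<noteq> 0"
    using assms by (auto simp: F_def)
  have c1: "pochhammer (n - 2) (Suc j) / fact (Suc j) = P * (n - 2 + real j) / (F * (real j + 1))"
    by (simp add: pochhammer_Suc P_def F_def algebra_simps)
  have c2: "pochhammer (n - 2) (Suc (Suc j)) / fact (Suc (Suc j))
      = P * (n - 2 + real j) * (n - 1 + real j) / (F * (real j + 1) * (real j + 2))"
    by (simp add: pochhammer_Suc P_def F_def algebra_simps)
  have "poly (gegenbauer ((n - 2) / 2) (Suc (Suc j))) t
      = poly (smult (pochhammer (n - 2) (Suc (Suc j)) / fact (Suc (Suc j))) (zonal n (Suc (Suc j)))) t" for t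
  proof -
    define u v where "u = poly (zonal n j) t" and "v = poly (zonal n (Suc j)) t"
    have \<alpha>: "2 * (real (j + 2) + (n - 2) / 2 - 1) = 2 * real j + n" "real (j + 2) + 2 * ((n - 2) / 2) - 2 = real j + n - 2"
      by (simp_all add: field_simps)
    have "poly (gegenbauer ((n - 2) / 2) (Suc (Suc j))) t
      = 1 / (real j + 2) * (t * (2 * real j + n) * poly (gegenbauer ((n - 2) / 2) (Suc j)) t
          - (real j + n - 2) * poly (gegenbauer ((n - 2) / 2) j) t)"
      unfolding gegenbauer.simps \<alpha> by (simp add: algebra_simps)
    also have "\<dots> = 1 / (real j + 2) * (t * (2 * real j + n) * (P * (n - 2 + real j) / (F * (real j + 1)) * v)
          - (real j + n - 2) * (P / F * u))"
      unfolding 3 c1 by (simp only: poly_smult u_def v_def P_def F_def)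
    also have "\<dots> = P * (n - 2 + real j) * (n - 1 + real j) / (F * (real j + 1) * (real j + 2))
        * (1 / (n + real j - 1) * ((2 * real j + n) * (t * v) - (real j + 1) * u))"
      using nz by (simp add: divide_simps) (simp add: algebra_simps)
    also have "\<dots> = poly (smult (pochhammer (n - 2) (Suc (Suc j)) / fact (Suc (Suc j))) (zonal n (Suc (Suc j)))) t"
      unfolding c2 zonal.simps by (simp add: u_def v_def)
    finally show ?thesis .
  qed
  then show ?case by (intro poly_eq_poly_eq_iff[THEN iffD1] ext)
qed simp

text \<open>The recurrence solved for t P_j. At j = 0 the truncated index j - 1 comes with the
  coefficient 0.\<close>

lemma zonal_three_term:
  assumes "n > 2"
  shows "smult (2 * real j + n - 2) ([:0, 1:] * zonal n j)
    = smult (n + real j - 2) (zonal n (Suc j)) + smult (real j) (zonal n (j - 1))"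
proof (cases j)
  case (Suc l)
  have "n + real l - 1 \<noteq> 0" using assms by simp
  then show ?thesis unfolding Suc by (simp add: algebra_simps)
qed simp

lemma poly_zonal_1: "n > 2 \<Longrightarrow> poly (zonal n j) 1 = 1"
  by (induction n j rule: zonal.induct) (auto simp: divide_simps)

lemma poly_zonal_minus: "poly (zonal n j) (- t) = (- 1) ^ j * poly (zonal n j) t"
  by (induction n j rule: zonal.induct) (auto simp: algebra_simps)

lemma degree_zonal: "degree (zonal n j) \<le> j"
proof (induction n j rule: zonal.induct)
  case (3 n j)
  have "degree ([:0, 1:] * zonal n (Suc j)) \<le> Suc (Suc j)"
    using degree_mult_le[of "[:0, 1:]" "zonal n (Suc j)"] 3(1) by simp
  then show ?case using 3(2)
    by (auto intro!: degree_smult_le[THEN order_trans] degree_diff_le simp del: mult_pCons_left)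
qed auto

lemma coeff_zonal_pos: "n > 2 \<Longrightarrow> coeff (zonal n j) j > 0"
proof (induction n j rule: zonal.induct)
  case (3 n j)
  have "coeff (zonal n j) (Suc (Suc j)) = 0"
    using degree_zonal[of n j] by (intro coeff_eq_0) simp
  then show ?case using 3 by simp
qed auto

declare zonal.simps(3) [simp del]

lemma zonal_expansion:
  assumes "n > 2" "degree p \<le> d"
  shows "\<exists>c. p = (\<Sum>j\<le>d. smult (c j) (zonal n j))"
  using assms(2)
proof (induction d arbitrary: p)
  case 0
  then obtain a where "p = [:a:]" by (auto elim: degree_eq_zeroE)
  then show ?case by (intro exI[of _ "\<lambda>_. a"]) simp
next
  case (Suc d)
  define a where "a = coeff p (Suc d) / coeff (zonal n (Suc d)) (Suc d)"
  define q where "q = p - smult a (zonal n (Suc d))"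
  have "degree q \<le> Suc d" unfolding q_def
    using Suc.prems degree_zonal[of n "Suc d"] by (intro degree_diff_le degree_smult_le[THEN order_trans]) auto
  moreover have "coeff q (Suc d) = 0" using coeff_zonal_pos[OF assms(1), of "Suc d"] by (simp add: q_def a_def)
  ultimately have "degree q \<le> d"
    by (metis degree_le le_less_Suc_eq coeff_eq_0 le_neq_implies_less less_trans_Suc not_less_eq_eq nle_le)
  from Suc.IH[OF this] obtain c where "q = (\<Sum>j\<le>d. smult (c j) (zonal n j))" by auto
  then have "p = (\<Sum>j\<le>d. smult (c j) (zonal n j)) + smult a (zonal n (Suc d))"
    by (simp add: q_def algebra_simps)
  then show ?case by (intro exI[of _ "c(Suc d := a)"]) (simp cong: sum.cong_simp)
qed

section \<open>Integration of zonal functions: moments, orthogonality and norms\<close>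

locale sphere_axis =
  fixes i :: "'n::finite" and n :: real and d :: "nat \<Rightarrow> real"
  assumes dim_ge: "CARD('n) \<ge> 3" and n_def: "n = real CARD('n)"
    and d_def: "\<And>j. d j = real (dim_harmonic TYPE('n) j)"
begin

text \<open>Up to a constant this is integration against the Gegenbauer weight (1 - t^2)^((n-3)/2)
  on [-1, 1]. The density itself never appears; all values are computed from the moments.\<close>

definition L :: "real poly \<Rightarrow> real" where
  "L p = (LINT y|(sphere_area :: (real^'n) measure). poly p (y $ i))"

abbreviation P :: "nat \<Rightarrow> real poly" where "P \<equiv> zonal n"

lemma n_ge: "n \<ge> 3"
  using dim_ge by (simp add: n_def)

lemma integrable_poly_axis: "integrable sphere_area (\<lambda>y :: real^'n. poly p (y $ i))"
  by (intro integrable_sphere_area continuous_intros)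

lemma L_add: "L (p + q) = L p + L q"
  by (simp add: L_def integrable_poly_axis)

lemma L_diff: "L (p - q) = L p - L q"
  by (simp add: L_def integrable_poly_axis)

lemma L_smult: "L (smult c p) = c * L p"
  by (simp add: L_def)

lemma L_0: "L 0 = 0"
  by (simp add: L_def)

lemma L_sum: "L (\<Sum>j\<in>J. f j) = (\<Sum>j\<in>J. L (f j))"
  by (induction J rule: infinite_finite_induct) (auto simp: L_0 L_add)

lemmas L_simps = L_add L_diff L_smult L_0 L_sum

lemma L_mono:
  assumes "\<And>t. - 1 \<le> t \<Longrightarrow> t \<le> 1 \<Longrightarrow> poly p t \<le> poly q t"
  shows "L p \<le> L q"
  unfolding L_def
proof (rule integral_mono[OF integrable_poly_axis integrable_poly_axis])
  fix y :: "real^'n" assume "y \<in> space sphere_area"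
  then have "\<bar>y $ i\<bar> \<le> 1" using component_le_norm_cart[of y i] by simp
  then show "poly p (y $ i) \<le> poly q (y $ i)" by (intro assms) auto
qed

lemma L_1_pos: "L 1 > 0"
  using measure_sphere_pos[where 'n='n] by (simp add: L_def)

lemma L_odd: "(\<And>t. poly p (- t) = - poly p t) \<Longrightarrow> L p = 0"
  unfolding L_def by (rule integral_sphere_area_odd) (auto intro!: continuous_intros)

definition moment :: "nat \<Rightarrow> real" where "moment s = L (monom 1 (2 * s))"

lemma moment_Suc: "moment (Suc s) = moment s * (real s + 1/2) / (real s + n / 2)"
proof -
  have "(2 * real s + n) * moment (Suc s) = (2 * real s + 1) * moment s"
    using moment_recurrence[of s i] by (simp add: moment_def L_def poly_monom n_def)
  then show ?thesis using n_ge by (simp add: field_simps)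
qed

lemma moment_pos: "moment s > 0"
proof (induction s)
  case 0
  then show ?case using L_1_pos by (simp add: moment_def)
next
  case (Suc s)
  then show ?case using n_ge by (simp add: moment_Suc)
qed

lemma L_monom_mult_zonal_parity: "odd (l + j) \<Longrightarrow> L (monom 1 l * P j) = 0"
  by (rule L_odd) (auto simp: poly_monom poly_zonal_minus power_minus' elim: oddE split: if_splits)

text \<open>For a = s + n/2 this is L(t^(2s) P_(2j)) / L(t^(2s)), the coefficient \<lambda>_(2j) of
  the power kernel. The numerators make it vanish for a natural number s < j, which is orthogonality
  to low powers.\<close>

definition ratio :: "real \<Rightarrow> real \<Rightarrow> nat \<Rightarrow> real" where
  "ratio s a j = (\<Prod>l<j. (s - real l) / (a + real l))"

lemma ratio_Suc: "ratio s a (Suc j) = ratio s a j * ((s - real j) / (a + real j))"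
  by (simp add: ratio_def)

text \<open>Apart from the first one, the numerators on the left are those on the right. This links
  the even moment formula at s + 1 with the odd one at s.\<close>

lemma ratio_shift:
  assumes "a > 0"
  shows "ratio (s + 1) a (Suc j) * (a + real j) = (s + 1) * ratio s a j"
proof (induction j)
  case 0
  then show ?case using assms by (simp add: ratio_def)
next
  case (Suc j)
  have "a + real j \<noteq> 0" "a + real (Suc j) \<noteq> 0" using assms by auto
  then have "ratio (s + 1) a (Suc (Suc j)) * (a + real (Suc j)) = ratio (s + 1) a (Suc j) * (s - real j)"
    unfolding ratio_Suc[of _ _ "Suc j"] by (simp add: field_simps)
  also have "\<dots> = (s + 1) * ratio s a (Suc j)"
  proof -
    have "ratio (s + 1) a (Suc j) = (s + 1) * ratio s a j / (a + real j)"
      using Suc \<open>a + real j \<noteq> 0\<close> by (simp add: eq_divide_eq)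
    then show ?thesis unfolding ratio_Suc[of s _ j] by simp
  qed
  finally show ?case .
qed

text \<open>Telescoping of the denominators, starting from the moment recurrence. It links the odd
  moment formula with the even one for the same s and j.\<close>

lemma moment_ratio:
  "moment (Suc s) * ratio (real s) (real s + 1 + n / 2) j * (real s + n / 2 + real j) = moment s * ratio (real s) (real s + n / 2) j * (real s + 1/2)"
proof (induction j)
  case 0
  have "real s + n / 2 \<noteq> 0" using n_ge by auto
  then show ?case by (simp add: ratio_def moment_Suc)
next
  case (Suc j)
  have nz: "real s + n / 2 + real j \<noteq> 0" "real s + 1 + n / 2 + real j \<noteq> 0" using n_ge by auto
  have "moment (Suc s) * ratio (real s) (real s + 1 + n / 2) (Suc j) * (real s + n / 2 + real (Suc j))
      = moment (Suc s) * ratio (real s) (real s + 1 + n / 2) j * (real s + n / 2 + real j) * ((real s - real j) / (real s + n / 2 + real j))"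
    unfolding ratio_Suc using nz by (simp add: divide_simps) (simp add: algebra_simps)
  also have "\<dots> = moment s * ratio (real s) (real s + n / 2) (Suc j) * (real s + 1/2)"
    unfolding Suc ratio_Suc by simp
  finally show ?case .
qed

text \<open>The recurrence expresses P_(j+2) by t P_(j+1) and P_j, and multiplication by t changes
  the parity and raises the power. Both parities are therefore treated in one induction, for all s
  at once.\<close>

lemma L_monom_mult_zonal:
  "L (monom 1 (2 * s) * P (2 * j)) = moment s * ratio (real s) (real s + n / 2) j"
  "L (monom 1 (Suc (2 * s)) * P (Suc (2 * j))) = moment (Suc s) * ratio (real s) (real s + 1 + n / 2) j"
proof -
  have X: "[:0, 1:] * monom 1 l = monom (1 :: real) (Suc l)" for l by (simp add: monom_Suc)
  have rec: "(n + real j - 1) * L (monom 1 l * P (Suc (Suc j)))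
      = (2 * real j + n) * L (monom 1 (Suc l) * P (Suc j)) - (real j + 1) * L (monom 1 l * P j)" for l j
  proof -
    have "smult (n + real j - 1) (monom 1 l * P (Suc (Suc j)))
        = smult (2 * real j + n) ([:0, 1:] * monom 1 l * P (Suc j)) - smult (real j + 1) (monom 1 l * P j)"
      using n_ge by (simp add: zonal.simps(3) algebra_simps)
    from arg_cong[OF this, of L] show ?thesis by (simp only: L_simps X)
  qed
  have "(\<forall>s. L (monom 1 (2 * s) * P (2 * j)) = moment s * ratio (real s) (real s + n / 2) j) \<and>
    (\<forall>s. L (monom 1 (Suc (2 * s)) * P (Suc (2 * j))) = moment (Suc s) * ratio (real s) (real s + 1 + n / 2) j)"
  proof (induction j)
    case 0
    have "monom 1 (Suc (2 * s)) * [:0, 1:] = monom (1 :: real) (2 * Suc s)" for s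
      using X[of "Suc (2 * s)"] by (simp add: mult.commute)
    then show ?case by (simp add: ratio_def moment_def)
  next
    case (Suc j)
    have E: "L (monom 1 (2 * s) * P (2 * Suc j)) = moment s * ratio (real s) (real s + n / 2) (Suc j)" for s
    proof -
      define x y where "x = moment (Suc s) * ratio (real s) (real s + 1 + n / 2) j" and "y = moment s * ratio (real s) (real s + n / 2) j"
      have nz: "n + 2 * real j - 1 \<noteq> 0" "real s + n / 2 + real j \<noteq> 0" using n_ge by auto
      have "(n + 2 * real j - 1) * L (monom 1 (2 * s) * P (2 * Suc j)) = (4 * real j + n) * x - (2 * real j + 1) * y"
        using rec[of "2 * j" "2 * s"] Suc by (simp add: x_def y_def)
      moreover have "x = y * (real s + 1/2) / (real s + n / 2 + real j)"
        using moment_ratio[of s j] nz by (simp add: x_def y_def field_simps)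
      moreover have "(4 * real j + n) * (y * (real s + 1/2) / (real s + n / 2 + real j)) - (2 * real j + 1) * y
          = (n + 2 * real j - 1) * (y * ((real s - real j) / (real s + n / 2 + real j)))"
        using nz by (simp add: divide_simps) (simp add: algebra_simps)
      ultimately have "(n + 2 * real j - 1) * L (monom 1 (2 * s) * P (2 * Suc j))
          = (n + 2 * real j - 1) * (y * ((real s - real j) / (real s + n / 2 + real j)))" by simp
      then have "L (monom 1 (2 * s) * P (2 * Suc j)) = y * ((real s - real j) / (real s + n / 2 + real j))"
        using mult_left_cancel[OF nz(1)] by blast
      then show ?thesis by (simp add: ratio_Suc y_def)
    qed
    moreover have "L (monom 1 (Suc (2 * s)) * P (Suc (2 * Suc j))) = moment (Suc s) * ratio (real s) (real s + 1 + n / 2) (Suc j)" for s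
    proof -
      define z where "z = moment (Suc s) * ratio (real s) (real s + 1 + n / 2) j"
      define a where "a = real s + 1 + n / 2"
      have nz: "n + 2 * real j \<noteq> 0" "a + real j \<noteq> 0" "a > 0" using n_ge by (auto simp: a_def)
      \<comment> \<open>The even formula at s + 1 belongs to the same a, since (s + 1) + n/2 = a; so
        it is a multiple of z.\<close>
      have "moment (Suc s) * ratio (real (Suc s)) (real (Suc s) + n / 2) (Suc j) = z * ((real s + 1) / (a + real j))"
        using ratio_shift[OF nz(3), of s j] nz by (simp add: z_def a_def field_simps)
      then have "(n + 2 * real j) * L (monom 1 (Suc (2 * s)) * P (Suc (2 * Suc j)))
          = (4 * real j + 2 + n) * (z * ((real s + 1) / (a + real j))) - (2 * real j + 2) * z"
      proof -
        assume E': "moment (Suc s) * ratio (real (Suc s)) (real (Suc s) + n / 2) (Suc j) = z * ((real s + 1) / (a + real j))"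
        have c: "n + real (Suc (2 * j)) - 1 = n + 2 * real j" "2 * real (Suc (2 * j)) + n = 4 * real j + 2 + n"
          "real (Suc (2 * j)) + 1 = 2 * real j + 2" "Suc (Suc (2 * s)) = 2 * Suc s" "Suc (Suc (2 * j)) = 2 * Suc j"
          "L (monom 1 (Suc (2 * s)) * P (Suc (2 * j))) = z"
          using Suc by (simp_all add: z_def)
        from rec[of "Suc (2 * j)" "Suc (2 * s)"] show ?thesis unfolding c E E' .
      qed
      also have "\<dots> = (n + 2 * real j) * (z * ((real s - real j) / (a + real j)))"
        using nz by (simp add: divide_simps) (simp add: a_def algebra_simps)
      finally have "L (monom 1 (Suc (2 * s)) * P (Suc (2 * Suc j))) = z * ((real s - real j) / (a + real j))"
        using mult_left_cancel[OF nz(1)] by blast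
      then show ?thesis by (simp add: ratio_Suc z_def a_def)
    qed
    ultimately show ?case by blast
  qed
  then show "L (monom 1 (2 * s) * P (2 * j)) = moment s * ratio (real s) (real s + n / 2) j"
    "L (monom 1 (Suc (2 * s)) * P (Suc (2 * j))) = moment (Suc s) * ratio (real s) (real s + 1 + n / 2) j" by auto
qed

text \<open>If l and j have the same parity, the closed form contains the factor s - s = 0;
  otherwise the integrand is odd.\<close>

lemma L_monom_mult_zonal_eq_0:
  assumes "l < j"
  shows "L (monom 1 l * P j) = 0"
proof (cases "even (l + j)")
  case True
  have zero: "ratio (real s) a r = 0" if "s < r" for s a r
    unfolding ratio_def using that by (intro prod_zero) auto
  show ?thesis
  proof (cases "even l")
    case True
    with \<open>even (l + j)\<close> obtain s r where "l = 2 * s" "j = 2 * r" by (auto elim!: evenE)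
    then show ?thesis using assms L_monom_mult_zonal(1)[of s r] zero by simp
  next
    case False
    with \<open>even (l + j)\<close> obtain s r where "l = Suc (2 * s)" "j = Suc (2 * r)" by (auto elim!: oddE)
    then show ?thesis using assms L_monom_mult_zonal(2)[of s r] zero by simp
  qed
qed (simp add: L_monom_mult_zonal_parity)

lemma L_mult_zonal_eq_0:
  assumes "degree p < j"
  shows "L (p * P j) = 0"
proof -
  have "p * P j = (\<Sum>l\<le>degree p. smult (coeff p l) (monom 1 l * P j))"
    by (subst poly_as_sum_of_monoms[symmetric]) (simp add: sum_distrib_right smult_monom flip: mult_smult_left)
  also have "L \<dots> = 0" using assms by (simp add: L_simps L_monom_mult_zonal_eq_0)
  finally show ?thesis .
qed

lemma L_zonal_orthogonal: "j \<noteq> l \<Longrightarrow> L (P j * P l) = 0"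
  using L_mult_zonal_eq_0[of "P j" l] L_mult_zonal_eq_0[of "P l" j] degree_zonal[of n j] degree_zonal[of n l]
  by (cases "j < l") (auto simp: mult.commute)

lemma d_eq: "d j = (2 * real j + n - 2) / (n - 2) * (pochhammer (n - 2) j / fact j)"
  using dim_harmonic_eq[OF dim_ge, of j] by (simp add: d_def n_def)

lemma d_0: "d 0 = 1"
  using n_ge by (simp add: d_eq)

lemma d_pos: "d j > 0"
  using n_ge by (auto simp: d_eq pochhammer_pos)

lemma d_Suc: "d (Suc j) = d j * ((2 * real j + n) * (n - 2 + real j) / ((2 * real j + n - 2) * (real j + 1)))"
proof -
  have "n - 2 \<noteq> 0" "2 * real j + n - 2 \<noteq> 0" "real j + 1 \<noteq> 0" using n_ge by auto
  then show ?thesis by (simp add: d_eq pochhammer_Suc divide_simps)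
qed

text \<open>Here the three-term recurrence is applied to t P_(j+1), in the next lemma to t P_j.
  Equating the two values of one integral gives the ratio of consecutive square norms.\<close>

lemma L_X_mult_zonal: "L ([:0, 1:] * P j * P (Suc j)) = (real j + 1) / (2 * real j + n) * L (P j * P j)"
proof -
  have "smult (2 * real (Suc j) + n - 2) ([:0, 1:] * P j * P (Suc j))
      = smult (n + real (Suc j) - 2) (P (Suc (Suc j)) * P j) + smult (real (Suc j)) (P j * P j)"
    using arg_cong[OF zonal_three_term[of n "Suc j"], of "\<lambda>p. p * P j"] n_ge
    by (simp add: distrib_right distrib_left mult_ac del: mult_pCons_left mult_pCons_right)
  from arg_cong[OF this, of L] show ?thesis
    using n_ge by (simp add: L_simps L_zonal_orthogonal field_simps del: mult_pCons_left mult_pCons_right)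
qed

lemma L_X_mult_zonal': "L ([:0, 1:] * P j * P (Suc j)) = (n + real j - 2) / (2 * real j + n - 2) * L (P (Suc j) * P (Suc j))"
proof -
  have "smult (2 * real j + n - 2) ([:0, 1:] * P j * P (Suc j))
      = smult (n + real j - 2) (P (Suc j) * P (Suc j)) + smult (real j) (P (j - 1) * P (Suc j))"
    using arg_cong[OF zonal_three_term[of n j], of "\<lambda>p. p * P (Suc j)"] n_ge
    by (simp add: distrib_right distrib_left mult_ac del: mult_pCons_left mult_pCons_right)
  from arg_cong[OF this, of L] show ?thesis
    using n_ge by (simp add: L_simps L_zonal_orthogonal field_simps del: mult_pCons_left mult_pCons_right)
qed

text \<open>The ratio of consecutive square norms is the inverse of the ratio of consecutive
  dimensions. Here the dimensions found from the Laplacian meet the Gegenbauer recurrence.\<close>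

lemma L_zonal_square: "L (P j * P j) = L 1 / d j"
proof (induction j)
  case 0
  then show ?case by (simp add: d_0)
next
  case (Suc j)
  have nz: "n + real j - 2 \<noteq> 0" "2 * real j + n - 2 \<noteq> 0" "2 * real j + n \<noteq> 0" "real j + 1 \<noteq> 0" "d j \<noteq> 0" "n - 2 + real j \<noteq> 0"
    using n_ge d_pos[of j] by auto
  have "L (P (Suc j) * P (Suc j)) = (2 * real j + n - 2) / (n + real j - 2) * ((real j + 1) / (2 * real j + n) * (L 1 / d j))"
  proof -
    have solve: "Y = b / a * Z" if "Z = a / b * Y" "a \<noteq> 0" "b \<noteq> 0" for a b Y Z :: real
      using that by simp
    show ?thesis
      using L_X_mult_zonal'[of j] nz(1,2) unfolding L_X_mult_zonal Suc by (rule solve)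
  qed
  also have "\<dots> = L 1 / d (Suc j)"
    unfolding d_Suc using nz by (simp add: divide_simps)
  finally show ?case .
qed

lemma normalized_gegenbauer_eq: "normalized_gegenbauer TYPE('n) j = smult (d j / L 1) (P j)"
proof -
  have r: "pochhammer (n - 2) j / fact j \<noteq> 0" using n_ge by (auto simp: pochhammer_eq_0_iff)
  have "gegenbauer ((real CARD('n) - 2) / 2) j = smult (pochhammer (n - 2) j / fact j) (P j)"
    using gegenbauer_eq_zonal[of n j] n_ge by (simp add: n_def)
  moreover have "measure (sphere_area :: (real^'n) measure) (sphere 0 1) = L 1" by (simp add: L_def)
  ultimately show ?thesis
    using r n_ge by (simp add: normalized_gegenbauer_def Let_def poly_zonal_1 d_def[symmetric])
qed

text \<open>By the square norms, L(g_j P_l) is 1 for j = l and 0 otherwise, so P_j reads off the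
  coefficient of g_j. Existence and uniqueness of the expansion are both established, as the
  coefficients are given by a definite description; beyond the degree both sides are 0.\<close>

lemma gegenbauer_coeff_eq: "gegenbauer_coeff TYPE('n) h j = L (h * P j)"
proof -
  let ?Q = "\<lambda>l. (\<forall>j>degree h. l j = 0) \<and> h = (\<Sum>j\<le>degree h. smult (l j) (normalized_gegenbauer TYPE('n) j))"
  have nz: "L 1 \<noteq> 0" "d j \<noteq> 0" for j using L_1_pos d_pos[of j] by auto
  have uniq: "l = (\<lambda>j. L (h * P j))" if l: "?Q l" for l
  proof
    fix m
    show "l m = L (h * P m)"
    proof (cases "m \<le> degree h")
      case True
      have "L (h * P m) = (\<Sum>j\<le>degree h. l j * (d j / L 1) * L (P j * P m))"
        by (subst conjunct2[OF l]) (simp add: sum_distrib_right L_simps normalized_gegenbauer_eq)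
      also have "\<dots> = (\<Sum>j\<le>degree h. if j = m then l m else 0)"
        using nz by (intro sum.cong) (auto simp: L_zonal_orthogonal L_zonal_square)
      also have "\<dots> = l m" using True by simp
      finally show ?thesis by simp
    qed (use l L_mult_zonal_eq_0 in auto)
  qed
  obtain c where c: "h = (\<Sum>j\<le>degree h. smult (c j) (P j))"
    using zonal_expansion[of n h "degree h"] n_ge by auto
  define l where "l j = (if j \<le> degree h then c j * L 1 / d j else 0)" for j
  have "(\<Sum>j\<le>degree h. smult (l j) (normalized_gegenbauer TYPE('n) j)) = (\<Sum>j\<le>degree h. smult (c j) (P j))"
    using nz by (intro sum.cong) (auto simp: l_def normalized_gegenbauer_eq)
  then have "?Q l" using c by (auto simp: l_def)
  then have "gegenbauer_coeff TYPE('n) h = l"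
    unfolding gegenbauer_coeff_def using uniq by (intro the_equality) auto
  with uniq[OF \<open>?Q l\<close>] show ?thesis by simp
qed

end

section \<open>The bound 1 for the zonal polynomials on [-1, 1]\<close>

text \<open>The coefficients of \<open>(1 - 2 t X + X\<^sup>2)\<^bsup>-\<alpha>\<^esup> = (1 - z X)\<^bsup>-\<alpha>\<^esup> (1 - w X)\<^bsup>-\<alpha>\<^esup>\<close>,
  where \<open>z + w = 2 t\<close> and \<open>z w = 1\<close>, are nonnegative combinations of the numbers \<open>z\<^sup>a w\<^sup>b\<close>.\<close>

lemma gegenbauer_complex:
  fixes z w :: complex and \<alpha> t :: real
  assumes zw: "z * w = 1" "z + w = 2 * of_real t"
  defines "c \<equiv> \<lambda>a. pochhammer \<alpha> a / fact a"
  shows "of_real (poly (gegenbauer \<alpha> j) t)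
    = (\<Sum>a\<le>j. of_real (c a * c (j - a)) * z ^ a * w ^ (j - a))"
proof -
  define F where "F u = Abs_fps (\<lambda>a. of_real (c a) * u ^ a)" for u :: complex
  define G where "G = F z * F w"
  have c_Suc: "(real a + 1) * c (Suc a) = (\<alpha> + real a) * c a" for a
    by (simp add: c_def pochhammer_Suc divide_simps)
  \<comment> \<open>The binomial series (1 - u X)^(-\<alpha>) is handled through its first-order
    differential equation.\<close>
  have F: "(1 - fps_const u * fps_X) * fps_deriv (F u) = fps_const (of_real \<alpha> * u) * F u" for u
  proof (rule fps_ext)
    fix a
    have "fps_nth ((1 - fps_const u * fps_X) * fps_deriv (F u)) a
        = of_real ((real a + 1) * c (Suc a)) * u ^ Suc a - of_real (real a * c a) * u ^ Suc a"
      by (cases a) (simp_all add: F_def left_diff_distrib mult.assoc algebra_simps)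
    also have "\<dots> = fps_nth (fps_const (of_real \<alpha> * u) * F u) a"
      unfolding c_Suc by (simp add: F_def algebra_simps)
    finally show "fps_nth ((1 - fps_const u * fps_X) * fps_deriv (F u)) a
        = fps_nth (fps_const (of_real \<alpha> * u) * F u) a" .
  qed
  let ?t = "of_real t :: complex"
  have quad: "(1 - fps_const z * fps_X) * (1 - fps_const w * fps_X) = 1 - fps_const (2 * ?t) * fps_X + fps_X * fps_X"
  proof -
    have "(1 - fps_const z * fps_X) * (1 - fps_const w * fps_X)
        = 1 - fps_const (z + w) * fps_X + fps_const (z * w) * (fps_X * fps_X)"
      by (simp add: algebra_simps flip: fps_const_add fps_const_mult)
    then show ?thesis by (simp add: zw)
  qed
  have "(1 - fps_const z * fps_X) * (1 - fps_const w * fps_X) * fps_deriv G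
      = (1 - fps_const w * fps_X) * ((1 - fps_const z * fps_X) * fps_deriv (F z)) * F w
        + (1 - fps_const z * fps_X) * ((1 - fps_const w * fps_X) * fps_deriv (F w)) * F z"
  proof -
    have "A * B * (f * g' + f' * g) = B * (A * f') * g + A * (B * g') * f" for A B f g f' g' :: "complex fps"
      by (simp add: algebra_simps)
    then show ?thesis unfolding G_def fps_deriv_mult .
  qed
  also have "\<dots> = fps_const (of_real \<alpha>) * (fps_const (z + w) - fps_const 2 * fps_const (z * w) * fps_X) * G"
    unfolding F G_def by (simp add: algebra_simps flip: fps_const_add fps_const_mult numeral_fps_const)
  \<comment> \<open>The differential equation of the generating function; its coefficient at X^(j+1)
    is the Gegenbauer recurrence.\<close>
  finally have ode: "(1 - fps_const (2 * ?t) * fps_X + fps_X * fps_X) * fps_deriv G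
      = fps_const (2 * of_real \<alpha> * ?t) * G - fps_const (2 * of_real \<alpha>) * (fps_X * G)"
    unfolding quad zw by (simp add: algebra_simps flip: fps_const_mult)
  have rec: "(of_nat j + 2) * fps_nth G (Suc (Suc j))
      = 2 * ?t * (of_nat j + 1 + of_real \<alpha>) * fps_nth G (Suc j) - (of_nat j + 2 * of_real \<alpha>) * fps_nth G j" for j
    using arg_cong[OF ode, of "\<lambda>f. fps_nth f (Suc j)"]
    by (cases j) (simp_all add: distrib_right left_diff_distrib mult.assoc algebra_simps)
  have G0: "fps_nth G 0 = 1" "fps_nth G (Suc 0) = 2 * of_real \<alpha> * ?t"
  proof -
    show "fps_nth G 0 = 1" by (simp add: G_def F_def c_def)
    have "fps_nth G (Suc 0) = of_real \<alpha> * (z + w)"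
      by (simp add: G_def F_def c_def fps_mult_nth algebra_simps)
    then show "fps_nth G (Suc 0) = 2 * of_real \<alpha> * ?t" by (simp add: zw)
  qed
  have "of_real (poly (gegenbauer \<alpha> j) t) = fps_nth G j"
  proof (induction j rule: induct_nat_012)
    case (ge2 j)
    have nz: "(of_nat j + 2 :: complex) \<noteq> 0" by (metis of_nat_0_neq add_2_eq_Suc' of_nat_add of_nat_numeral of_nat_eq_0_iff nat.distinct(2))
    have "(real j + 2) * poly (gegenbauer \<alpha> (Suc (Suc j))) t
        = 2 * t * (real j + 1 + \<alpha>) * poly (gegenbauer \<alpha> (Suc j)) t - (real j + 2 * \<alpha>) * poly (gegenbauer \<alpha> j) t"
    proof -
      have "real (j + 2) * (1 / real (j + 2) * y) = y" for y by simp
      then have "real (j + 2) * poly (gegenbauer \<alpha> (Suc (Suc j))) t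
          = t * (2 * (real (j + 2) + \<alpha> - 1)) * poly (gegenbauer \<alpha> (Suc j)) t
            - (real (j + 2) + 2 * \<alpha> - 2) * poly (gegenbauer \<alpha> j) t"
        unfolding gegenbauer.simps poly_smult poly_diff by simp
      then show ?thesis by (simp add: algebra_simps)
    qed
    from arg_cong[OF this, of complex_of_real]
    have "(of_nat j + 2) * of_real (poly (gegenbauer \<alpha> (Suc (Suc j))) t)
        = 2 * ?t * (of_nat j + 1 + of_real \<alpha>) * fps_nth G (Suc j) - (of_nat j + 2 * of_real \<alpha>) * fps_nth G j"
      by (simp only: of_real_mult of_real_add of_real_diff of_real_of_nat_eq of_real_numeral of_real_1 ge2)
    also have "\<dots> = (of_nat j + 2) * fps_nth G (Suc (Suc j))" by (rule rec[symmetric])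
    finally show ?case using nz mult_left_cancel by blast
  qed (use G0 in auto)
  also have "fps_nth G j = (\<Sum>a\<le>j. of_real (c a * c (j - a)) * z ^ a * w ^ (j - a))"
    unfolding G_def fps_mult_nth atMost_atLeast0 by (intro sum.cong) (simp_all add: F_def)
  finally show ?thesis .
qed

text \<open>For \<bar>t\<bar> \<le> 1 the numbers z and w are conjugate points of the unit circle.
  The triangle inequality bounds the sum by the sum of its nonnegative coefficients, which is the
  value for z = w = 1, that is, for t = 1.\<close>

lemma gegenbauer_abs_le:
  assumes "\<alpha> > 0" "\<bar>t\<bar> \<le> 1"
  shows "\<bar>poly (gegenbauer \<alpha> j) t\<bar> \<le> poly (gegenbauer \<alpha> j) 1"
proof -
  define c where "c a = pochhammer \<alpha> a / fact a" for a
  have c: "c a \<ge> 0" for a using assms by (simp add: c_def pochhammer_nonneg)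
  define z where "z = Complex t (sqrt (1 - t\<^sup>2))"
  have t: "t\<^sup>2 \<le> 1" using assms(2) by (simp add: abs_square_le_1)
  then have norm: "cmod z = 1" by (simp add: z_def cmod_def)
  have "z * cnj z = 1" using complex_norm_square[of z] norm by simp
  moreover have "z + cnj z = 2 * of_real t" by (simp add: z_def complex_add_cnj)
  ultimately have "complex_of_real (poly (gegenbauer \<alpha> j) t) = (\<Sum>a\<le>j. of_real (c a * c (j - a)) * z ^ a * cnj z ^ (j - a))"
    unfolding c_def by (rule gegenbauer_complex)
  then have "\<bar>poly (gegenbauer \<alpha> j) t\<bar> = cmod (\<Sum>a\<le>j. of_real (c a * c (j - a)) * z ^ a * cnj z ^ (j - a))"
    by (metis norm_of_real)
  also have "\<dots> \<le> (\<Sum>a\<le>j. c a * c (j - a))"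
    by (rule sum_norm_le) (simp add: norm_mult norm_power norm c)
  also have "\<dots> = poly (gegenbauer \<alpha> j) 1"
  proof -
    have "complex_of_real (poly (gegenbauer \<alpha> j) 1) = (\<Sum>a\<le>j. of_real (c a * c (j - a)) * 1 ^ a * 1 ^ (j - a))"
      unfolding c_def by (rule gegenbauer_complex) auto
    also have "\<dots> = complex_of_real (\<Sum>a\<le>j. c a * c (j - a))" by simp
    finally show ?thesis by (simp only: of_real_eq_iff)
  qed
  finally show ?thesis .
qed

lemma zonal_abs_le_1:
  assumes "n > 2" "\<bar>t\<bar> \<le> 1"
  shows "\<bar>poly (zonal n j) t\<bar> \<le> 1"
proof -
  define r where "r = pochhammer (n - 2) j / fact j"
  have r: "r > 0" using assms by (simp add: r_def pochhammer_pos)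
  have "\<bar>r * poly (zonal n j) t\<bar> \<le> r * poly (zonal n j) 1"
    using gegenbauer_abs_le[of "(n - 2) / 2" t j] assms unfolding gegenbauer_eq_zonal[OF assms(1)]
    by (simp add: r_def)
  then show ?thesis using r assms by (simp add: poly_zonal_1 abs_mult)
qed

section \<open>The Frobenius threshold of the power kernel\<close>

context sphere_axis
begin

text \<open>Used to bound the number k of terms by D in the upper estimate of the threshold. For n
  \<ge> 3 the quotient of consecutive dimensions is at least (j + 2)/(j + 1).\<close>

lemma d_ge: "d j \<ge> real j + 1"
proof (induction j)
  case 0
  then show ?case by (simp add: d_0)
next
  case (Suc j)
  have pos: "2 * real j + n - 2 > 0" using n_ge by simp
  have "(real j + 2) * (2 * real j + n - 2) \<le> (2 * real j + n) * (n - 2 + real j)"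
  proof -
    have "(2 * real j + n) * (n - 2 + real j) - (real j + 2) * (2 * real j + n - 2)
        = (2 * n - 6) * real j + (n - 2)\<^sup>2"
      by (simp add: algebra_simps power2_eq_square)
    also have "\<dots> \<ge> 0" using n_ge by (intro add_nonneg_nonneg mult_nonneg_nonneg) auto
    finally show ?thesis by simp
  qed
  then have "real (Suc j) + 1 \<le> (real j + 1) * ((2 * real j + n) * (n - 2 + real j) / ((2 * real j + n - 2) * (real j + 1)))"
    (is "_ \<le> (real j + 1) * ?x")
  proof -
    have "(real j + 1) * ?x = (2 * real j + n) * (n - 2 + real j) / (2 * real j + n - 2)" by simp
    moreover assume "(real j + 2) * (2 * real j + n - 2) \<le> (2 * real j + n) * (n - 2 + real j)"
    ultimately show ?thesis using pos by (simp add: pos_le_divide_eq add.commute)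
  qed
  also have "\<dots> \<le> d j * ((2 * real j + n) * (n - 2 + real j) / ((2 * real j + n - 2) * (real j + 1)))"
    using Suc n_ge by (intro mult_right_mono divide_nonneg_nonneg mult_nonneg_nonneg) auto
  finally show ?case by (simp add: d_Suc)
qed

text \<open>The bound 4 is chosen for its root 2, which turns n/(2 s) into n/s in the lower
  estimate.\<close>

lemma d_2_ge: "d 2 \<ge> 4"
proof -
  have "d (Suc 0) = n" using n_ge d_Suc[of 0] by (simp add: d_0)
  then have "d 2 = (n + 2) * (n - 1) / 2"
    using n_ge d_Suc[of 1] by (simp add: numeral_2_eq_2 add.commute)
  moreover have "5 * 2 \<le> (n + 2) * (n - 1)" using n_ge by (intro mult_mono) auto
  ultimately show ?thesis by simp
qed

lemma max_dim_ge: "j \<le> k \<Longrightarrow> d (2 * j) \<le> real (max_dim_harmonic TYPE('n) k)"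
  unfolding max_dim_harmonic_def d_def of_nat_le_iff by (intro Max_ge) auto

lemma frobenius_threshold_eq:
  "frobenius_threshold TYPE('n) k h = (if \<exists>j\<le>k. L (h * P (2 * j)) = 0 then \<infinity>
     else ereal (sqrt (\<Sum>j\<le>k. d (2 * j) * (1 / L (h * P (2 * j)) - 1)\<^sup>2)))"
  by (simp add: frobenius_threshold_def gegenbauer_coeff_eq d_def)

lemma L_power_kernel: "L (power_kernel i s * P (2 * j)) = ratio (real s) (real s + n / 2) j"
proof -
  have "power_kernel i s = smult (1 / moment s) (monom 1 (2 * s))"
    by (simp add: power_kernel_def moment_def L_def poly_monom)
  then show ?thesis using moment_pos[of s] by (simp add: L_smult L_monom_mult_zonal(1))
qed

lemma ratio_pos: "j \<le> s \<Longrightarrow> ratio (real s) (real s + n / 2) j > 0"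
  using n_ge by (auto simp: ratio_def intro!: prod_pos divide_pos_pos)

lemma inverse_ratio_Suc:
  "1 / ratio (real s) (real s + n / 2) (Suc j)
    = 1 / ratio (real s) (real s + n / 2) j * ((real s + n / 2 + real j) / (real s - real j))"
  by (simp add: ratio_Suc)

lemma inverse_ratio_mono:
  assumes "j \<le> l" "l \<le> s"
  shows "1 / ratio (real s) (real s + n / 2) j \<le> 1 / ratio (real s) (real s + n / 2) l"
  using assms
proof (induction l rule: dec_induct)
  case (step l)
  have "1 \<le> (real s + n / 2 + real l) / (real s - real l)" using step n_ge by (simp add: field_simps)
  then have "1 / ratio (real s) (real s + n / 2) l * 1 \<le> 1 / ratio (real s) (real s + n / 2) (Suc l)"
    unfolding inverse_ratio_Suc using ratio_pos[of l s] step by (intro mult_left_mono) auto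
  then show ?case using step by simp
qed simp

text \<open>Each factor (s + n/2 + l)/(s - l) is 1 + (n/2 + 2 l)/s + O(1/s^2), and the numbers n/2 +
  2 l for l < j add up to j (j - 1) + j n/2. The condition s > 2 j keeps s - l above s/2, which
  makes the constants uniform in s.\<close>

lemma inverse_ratio_asymp:
  "\<exists>C. \<forall>s>2*j. \<bar>1 / ratio (real s) (real s + n / 2) j - 1 - (real j * (real j - 1) + real j * n / 2) / real s\<bar>
    \<le> C / (real s)\<^sup>2"
proof (induction j)
  case 0
  then show ?case by (intro exI[of _ 0]) (simp add: ratio_def)
next
  case (Suc j)
  define c b where "c = real j * (real j - 1) + real j * n / 2" and "b = n / 2 + 2 * real j"
  obtain C where C: "\<And>s. s > 2 * j \<Longrightarrow> \<bar>1 / ratio (real s) (real s + n / 2) j - 1 - c / real s\<bar> \<le> C / (real s)\<^sup>2"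
    using Suc unfolding c_def by auto
  have b: "b \<ge> 0" using n_ge by (simp add: b_def)
  have c: "c \<ge> 0" unfolding c_def using n_ge by (cases j) auto
  \<comment> \<open>Bounds the remainder b j / (s (s - j)) of the new factor by R / s^2, using s - j
    \<ge> s/2.\<close>
  define R where "R = 2 * b * real j"
  have R: "R \<ge> 0" using b by (simp add: R_def)
  have "\<bar>1 / ratio (real s) (real s + n / 2) (Suc j) - 1 - (c + b) / real s\<bar>
      \<le> (c * b + C * (1 + b + R) + R * (1 + c)) / (real s)\<^sup>2" if s: "s > 2 * Suc j" for s
  proof -
    define u where "u = 1 / ratio (real s) (real s + n / 2) j"
    define e where "e = u - 1 - c / real s"
    define v where "v = (real s + n / 2 + real j) / (real s - real j)"
    define r where "r = v - 1 - b / real s"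
    have s0: "real s > 0" "real s \<ge> 1" "real s - real j > 0" using s by auto
    have e: "\<bar>e\<bar> \<le> C / (real s)\<^sup>2" unfolding e_def u_def using C s by simp
    have "r = b * real j / (real s * (real s - real j))"
      using s0 by (simp add: r_def v_def b_def field_simps)
    also have "\<dots> \<le> b * real j / (real s * (real s / 2))"
      using s0 s b by (intro divide_left_mono mult_left_mono mult_nonneg_nonneg mult_pos_pos) auto
    also have "\<dots> = R / (real s)\<^sup>2" by (simp add: R_def power2_eq_square)
    finally have r: "r \<le> R / (real s)\<^sup>2" .
    have r0: "r \<ge> 0"
      unfolding \<open>r = b * real j / (real s * (real s - real j))\<close> using s0 b by simp
    have le1: "x / real s \<le> x" if "x \<ge> 0" for x using s0 that by (simp add: divide_le_eq mult_le_cancel_left1)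
    have "R / (real s)\<^sup>2 \<le> R" using s0 R by (simp add: divide_le_eq mult_le_cancel_left1)
    then have "r \<le> R" using r by simp
    have "1 / ratio (real s) (real s + n / 2) (Suc j) = (1 + c / real s + e) * (1 + b / real s + r)"
      unfolding inverse_ratio_Suc by (simp add: e_def u_def r_def v_def)
    then have "1 / ratio (real s) (real s + n / 2) (Suc j) - 1 - (c + b) / real s
        = c * b / (real s)\<^sup>2 + e * (1 + b / real s + r) + r * (1 + c / real s)"
      by (simp add: algebra_simps power2_eq_square add_divide_distrib)
    also have "\<bar>\<dots>\<bar> \<le> c * b / (real s)\<^sup>2 + C / (real s)\<^sup>2 * (1 + b + R) + R / (real s)\<^sup>2 * (1 + c)"
    proof -
      have "\<bar>c * b / (real s)\<^sup>2\<bar> = c * b / (real s)\<^sup>2" using b c by simp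
      moreover have "\<bar>e * (1 + b / real s + r)\<bar> \<le> C / (real s)\<^sup>2 * (1 + b + R)"
        unfolding abs_mult using e le1[OF b] b r0 \<open>r \<le> R\<close> s0 by (intro mult_mono) auto
      moreover have "\<bar>r * (1 + c / real s)\<bar> \<le> R / (real s)\<^sup>2 * (1 + c)"
        unfolding abs_mult using r le1[OF c] c r0 s0 by (intro mult_mono) auto
      moreover have "\<bar>x + y + z\<bar> \<le> X + Y + Z" if "\<bar>x\<bar> = X" "\<bar>y\<bar> \<le> Y" "\<bar>z\<bar> \<le> Z" for x y z X Y Z :: real
        using that by linarith
      ultimately show ?thesis by blast
    qed
    also have "\<dots> = (c * b + C * (1 + b + R) + R * (1 + c)) / (real s)\<^sup>2"
      by (simp add: add_divide_distrib)
    finally show ?thesis .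
  qed
  moreover have "c + b = real (Suc j) * (real (Suc j) - 1) + real (Suc j) * n / 2"
    by (simp add: c_def b_def field_simps)
  ultimately show ?case by metis
qed

text \<open>The term j = 1 suffices: 1/\<lambda>_2 - 1 is exactly n/(2 s), and dim H_2 \<ge> 4 gives
  n/s, which is at least (1 + n/2)/s. The lower bound thus holds with error term 0.\<close>

lemma power_kernel_lower:
  assumes k: "k \<ge> 1" and s: "s > k"
  shows "ereal ((1 + n / 2) / real s) \<le> frobenius_threshold TYPE('n) k (power_kernel i s)"
proof -
  let ?r = "\<lambda>j. ratio (real s) (real s + n / 2) j"
  have "?r j \<noteq> 0" if "j \<le> k" for j using ratio_pos[of j s] that s by simp
  moreover have "(1 + n / 2) / real s \<le> sqrt (\<Sum>j\<le>k. d (2 * j) * (1 / ?r j - 1)\<^sup>2)"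
  proof -
    have "(1 + n / 2) / real s \<le> 2 * (n / 2 / real s)" using n_ge s by (simp add: field_simps)
    also have "\<dots> = sqrt (4 * (n / 2 / real s)\<^sup>2)" using n_ge by (simp add: real_sqrt_mult)
    also have "\<dots> \<le> sqrt (d 2 * (1 / ?r 1 - 1)\<^sup>2)"
    proof -
      have "1 / ?r 1 - 1 = n / 2 / real s" using s n_ge by (simp add: ratio_def field_simps)
      then show ?thesis using d_2_ge by (simp add: mult_right_mono)
    qed
    also have "\<dots> \<le> sqrt (\<Sum>j\<le>k. d (2 * j) * (1 / ?r j - 1)\<^sup>2)"
      using member_le_sum[of 1 "{..k}" "\<lambda>j. d (2 * j) * (1 / ?r j - 1)\<^sup>2"] k d_pos
      by (simp add: less_imp_le)
    finally show ?thesis .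
  qed
  ultimately show ?thesis by (simp add: frobenius_threshold_eq L_power_kernel)
qed

text \<open>The term j = 0 vanishes, and 1/\<lambda>_(2j) increases with j, so k equal bounds
  remain. Then k \<le> dim H_(2k) \<le> D turns the factor sqrt (k D) into D.\<close>

lemma power_kernel_upper:
  assumes k: "k \<ge> 1" and s: "s > k"
  shows "frobenius_threshold TYPE('n) k (power_kernel i s)
    \<le> ereal (real (max_dim_harmonic TYPE('n) k) * (1 / ratio (real s) (real s + n / 2) k - 1))"
proof -
  let ?r = "\<lambda>j. ratio (real s) (real s + n / 2) j"
  define D where "D = real (max_dim_harmonic TYPE('n) k)"
  have Dk: "real k \<le> D" using max_dim_ge[of k k] d_ge[of "2 * k"] by (simp add: D_def)
  have D0: "D \<ge> 0" by (simp add: D_def)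
  have u: "0 \<le> 1 / ?r j - 1" "1 / ?r j \<le> 1 / ?r k" if "j \<le> k" for j
    using inverse_ratio_mono[of 0 j s] inverse_ratio_mono[of j k s] that s by (auto simp: ratio_def[of _ _ 0])
  have "(\<Sum>j\<le>k. d (2 * j) * (1 / ?r j - 1)\<^sup>2) = (\<Sum>j\<in>{1..k}. d (2 * j) * (1 / ?r j - 1)\<^sup>2)"
    by (rule sum.mono_neutral_right) (auto simp: ratio_def not_less_eq_eq Suc_le_eq)
  also have "\<dots> \<le> (\<Sum>j\<in>{1..k}. D * (1 / ?r k - 1)\<^sup>2)"
    using max_dim_ge u D0 by (intro sum_mono mult_mono power_mono) (auto simp: D_def)
  also have "\<dots> = real k * (D * (1 / ?r k - 1)\<^sup>2)" by simp
  also have "\<dots> \<le> D * (D * (1 / ?r k - 1)\<^sup>2)"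
    using Dk D0 by (intro mult_right_mono mult_nonneg_nonneg) auto
  also have "\<dots> = (D * (1 / ?r k - 1))\<^sup>2" by (simp add: power2_eq_square)
  finally have "sqrt (\<Sum>j\<le>k. d (2 * j) * (1 / ?r j - 1)\<^sup>2) \<le> D * (1 / ?r k - 1)"
    using u[of k] D0 by (intro real_le_lsqrt) auto
  moreover have "?r j \<noteq> 0" if "j \<le> k" for j using ratio_pos[of j s] that s by simp
  ultimately show ?thesis by (simp add: frobenius_threshold_eq L_power_kernel D_def)
qed

lemma power_kernel_threshold:
  assumes k: "k \<ge> 1"
  defines "D \<equiv> real (max_dim_harmonic TYPE('n) k)"
  shows "\<exists>E1 \<in> O(\<lambda>s. 1 / (real s)\<^sup>2). \<exists>E2 \<in> O(\<lambda>s. 1 / (real s)\<^sup>2). \<forall>\<^sub>F s in sequentially.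
        ereal ((1 + n / 2) / real s + E1 s) \<le> frobenius_threshold TYPE('n) k (power_kernel i s) \<and>
        frobenius_threshold TYPE('n) k (power_kernel i s)
          \<le> ereal (D * (((real k)\<^sup>2 + real k * n / 2) / real s) + E2 s)"
proof (intro bexI)
  \<comment> \<open>The true first-order coefficient, smaller than the claimed k^2 + k n/2 by
    k.\<close>
  define c where "c = real k * (real k - 1) + real k * n / 2"
  define E where "E s = D * (1 / ratio (real s) (real s + n / 2) k - 1 - c / real s)" for s
  obtain C where C: "\<And>s. s > 2 * k \<Longrightarrow> \<bar>1 / ratio (real s) (real s + n / 2) k - 1 - c / real s\<bar> \<le> C / (real s)\<^sup>2"
    using inverse_ratio_asymp[of k] unfolding c_def by auto
  have D0: "D \<ge> 0" by (simp add: D_def)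
  show "E \<in> O(\<lambda>s. 1 / (real s)\<^sup>2)"
  proof (rule bigoI[of _ "D * C"])
    have "norm (E s) \<le> D * C * norm (1 / (real s)\<^sup>2)" if "s > 2 * k" for s
      using mult_left_mono[OF C[OF that] D0] D0 by (simp add: E_def abs_mult)
    then show "\<forall>\<^sub>F s in sequentially. norm (E s) \<le> D * C * norm (1 / (real s)\<^sup>2)"
      by (intro eventually_sequentiallyI[of "Suc (2 * k)"]) auto
  qed
  show "(\<lambda>s. 0) \<in> O(\<lambda>s. 1 / (real s)\<^sup>2)" by simp
  have "ereal ((1 + n / 2) / real s + 0) \<le> frobenius_threshold TYPE('n) k (power_kernel i s) \<and>
      frobenius_threshold TYPE('n) k (power_kernel i s)
        \<le> ereal (D * (((real k)\<^sup>2 + real k * n / 2) / real s) + E s)" if s: "s > k" for s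
  proof -
    have "c \<le> (real k)\<^sup>2 + real k * n / 2" by (simp add: c_def power2_eq_square algebra_simps)
    then have "D * (c / real s) \<le> D * (((real k)\<^sup>2 + real k * n / 2) / real s)"
      using D0 by (intro mult_left_mono divide_right_mono) auto
    then have "D * (1 / ratio (real s) (real s + n / 2) k - 1) \<le> D * (((real k)\<^sup>2 + real k * n / 2) / real s) + E s"
      by (simp add: E_def algebra_simps)
    then show ?thesis
      using power_kernel_lower[OF k s] power_kernel_upper[OF k s] unfolding D_def
      by (auto intro: order_trans)
  qed
  then show "\<forall>\<^sub>F s in sequentially.
        ereal ((1 + n / 2) / real s + 0) \<le> frobenius_threshold TYPE('n) k (power_kernel i s) \<and>
        frobenius_threshold TYPE('n) k (power_kernel i s)
          \<le> ereal (D * (((real k)\<^sup>2 + real k * n / 2) / real s) + E s)"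
    by (intro eventually_sequentiallyI[of "Suc k"]) auto
qed

section \<open>The optimal kernels\<close>

text \<open>The integral of t P_j P_(j+1), scaled by d_j d_(j+1) / L 1: the off-diagonal entry of
  the matrix of multiplication by t with respect to the polynomials d_j P_j.\<close>

definition w :: "nat \<Rightarrow> real" where "w j = d j * (n + real j - 2) / (2 * real j + n - 2)"

text \<open>This is the three-term recurrence at t = 1, where all P_j equal 1. It makes the diagonal
  entry the sum of its neighbours, so that 1 - t yields a pure Dirichlet form.\<close>

lemma w_Suc: "d (Suc j) = w j + w (Suc j)"
proof -
  have nz: "2 * real j + n - 2 \<noteq> 0" "2 * real j + n \<noteq> 0" "real j + 1 \<noteq> 0" using n_ge by auto
  have "w j = d (Suc j) * (real j + 1) / (2 * real j + n)"
  proof -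
    have "n + real j - 2 = n - 2 + real j" by simp
    then show ?thesis using nz unfolding w_def d_Suc by simp
  qed
  moreover have "w (Suc j) = d (Suc j) * (n + real j - 1) / (2 * real j + n)"
    unfolding w_def by (simp add: algebra_simps)
  moreover have "d (Suc j) * (real j + 1) / (2 * real j + n) + d (Suc j) * (n + real j - 1) / (2 * real j + n)
      = d (Suc j) * ((2 * real j + n) / (2 * real j + n))"
  proof -
    have "(real j + 1) + (n + real j - 1) = 2 * real j + n" by simp
    then show ?thesis
      unfolding add_divide_distrib[symmetric] distrib_left[symmetric] by simp
  qed
  ultimately show ?thesis using nz by simp
qed

lemma w_le: "w j \<le> d j"
  using d_pos[of j] n_ge by (simp add: w_def field_simps)

text \<open>Since d_j P_j = L 1 * g_j, constant weights x give, up to a factor, the truncated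
  expansion of a point mass at t = 1. Slowly varying x mean concentration near 1.\<close>

definition zonal_sum :: "(nat \<Rightarrow> real) \<Rightarrow> nat \<Rightarrow> real poly" where
  "zonal_sum x m = (\<Sum>j\<le>m. smult (x j * d j) (P j))"

lemma degree_zonal_sum: "degree (zonal_sum x m) \<le> m"
  unfolding zonal_sum_def
  by (intro degree_sum_le degree_smult_le[THEN order_trans] degree_zonal[THEN order_trans]) auto

lemma zonal_sum_Suc: "zonal_sum x (Suc m) = zonal_sum x m + smult (x (Suc m) * d (Suc m)) (P (Suc m))"
  by (simp add: zonal_sum_def)

lemma square_add_smult:
  "(a + smult y b) * (a + smult y b) = a * a + smult (2 * y) (a * b) + smult (y * y) (b * b)" for a b :: "real poly"
  unfolding mult_2 smult_add_left by (simp add: algebra_simps)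

lemma L_zonal_sum_square: "L (zonal_sum x m * zonal_sum x m) = L 1 * (\<Sum>j\<le>m. d j * (x j)\<^sup>2)"
proof (induction m)
  case 0
  have "zonal_sum x 0 * zonal_sum x 0 = smult (x 0 * x 0) 1" by (simp add: zonal_sum_def d_0)
  then have "L (zonal_sum x 0 * zonal_sum x 0) = x 0 * x 0 * L 1" by (simp only: L_smult)
  then show ?case by (simp add: d_0 power2_eq_square)
next
  case (Suc m)
  have z: "L (zonal_sum x m * P (Suc m)) = 0"
    using degree_zonal_sum[of x m] by (intro L_mult_zonal_eq_0) simp
  define y where "y = x (Suc m) * d (Suc m)"
  have "zonal_sum x (Suc m) * zonal_sum x (Suc m)
      = zonal_sum x m * zonal_sum x m + smult (2 * y) (zonal_sum x m * P (Suc m)) + smult (y * y) (P (Suc m) * P (Suc m))"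
    unfolding zonal_sum_Suc y_def[symmetric] by (rule square_add_smult)
  then have "L (zonal_sum x (Suc m) * zonal_sum x (Suc m))
      = L (zonal_sum x m * zonal_sum x m) + y * y * (L 1 / d (Suc m))"
    by (simp only: L_simps z L_zonal_square mult_zero_right add_0_right)
  then show ?case using d_pos[of "Suc m"] by (simp add: Suc y_def power2_eq_square algebra_simps)
qed

text \<open>Multiplication by t couples only neighbouring indices, so the new index m + 1 brings a
  single cross term, the one with P_m; the integral of t P_(m+1)^2 is 0 by parity.\<close>

lemma L_X_zonal_sum_square:
  "L ([:0, 1:] * (zonal_sum x m * zonal_sum x m)) = L 1 * (2 * (\<Sum>j<m. w j * (x j * x (Suc j))))"
proof (induction m)
  case 0
  have "L (smult (x 0 * x 0) [:0, 1:]) = 0" by (rule L_odd) simp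
  then show ?case by (simp add: zonal_sum_def d_0)
next
  case (Suc m)
  define y where "y = x (Suc m) * d (Suc m)"
  let ?X = "[:0, 1:] :: real poly"
  have A: "L (?X * P j * P (Suc m)) = 0" if "j < m" for j
  proof (rule L_mult_zonal_eq_0)
    have "degree (?X * P j) \<le> Suc j" using degree_mult_le[of ?X "P j"] degree_zonal[of n j] by simp
    then show "degree (?X * P j) < Suc m" using that by simp
  qed
  have "L (?X * (zonal_sum x m * P (Suc m))) = (\<Sum>j\<le>m. x j * d j * L (?X * P j * P (Suc m)))"
    by (simp only: zonal_sum_def sum_distrib_left sum_distrib_right mult_smult_left mult_smult_right L_simps mult.assoc)
  also have "\<dots> = x m * d m * L (?X * P m * P (Suc m))"
    by (simp add: A lessThan_Suc_atMost[symmetric] del: mult_pCons_left)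
  also have "L (?X * P m * P (Suc m)) = (n + real m - 2) / (2 * real m + n - 2) * (L 1 / d (Suc m))"
    by (simp only: L_X_mult_zonal' L_zonal_square)
  finally have B: "L (?X * (zonal_sum x m * P (Suc m))) = x m * w m * (L 1 / d (Suc m))"
    by (simp add: w_def)
  have C: "L (?X * (P (Suc m) * P (Suc m))) = 0"
    by (rule L_odd) (simp add: poly_zonal_minus del: mult_pCons_left)
  have "?X * (zonal_sum x (Suc m) * zonal_sum x (Suc m))
      = ?X * (zonal_sum x m * zonal_sum x m) + smult (2 * y) (?X * (zonal_sum x m * P (Suc m)))
        + smult (y * y) (?X * (P (Suc m) * P (Suc m)))"
    unfolding zonal_sum_Suc y_def[symmetric] square_add_smult
    by (simp only: distrib_left mult_smult_right)
  then have "L (?X * (zonal_sum x (Suc m) * zonal_sum x (Suc m)))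
      = L (?X * (zonal_sum x m * zonal_sum x m)) + 2 * y * (x m * w m * (L 1 / d (Suc m)))"
    by (simp only: L_simps B C mult_zero_right add_0_right)
  also have "\<dots> = L 1 * (2 * (\<Sum>j<Suc m. w j * (x j * x (Suc j))))"
    unfolding Suc using d_pos[of "Suc m"] by (simp add: y_def algebra_simps)
  finally show ?case .
qed

text \<open>Summation by parts turns the quadratic form \<open>L ((1 - X) p\<^sup>2)\<close> into a discrete Dirichlet form,
  which is small for slowly varying coefficients.\<close>

lemma dirichlet_form:
  "(\<Sum>j\<le>m. d j * (x j)\<^sup>2) - 2 * (\<Sum>j<m. w j * (x j * x (Suc j)))
    = (\<Sum>j<m. w j * (x j - x (Suc j))\<^sup>2) + w m * (x m)\<^sup>2"
proof (induction m)
  case 0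
  then show ?case using n_ge by (simp add: w_def)
next
  case (Suc m)
  then show ?case by (simp add: w_Suc power2_eq_square algebra_simps)
qed

lemma L_1_minus_X_zonal_sum:
  "L ([:1, -1:] * (zonal_sum x m * zonal_sum x m))
    = L 1 * ((\<Sum>j<m. w j * (x j - x (Suc j))\<^sup>2) + w m * (x m)\<^sup>2)"
proof -
  have "[:1, -1:] * p = p - [:0, 1:] * p" for p :: "real poly" by simp
  then show ?thesis
    unfolding dirichlet_form[symmetric]
    by (simp only: L_diff L_zonal_sum_square L_X_zonal_sum_square right_diff_distrib)
qed

text \<open>A quotient of consecutive dimensions is the product of 1 + 2/(2 l + n - 2) and 1 + (n -
  3)/(l + 1). The exponentials bounding them have exponents 2/(j + 1) and (n - 3)/(j + 1), with sum
  (n - 1)/(j + 1). For m \<le> j + 1 the total factor is at most exp (n - 1).\<close>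

lemma d_growth: "d (j + m) \<le> d j * exp ((n - 1) * real m / (real j + 1))"
proof (induction m)
  case (Suc m)
  define l where "l = real (j + m)"
  have l: "l \<ge> real j" by (simp add: l_def)
  have "(2 * l + n) / (2 * l + n - 2) = 1 + 2 / (2 * l + n - 2)" using n_ge l by (simp add: field_simps)
  also have "\<dots> \<le> 1 + 2 / (real j + 1)" using n_ge l by (intro add_left_mono divide_left_mono mult_pos_pos) auto
  also have "\<dots> \<le> exp (2 / (real j + 1))" by (rule exp_ge_add_one_self)
  finally have 1: "(2 * l + n) / (2 * l + n - 2) \<le> exp (2 / (real j + 1))" .
  have "(n - 2 + l) / (l + 1) = 1 + (n - 3) / (l + 1)" using l by (simp add: field_simps)
  also have "\<dots> \<le> 1 + (n - 3) / (real j + 1)" using n_ge l by (intro add_left_mono divide_left_mono mult_pos_pos) auto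
  also have "\<dots> \<le> exp ((n - 3) / (real j + 1))" by (rule exp_ge_add_one_self)
  finally have 2: "(n - 2 + l) / (l + 1) \<le> exp ((n - 3) / (real j + 1))" .
  have "d (j + Suc m) = d (j + m) * ((2 * l + n) / (2 * l + n - 2) * ((n - 2 + l) / (l + 1)))"
    using d_Suc[of "j + m"] by (simp add: l_def)
  also have "\<dots> \<le> d j * exp ((n - 1) * real m / (real j + 1)) * (exp (2 / (real j + 1)) * exp ((n - 3) / (real j + 1)))"
    using Suc 1 2 n_ge l d_pos[of "j + m"] d_pos[of j]
    by (intro mult_mono) (auto intro!: mult_nonneg_nonneg divide_nonneg_nonneg)
  also have "\<dots> = d j * exp ((n - 1) * real m / (real j + 1) + (2 / (real j + 1) + (n - 3) / (real j + 1)))"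
    by (simp only: exp_add mult.assoc)
  also have "(n - 1) * real m / (real j + 1) + (2 / (real j + 1) + (n - 3) / (real j + 1)) = (n - 1) * real (Suc m) / (real j + 1)"
    unfolding add_divide_distrib[symmetric] by (simp add: algebra_simps)
  finally show ?case .
qed simp

lemma d_doubling:
  assumes "m \<le> Suc j"
  shows "d (j + m) \<le> exp (n - 1) * d j"
proof -
  have "(n - 1) * real m \<le> (n - 1) * (real j + 1)" using assms n_ge by (intro mult_left_mono) auto
  then have "(n - 1) * real m / (real j + 1) \<le> n - 1" by (simp add: divide_le_eq)
  then have "d j * exp ((n - 1) * real m / (real j + 1)) \<le> d j * exp (n - 1)"
    using d_pos[of j] by (intro mult_left_mono) auto
  then show ?thesis using d_growth[of j m] by (simp add: mult.commute)
qed

text \<open>The indices 2 j and 2 j + 1 are both charged to j. The test weights are at least 1/2 on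
  the lower half of the indices, so a fixed share of the total there bounds their norm from
  below.\<close>

lemma sum_d_doubling: "(\<Sum>j\<le>s. d j) \<le> 2 * exp (n - 1) * (\<Sum>j\<le>s div 2. d j)"
proof -
  have "(\<Sum>j\<le>s. d j) \<le> (\<Sum>j\<le>Suc (2 * (s div 2)). d j)"
    using d_pos by (intro sum_mono2) (auto simp: less_imp_le)
  also have "\<dots> = (\<Sum>j\<le>s div 2. d (2 * j) + d (Suc (2 * j)))"
  proof -
    have "(\<Sum>j\<le>Suc (2 * m). d j) = (\<Sum>j\<le>m. d (2 * j) + d (Suc (2 * j)))" for m by (induction m) auto
    then show ?thesis .
  qed
  also have "\<dots> \<le> (\<Sum>j\<le>s div 2. exp (n - 1) * d j + exp (n - 1) * d j)"
  proof (intro sum_mono add_mono)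
    fix j
    show "d (2 * j) \<le> exp (n - 1) * d j" using d_doubling[of j j] by (simp add: mult_2)
    show "d (Suc (2 * j)) \<le> exp (n - 1) * d j" using d_doubling[of "Suc j" j] by (simp add: mult_2)
  qed
  finally show ?thesis by (simp add: sum_distrib_left mult_ac)
qed

text \<open>The linear weights have all differences equal to 1/(s + 1), including the last step to
  0, so the Dirichlet form is the sum of the \<open>w j\<close> over (s + 1)^2. Compared with the
  norm \<open>A\<close>, doubling costs 2 exp (n - 1) and the squared weight 1/4 on the lower half
  costs 4, whence 8 exp (n - 1).\<close>

lemma test_polynomial:
  "\<exists>p. degree p \<le> s \<and> L (p * p) = 1 \<and> L ([:1, -1:] * (p * p)) \<le> 8 * exp (n - 1) / (real s + 1)\<^sup>2"
proof -
  define x where "x j = 1 - real j / (real s + 1)" for j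
  define p where "p = zonal_sum x s"
  define A where "A = (\<Sum>j\<le>s. d j * (x j)\<^sup>2)"
  have diff: "x j - x (Suc j) = 1 / (real s + 1)" for j
    by (simp add: x_def diff_divide_distrib[symmetric])
  have xs: "x s = 1 / (real s + 1)" by (simp add: x_def field_simps)
  have "(\<Sum>j\<le>s div 2. d j) / 4 = (\<Sum>j\<le>s div 2. d j * (1 / 2)\<^sup>2)"
    by (simp add: sum_divide_distrib power2_eq_square)
  also have "\<dots> \<le> (\<Sum>j\<le>s div 2. d j * (x j)\<^sup>2)"
  proof (intro sum_mono mult_left_mono power_mono)
    fix j assume "j \<in> {..s div 2}"
    then have "2 * j \<le> s" by auto
    then have "2 * real j \<le> real s" by linarith
    then show "1 / 2 \<le> x j" by (simp add: x_def field_simps)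
  qed (use d_pos in \<open>auto simp: less_imp_le\<close>)
  also have "\<dots> \<le> A" unfolding A_def using d_pos by (intro sum_mono2) (auto simp: less_imp_le)
  finally have half: "(\<Sum>j\<le>s div 2. d j) \<le> 4 * A" by simp
  have "0 < (\<Sum>j\<le>s div 2. d j)" using d_pos by (intro sum_pos) auto
  then have A: "A > 0" using half by linarith
  have pp: "L (p * p) = L 1 * A" by (simp add: p_def L_zonal_sum_square A_def)
  have "L ([:1, -1:] * (p * p)) = L 1 * ((\<Sum>j<s. w j * (1 / (real s + 1))\<^sup>2) + w s * (1 / (real s + 1))\<^sup>2)"
    by (simp only: p_def L_1_minus_X_zonal_sum diff xs)
  also have "\<dots> = L 1 * ((\<Sum>j\<le>s. w j) / (real s + 1)\<^sup>2)"
    by (simp add: lessThan_Suc_atMost[symmetric] sum_divide_distrib power_one_over add_divide_distrib)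
  also have "\<dots> \<le> L 1 * ((2 * exp (n - 1) * (4 * A)) / (real s + 1)\<^sup>2)"
  proof -
    have "(\<Sum>j\<le>s. w j) \<le> (\<Sum>j\<le>s. d j)" by (intro sum_mono w_le)
    also have "\<dots> \<le> 2 * exp (n - 1) * (\<Sum>j\<le>s div 2. d j)" by (rule sum_d_doubling)
    also have "\<dots> \<le> 2 * exp (n - 1) * (4 * A)" using half by simp
    finally show ?thesis using L_1_pos by (intro mult_left_mono divide_right_mono) auto
  qed
  finally have ub: "L ([:1, -1:] * (p * p)) \<le> L 1 * A * (8 * exp (n - 1) / (real s + 1)\<^sup>2)"
    by (simp add: algebra_simps)
  define c where "c = 1 / sqrt (L 1 * A)"
  have LA: "L 1 * A > 0" using A L_1_pos by simp
  have cc: "c * c = 1 / (L 1 * A)" using LA by (simp add: c_def)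
  have "smult c p * smult c p = smult (c * c) (p * p)" by simp
  then have "L (smult c p * smult c p) = 1" using A L_1_pos by (simp only: L_smult pp cc) (simp add: less_imp_neq[symmetric])
  moreover have "[:1, -1:] * (smult c p * smult c p) = smult (c * c) ([:1, -1:] * (p * p))"
    by (simp only: mult_smult_left mult_smult_right smult_smult)
  then have "L ([:1, -1:] * (smult c p * smult c p)) = L ([:1, -1:] * (p * p)) / (L 1 * A)"
    by (simp only: L_smult cc) simp
  moreover have "L ([:1, -1:] * (p * p)) / (L 1 * A) \<le> 8 * exp (n - 1) / (real s + 1)\<^sup>2"
    using ub LA by (simp add: pos_divide_le_eq mult.commute)
  moreover have "degree (smult c p) \<le> s"
    using degree_smult_le[of c p] degree_zonal_sum[of x s] by (simp add: p_def)
  ultimately show ?thesis by (intro exI[of _ "smult c p"]) simp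
qed

text \<open>The polynomial 1 - P_j vanishes at 1, so it is 1 - t times a polynomial bounded on
  [-1, 1]. The one estimate of L((1 - t) p^2) thereby controls 1 - \<lambda>_j for each j.\<close>

lemma zonal_near_1: "\<exists>K\<ge>0. \<forall>t. - 1 \<le> t \<longrightarrow> t \<le> 1 \<longrightarrow> 1 - poly (P j) t \<le> K * (1 - t)"
proof -
  have "poly (1 - P j) 1 = 0" using n_ge by (simp add: poly_zonal_1)
  then obtain r where r: "1 - P j = [:- 1, 1:] * r" using poly_eq_0_iff_dvd by (metis dvdE)
  have "bounded (poly r ` {- 1..1})"
    by (intro compact_imp_bounded compact_continuous_image continuous_intros) auto
  then obtain K where "\<forall>t\<in>{- 1..1}. \<bar>poly r t\<bar> \<le> K" unfolding bounded_iff by auto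
  then have K: "\<bar>poly r t\<bar> \<le> K" if "t \<in> {- 1..1}" for t using that by blast
  have "1 - poly (P j) t \<le> K * (1 - t)" if t: "- 1 \<le> t" "t \<le> 1" for t
  proof -
    have "1 - poly (P j) t = (- poly r t) * (1 - t)"
      using arg_cong[OF r, of "\<lambda>q. poly q t"] by (simp add: algebra_simps)
    also have "\<dots> \<le> K * (1 - t)" using K[of t] t by (intro mult_right_mono) auto
    finally show ?thesis .
  qed
  moreover have "K \<ge> 0" using K[of 0] by simp
  ultimately show ?thesis by blast
qed

lemma L_square_zonal_le: "L (q\<^sup>2 * P j) \<le> L (q\<^sup>2)"
proof (rule L_mono)
  fix t :: real assume t: "- 1 \<le> t" "t \<le> 1"
  have "\<bar>t\<bar> \<le> 1" using t by linarith
  then have "poly (P j) t \<le> 1" using zonal_abs_le_1[of n t j] n_ge by linarith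
  then have "(poly q t)\<^sup>2 * poly (P j) t \<le> (poly q t)\<^sup>2 * 1" by (intro mult_left_mono) auto
  then show "poly (q\<^sup>2 * P j) t \<le> poly (q\<^sup>2) t" by simp
qed

lemma optimal_root_estimate:
  "\<exists>C\<ge>0. \<forall>s q. optimal_root TYPE('n) k s q \<longrightarrow> L (q\<^sup>2) = 1 \<and>
    (\<forall>j\<le>k. 0 \<le> 1 - L (q\<^sup>2 * P (2 * j)) \<and> 1 - L (q\<^sup>2 * P (2 * j)) \<le> C / (real s + 1)\<^sup>2)"
proof -
  obtain K where K: "\<And>j. K j \<ge> 0"
    "\<And>j t. - 1 \<le> t \<Longrightarrow> t \<le> 1 \<Longrightarrow> 1 - poly (P (2 * j)) t \<le> K j * (1 - t)"
    using zonal_near_1[of "2 * _"] by metis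
  \<comment> \<open>Depends on k and n only, so the estimate is uniform in s and in the minimizer
    q.\<close>
  define C where "C = (\<Sum>j\<le>k. K j) * (8 * exp (n - 1))"
  have "L (q\<^sup>2) = 1 \<and>
    (\<forall>j\<le>k. 0 \<le> 1 - L (q\<^sup>2 * P (2 * j)) \<and> 1 - L (q\<^sup>2 * P (2 * j)) \<le> C / (real s + 1)\<^sup>2)"
    if "optimal_root TYPE('n) k s q" for s q
  proof -
    from that have q: "L (q\<^sup>2) = 1"
      "\<And>p. degree p \<le> s \<Longrightarrow> L (p\<^sup>2) = 1 \<Longrightarrow> (\<Sum>j\<le>k. 1 - L (q\<^sup>2 * P (2 * j))) \<le> (\<Sum>j\<le>k. 1 - L (p\<^sup>2 * P (2 * j)))"
      by (auto simp: optimal_root_def is_arg_min_linorder gegenbauer_coeff_eq)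
    obtain p where p: "degree p \<le> s" "L (p * p) = 1" "L ([:1, -1:] * (p * p)) \<le> 8 * exp (n - 1) / (real s + 1)\<^sup>2"
      using test_polynomial by blast
    have nonneg: "0 \<le> 1 - L (q\<^sup>2 * P (2 * j))" for j using L_square_zonal_le[of q "2 * j"] q(1) by simp
    have "1 - L (p\<^sup>2 * P (2 * j)) \<le> K j * (8 * exp (n - 1) / (real s + 1)\<^sup>2)" for j
    proof -
      have "1 - L (p\<^sup>2 * P (2 * j)) = L (p\<^sup>2 * (1 - P (2 * j)))"
        using p(2) by (simp add: right_diff_distrib L_diff power2_eq_square)
      also have "\<dots> \<le> L (smult (K j) ([:1, -1:] * (p * p)))"
      proof (rule L_mono)
        fix t :: real assume t: "- 1 \<le> t" "t \<le> 1"
        have "(poly p t)\<^sup>2 * (1 - poly (P (2 * j)) t) \<le> (poly p t)\<^sup>2 * (K j * (1 - t))"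
          using K(2)[OF t] by (intro mult_left_mono) auto
        then show "poly (p\<^sup>2 * (1 - P (2 * j))) t \<le> poly (smult (K j) ([:1, -1:] * (p * p))) t"
          by (simp add: power2_eq_square algebra_simps)
      qed
      also have "\<dots> \<le> K j * (8 * exp (n - 1) / (real s + 1)\<^sup>2)"
        unfolding L_smult using p(3) K(1) by (intro mult_left_mono)
      finally show ?thesis .
    qed
    then have "(\<Sum>j\<le>k. 1 - L (p\<^sup>2 * P (2 * j))) \<le> (\<Sum>j\<le>k. K j * (8 * exp (n - 1) / (real s + 1)\<^sup>2))"
      by (intro sum_mono)
    also have "\<dots> = C / (real s + 1)\<^sup>2" by (simp add: C_def sum_distrib_right sum_divide_distrib)
    finally have total: "(\<Sum>j\<le>k. 1 - L (q\<^sup>2 * P (2 * j))) \<le> C / (real s + 1)\<^sup>2"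
      using q(2)[OF p(1)] p(2) by (simp add: power2_eq_square)
    have "1 - L (q\<^sup>2 * P (2 * j)) \<le> C / (real s + 1)\<^sup>2" if "j \<le> k" for j
      using member_le_sum[of j "{..k}" "\<lambda>j. 1 - L (q\<^sup>2 * P (2 * j))"] that nonneg total by force
    then show ?thesis using q(1) nonneg by blast
  qed
  moreover have "C \<ge> 0" unfolding C_def using K(1) by (intro mult_nonneg_nonneg sum_nonneg) auto
  ultimately show ?thesis by blast
qed

text \<open>Once \<lambda> > 1/2, which holds for large s, the threshold is finite and 1/\<lambda> -
  1 = (1 - \<lambda>)/\<lambda> is at most 2 (1 - \<lambda>).\<close>

lemma optimal_root_threshold:
  assumes k: "k \<ge> 1" and q: "\<And>s. optimal_root TYPE('n) k s (q s)"
  shows "\<exists>E \<in> O(\<lambda>s. 1 / (real s)\<^sup>2). \<forall>\<^sub>F s in sequentially.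
    frobenius_threshold TYPE('n) k ((q s)\<^sup>2)
      \<le> ereal (sqrt (real (max_dim_harmonic TYPE('n) k)) * (real k)\<^sup>2 * n\<^sup>2 * E s)"
proof -
  obtain C where C: "C \<ge> 0" "\<And>s j. j \<le> k \<Longrightarrow> 0 \<le> 1 - L ((q s)\<^sup>2 * P (2 * j))"
    "\<And>s j. j \<le> k \<Longrightarrow> 1 - L ((q s)\<^sup>2 * P (2 * j)) \<le> C / (real s + 1)\<^sup>2"
    using optimal_root_estimate[of k] q by metis
  define B where "B = sqrt (\<Sum>j\<le>k. d (2 * j)) * (2 * C)"
  \<comment> \<open>The explicit prefactor of the claim. It is a positive constant, so the bound B /
    s^2 can be divided by it to give the O-term.\<close>
  define G where "G = sqrt (real (max_dim_harmonic TYPE('n) k)) * (real k)\<^sup>2 * n\<^sup>2"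
  have "0 < d 0" by (rule d_pos)
  also have "d 0 \<le> real (max_dim_harmonic TYPE('n) k)" using max_dim_ge[of 0 k] by simp
  finally have G: "G > 0" using k n_ge by (simp add: G_def)
  have small: "\<forall>\<^sub>F s in sequentially. C / (real s + 1)\<^sup>2 < 1 / 2"
  proof (rule eventually_sequentiallyI)
    fix s assume "nat \<lceil>2 * C\<rceil> \<le> s"
    then have "2 * C < real s + 1" by linarith
    also have "real s + 1 \<le> (real s + 1)\<^sup>2" by (simp add: power2_eq_square mult_le_cancel_left1)
    finally show "C / (real s + 1)\<^sup>2 < 1 / 2" by (simp add: divide_less_eq)
  qed
  have main: "frobenius_threshold TYPE('n) k ((q s)\<^sup>2) \<le> ereal (G * (B / G / (real s)\<^sup>2))"
    if s: "C / (real s + 1)\<^sup>2 < 1 / 2" "s \<ge> 1" for s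
  proof -
    define l where "l j = L ((q s)\<^sup>2 * P (2 * j))" for j
    have l: "l j > 1 / 2" "l j \<le> 1" "1 - l j \<le> C / (real s + 1)\<^sup>2" if "j \<le> k" for j
      using C(2,3)[OF that, of s] s unfolding l_def by linarith+
    have "(1 / l j - 1)\<^sup>2 \<le> (2 * C / (real s)\<^sup>2)\<^sup>2" if "j \<le> k" for j
    proof (rule power_mono)
      show "0 \<le> 1 / l j - 1" using l[OF that] by (simp add: field_simps)
      have "1 / l j - 1 = (1 - l j) / l j" using l[OF that] by (simp add: field_simps)
      also have "\<dots> \<le> (1 - l j) / (1 / 2)" using l[OF that] by (intro divide_left_mono) auto
      also have "\<dots> \<le> 2 * (C / (real s + 1)\<^sup>2)" using l[OF that] by simp
      also have "\<dots> \<le> 2 * (C / (real s)\<^sup>2)"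
        using s C(1) by (intro mult_left_mono divide_left_mono power_mono mult_pos_pos) auto
      finally show "1 / l j - 1 \<le> 2 * C / (real s)\<^sup>2" by simp
    qed
    then have "(\<Sum>j\<le>k. d (2 * j) * (1 / l j - 1)\<^sup>2) \<le> (\<Sum>j\<le>k. d (2 * j) * (2 * C / (real s)\<^sup>2)\<^sup>2)"
      using d_pos by (intro sum_mono mult_left_mono) (auto simp: less_imp_le)
    also have "\<dots> = (\<Sum>j\<le>k. d (2 * j)) * (2 * C / (real s)\<^sup>2)\<^sup>2" by (simp add: sum_distrib_right)
    finally have "sqrt (\<Sum>j\<le>k. d (2 * j) * (1 / l j - 1)\<^sup>2) \<le> sqrt ((\<Sum>j\<le>k. d (2 * j)) * (2 * C / (real s)\<^sup>2)\<^sup>2)"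
      by simp
    also have "\<dots> = B / (real s)\<^sup>2" using C(1) by (simp add: real_sqrt_mult B_def)
    also have "\<dots> = G * (B / G / (real s)\<^sup>2)" using G by simp
    finally have "sqrt (\<Sum>j\<le>k. d (2 * j) * (1 / l j - 1)\<^sup>2) \<le> G * (B / G / (real s)\<^sup>2)" .
    moreover have "\<not> (\<exists>j\<le>k. l j = 0)" using l(1) by force
    ultimately show ?thesis by (simp add: frobenius_threshold_eq l_def)
  qed
  have "(\<lambda>s. B / G / (real s)\<^sup>2) \<in> O(\<lambda>s. 1 / (real s)\<^sup>2)"
    by (rule bigoI[of _ "\<bar>B / G\<bar>"]) (auto simp: abs_mult)
  moreover have "\<forall>\<^sub>F s in sequentially. frobenius_threshold TYPE('n) k ((q s)\<^sup>2) \<le> ereal (G * (B / G / (real s)\<^sup>2))"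
    using small eventually_ge_at_top[of "1::nat"] by eventually_elim (rule main)
  ultimately show ?thesis by (intro bexI[of _ "\<lambda>s. B / G / (real s)\<^sup>2"]) (simp_all only: G_def)
qed

end

section \<open>Convergence of the hierarchy\<close>

text \<open>Multiplying each power of \<open>x \<bullet> y\<close> by a power of \<open>y \<bullet> y\<close> makes the integrand a form, to which the
  cubature rule applies.\<close>

lemma gamma_hat_cubature_nonneg:
  fixes x :: "real^'n::finite"
  assumes F: "F \<in> forms (2 * k)" and x: "norm x = 1"
    and h: "\<And>t. - 1 \<le> t \<Longrightarrow> t \<le> 1 \<Longrightarrow> 0 \<le> poly h t"
    and cub: "cubature_rule (2 * (k + degree h)) X W" and FX: "\<And>y. y \<in> X \<Longrightarrow> 0 \<le> F y"
  shows "0 \<le> gamma_hat k h F x"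
proof -
  let ?d = "degree h"
  define \<Phi> where "\<Phi> y = (\<Sum>j\<le>?d. coeff h (2 * j) * ((y \<bullet> y) ^ (?d - j) * ((x \<bullet> y) ^ (2 * j) * F y)))" for y
  have "(\<lambda>y. (y \<bullet> y) ^ (?d - j) * ((x \<bullet> y) ^ (2 * j) * F y)) \<in> forms (2 * (k + ?d))" if "j \<le> ?d" for j
  proof -
    have "(\<lambda>y. (y \<bullet> y) ^ (?d - j) * ((x \<bullet> y) ^ (2 * j) * F y)) \<in> forms ((?d - j) * 2 + (2 * j * 1 + 2 * k))"
      by (intro forms_mult forms_power inner_self_in_forms inner_in_forms F)
    moreover have "(?d - j) * 2 + (2 * j * 1 + 2 * k) = 2 * (k + ?d)" using that by simp
    ultimately show ?thesis by (simp only:)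
  qed
  then have \<Phi>: "\<Phi> \<in> forms (2 * (k + ?d))"
    unfolding \<Phi>_def[abs_def] by (intro forms_sum forms_scale) auto
  have on_sphere: "\<Phi> y = (\<Sum>j\<le>?d. coeff h (2 * j) * ((x \<bullet> y) ^ (2 * j) * F y))" if "norm y = 1" for y
    using that by (simp add: \<Phi>_def dot_square_norm)
  have "gamma_hat k h F x = (\<Sum>j\<le>?d. LINT y|sphere_area. coeff h (2 * j) * ((x \<bullet> y) ^ (2 * j) * F y))"
    by (simp add: gamma_hat_def x)
  also have "\<dots> = (LINT y|sphere_area. (\<Sum>j\<le>?d. coeff h (2 * j) * ((x \<bullet> y) ^ (2 * j) * F y)))"
    by (intro Bochner_Integration.integral_sum[symmetric] integrable_sphere_area continuous_intros forms_continuous[OF F])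
  also have "\<dots> = (LINT y|sphere_area. \<Phi> y)"
    by (intro Bochner_Integration.integral_cong) (auto simp: on_sphere)
  also have "\<dots> = (\<Sum>y\<in>X. W y * \<Phi> y)" using cub \<Phi> by (simp add: cubature_rule_def)
  also have "\<dots> \<ge> 0"
  proof (rule sum_nonneg)
    fix y assume y: "y \<in> X"
    then have ny: "norm y = 1" and Wy: "0 < W y" using cub by (auto simp: cubature_rule_def)
    \<comment> \<open>At a node the value is F times the even part of h, which is nonnegative since
      both x \<bullet> y and its negative lie in [-1, 1].\<close>
    have "2 * \<Phi> y = (poly h (x \<bullet> y) + poly h (- (x \<bullet> y))) * F y"
      unfolding on_sphere[OF ny] poly_eq_even_odd_sum[OF order_refl] sum.distrib[symmetric]
        sum_distrib_left sum_distrib_right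
      by (intro sum.cong) (simp_all add: algebra_simps)
    moreover have "\<bar>x \<bullet> y\<bar> \<le> 1" using Cauchy_Schwarz_ineq2[of x y] x ny by simp
    then have "0 \<le> poly h (x \<bullet> y) + poly h (- (x \<bullet> y))" by (intro add_nonneg_nonneg h) auto
    then have "0 \<le> (poly h (x \<bullet> y) + poly h (- (x \<bullet> y))) * F y" using FX[OF y] by simp
    ultimately have "0 \<le> \<Phi> y" by linarith
    then show "0 \<le> W y * \<Phi> y" using Wy by simp
  qed
  finally show ?thesis .
qed

lemma tendsto_funI:
  fixes f :: "'a \<Rightarrow> 'b \<Rightarrow> 'c::topological_space"
  assumes "\<And>x. ((\<lambda>s. f s x) \<longlongrightarrow> g x) F"
  shows "(f \<longlongrightarrow> g) F"
proof -
  have "limitin (product_topology (\<lambda>_. euclidean) UNIV) f g F"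
    using assms by (simp add: limitin_componentwise)
  then show ?thesis by (simp add: euclidean_product_topology flip: limitin_canonical_iff)
qed

context sphere_axis
begin

text \<open>From P_2(t) = (n t^2 - 1)/(n - 1), the function 1 - t^2 is a multiple of 1 - P_2. So 1 -
  \<lambda>_2 measures the mass of the kernel away from \<plusminus>1.\<close>

lemma L_mult_1_minus_square: "L (h * (1 - [:0, 1:] * [:0, 1:])) = (n - 1) / n * (L h - L (h * P 2))"
proof -
  have "P 2 = smult (1 / (n - 1)) (smult n ([:0, 1:] * [:0, 1:]) - 1)"
    by (simp add: numeral_2_eq_2 zonal.simps(3) one_pCons)
  then have "L (h * P 2) = 1 / (n - 1) * (n * L (h * ([:0, 1:] * [:0, 1:])) - L h)"
    by (simp only: mult_smult_right right_diff_distrib mult_1_right L_simps)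
  moreover have "L (h * (1 - [:0, 1:] * [:0, 1:])) = L h - L (h * ([:0, 1:] * [:0, 1:]))"
    by (simp only: right_diff_distrib mult_1_right L_diff)
  ultimately show ?thesis using n_ge by (simp only:) (simp add: field_simps)
qed

lemma L_eq_inner: "norm (x :: real^'n) = 1 \<Longrightarrow> (LINT y|sphere_area. poly p (x \<bullet> y)) = L p"
  unfolding L_def by (rule integral_sphere_area_inner) (auto intro!: continuous_intros)

text \<open>By the equality case of Cauchy-Schwarz, 1 - (x \<bullet> y)^2 vanishes only at y =
  \<plusminus>x, where the even form f takes the value f x. On the compact set where f deviates by
  at least \<epsilon> it has a positive minimum m, and C = M / m works with M a bound for the
  deviation.\<close>

lemma form_modulus:
  fixes x :: "real^'n"
  assumes f: "f \<in> forms (2 * k)" and x: "norm x = 1" and \<epsilon>: "\<epsilon> > 0"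
  shows "\<exists>C\<ge>0. \<forall>y. norm y = 1 \<longrightarrow> \<bar>f y - f x\<bar> \<le> \<epsilon> + C * (1 - (x \<bullet> y)\<^sup>2)"
proof -
  have cs: "(x \<bullet> y)\<^sup>2 \<le> 1" if "norm y = 1" for y
    using Cauchy_Schwarz_ineq2[of x y] x that by (simp add: abs_square_le_1)
  define S where "S = {y \<in> sphere 0 1. \<epsilon> \<le> \<bar>f y - f x\<bar>}"
  have cont: "continuous_on (sphere 0 1) (\<lambda>y. \<bar>f y - f x\<bar>)"
    by (intro continuous_intros forms_continuous[OF f])
  have "S = sphere 0 1 \<inter> {y. \<epsilon> \<le> \<bar>f y - f x\<bar>}" by (auto simp: S_def)
  moreover have "closed {y. \<epsilon> \<le> \<bar>f y - f x\<bar>}"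
    by (intro closed_Collect_le continuous_intros forms_continuous[OF f])
  ultimately have comp: "compact S" by (simp add: compact_Int_closed)
  show ?thesis
  proof (cases "S = {}")
    case True
    then have "\<bar>f y - f x\<bar> \<le> \<epsilon> + 0 * (1 - (x \<bullet> y)\<^sup>2)" if "norm y = 1" for y
      using that by (force simp: S_def)
    then show ?thesis by (intro exI[of _ 0]) auto
  next
    case False
    have "continuous_on S (\<lambda>y. 1 - (x \<bullet> y)\<^sup>2)" by (intro continuous_intros)
    from continuous_attains_inf[OF comp False this] obtain z where
      z: "z \<in> S" "\<And>y. y \<in> S \<Longrightarrow> 1 - (x \<bullet> z)\<^sup>2 \<le> 1 - (x \<bullet> y)\<^sup>2" by auto
    have "S \<subseteq> sphere 0 1" by (auto simp: S_def)
    from continuous_attains_sup[OF comp False continuous_on_subset[OF cont this]] obtain M where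
      M: "\<And>y. y \<in> S \<Longrightarrow> \<bar>f y - f x\<bar> \<le> M" by auto
    define m where "m = 1 - (x \<bullet> z)\<^sup>2"
    have "m > 0"
    proof (rule ccontr)
      assume "\<not> m > 0"
      then have "\<bar>x \<bullet> z\<bar> = norm x * norm z"
        using cs[of z] z(1) x by (auto simp: m_def S_def power2_eq_1_iff)
      then have "z = x \<or> z = - x"
        using norm_cauchy_schwarz_abs_eq[of x z] x z(1) by (auto simp: S_def)
      then have "f z = f x" using forms_homogeneous[OF f, of "- 1" x] by auto
      then show False using z(1) \<epsilon> by (simp add: S_def)
    qed
    have M0: "M \<ge> 0" using M[OF z(1)] by linarith
    have "\<bar>f y - f x\<bar> \<le> \<epsilon> + M / m * (1 - (x \<bullet> y)\<^sup>2)" if y: "norm y = 1" for y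
    proof (cases "y \<in> S")
      case True
      have "\<bar>f y - f x\<bar> \<le> M / m * m" using M[OF True] \<open>m > 0\<close> by simp
      also have "\<dots> \<le> M / m * (1 - (x \<bullet> y)\<^sup>2)"
        using z(2)[OF True] M0 \<open>m > 0\<close> by (intro mult_left_mono) (auto simp: m_def)
      finally show ?thesis using \<epsilon> by simp
    next
      case False
      then have "\<bar>f y - f x\<bar> < \<epsilon>" using y by (auto simp: S_def)
      moreover have "0 \<le> M / m * (1 - (x \<bullet> y)\<^sup>2)" using cs[OF y] M0 \<open>m > 0\<close> by simp
      ultimately show ?thesis by linarith
    qed
    moreover have "M / m \<ge> 0" using M0 \<open>m > 0\<close> by simp
    ultimately show ?thesis by blast
  qed
qed

text \<open>A Korovkin-type argument: the kernel is nonnegative with total mass 1, so the error is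
  at most its integral against r/2 + C (1 - (x \<bullet> y)^2), and the second part is a constant
  times 1 - \<lambda>_2.\<close>

lemma gamma_hat_tendsto_on_sphere:
  fixes x :: "real^'n"
  assumes f: "f \<in> forms (2 * k)" and x: "norm x = 1"
    and h: "\<And>s t. - 1 \<le> t \<Longrightarrow> t \<le> 1 \<Longrightarrow> 0 \<le> poly (h s) t"
    and h1: "\<And>s. L (h s) = 1" and lim: "(\<lambda>s. L (h s * P 2)) \<longlonglongrightarrow> 1"
  shows "(\<lambda>s. gamma_hat k (h s) f x) \<longlonglongrightarrow> f x"
proof (rule LIMSEQ_I)
  fix r :: real assume r: "r > 0"
  obtain C where C: "C \<ge> 0" "\<And>y. norm y = 1 \<Longrightarrow> \<bar>f y - f x\<bar> \<le> r / 2 + C * (1 - (x \<bullet> y)\<^sup>2)"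
    using form_modulus[OF f x, of "r / 2"] r by auto
  define Q where "Q s = C * L (h s * (1 - [:0, 1:] * [:0, 1:]))" for s
  have "Q \<longlonglongrightarrow> C * ((n - 1) / n * (1 - 1))"
    unfolding Q_def[abs_def] L_mult_1_minus_square h1 by (intro tendsto_intros lim)
  then obtain N where N: "\<And>s. s \<ge> N \<Longrightarrow> \<bar>Q s\<bar> < r / 2"
    using LIMSEQ_D[of Q 0 "r / 2"] r by auto
  have "\<bar>gamma_hat k (h s) f x - f x\<bar> < r" if "s \<ge> N" for s
  proof -
    let ?p = "smult (r / 2) (h s) + smult C (h s * (1 - [:0, 1:] * [:0, 1:]))"
    have int: "integrable sphere_area (\<lambda>y. poly (h s) (x \<bullet> y) * (f y - f x))"
      "integrable sphere_area (\<lambda>y. poly (h s) (x \<bullet> y) * f y)"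
      "integrable sphere_area (\<lambda>y. poly (h s) (x \<bullet> y) * f x)"
      "integrable sphere_area (\<lambda>y. poly ?p (x \<bullet> y))"
      by (intro integrable_sphere_area continuous_intros forms_continuous[OF f])+
    have "gamma_hat k (h s) f x - f x = (LINT y|sphere_area. poly (h s) (x \<bullet> y) * f y) - (LINT y|sphere_area. poly (h s) (x \<bullet> y) * f x)"
      using h1[of s] by (simp add: gamma_hat_on_sphere[OF f x] L_eq_inner[OF x])
    also have "\<dots> = (LINT y|sphere_area. poly (h s) (x \<bullet> y) * (f y - f x))"
      using Bochner_Integration.integral_diff[OF int(2,3)] by (simp add: right_diff_distrib)
    also have "\<bar>\<dots>\<bar> \<le> (LINT y|sphere_area. poly ?p (x \<bullet> y))"
    proof (rule order_trans[OF integral_abs_bound integral_mono[OF integrable_abs[OF int(1)] int(4)]])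
      fix y :: "real^'n" assume "y \<in> space sphere_area"
      then have y: "norm y = 1" by simp
      have "\<bar>x \<bullet> y\<bar> \<le> 1" using Cauchy_Schwarz_ineq2[of x y] x y by simp
      then have hy: "0 \<le> poly (h s) (x \<bullet> y)" by (intro h) auto
      have "\<bar>poly (h s) (x \<bullet> y) * (f y - f x)\<bar> \<le> poly (h s) (x \<bullet> y) * (r / 2 + C * (1 - (x \<bullet> y)\<^sup>2))"
        unfolding abs_mult using C(2)[OF y] hy by (intro mult_mono) auto
      then show "\<bar>poly (h s) (x \<bullet> y) * (f y - f x)\<bar> \<le> poly ?p (x \<bullet> y)"
        by (simp add: algebra_simps power2_eq_square)
    qed
    also have "\<dots> = r / 2 + Q s" by (simp only: L_eq_inner[OF x] L_simps h1 Q_def mult_1_right)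
    also have "\<dots> < r" using N[OF that] by linarith
    finally show ?thesis .
  qed
  then show "\<exists>N. \<forall>s\<ge>N. norm (gamma_hat k (h s) f x - f x) < r" by auto
qed

text \<open>Both sides are forms of degree 2 k, so homogeneity carries the convergence from the
  sphere to all x; at the origin they vanish because k \<ge> 1.\<close>

lemma gamma_hat_tendsto:
  assumes f: "f \<in> forms (2 * k)" and k: "k \<ge> 1"
    and h: "\<And>s t. - 1 \<le> t \<Longrightarrow> t \<le> 1 \<Longrightarrow> 0 \<le> poly (h s) t"
    and h1: "\<And>s. L (h s) = 1" and lim: "(\<lambda>s. L (h s * P 2)) \<longlonglongrightarrow> 1"
  shows "(\<lambda>s. gamma_hat k (h s) f) \<longlonglongrightarrow> (f :: real^'n \<Rightarrow> real)"
proof (rule tendsto_funI)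
  fix x :: "real^'n"
  have hom: "g x = norm x ^ (2 * k) * g (sgn x)" if "g \<in> forms (2 * k)" for g
  proof -
    have "x = norm x *\<^sub>R sgn x" by (cases "x = 0") (auto simp: sgn_div_norm)
    then show ?thesis using forms_homogeneous[OF that, of "norm x" "sgn x"] by simp
  qed
  show "(\<lambda>s. gamma_hat k (h s) f x) \<longlonglongrightarrow> f x"
  proof (cases "x = 0")
    case True
    have "g x = 0" if "g \<in> forms (2 * k)" for g using hom[OF that] True k by (simp add: power_0_left)
    then have "gamma_hat k (h s) f x = 0" "f x = 0" for s using gamma_hat_in_forms[OF f k] f by blast+
    then show ?thesis by simp
  next
    case False
    then have "(\<lambda>s. norm x ^ (2 * k) * gamma_hat k (h s) f (sgn x)) \<longlonglongrightarrow> norm x ^ (2 * k) * f (sgn x)"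
      by (intro tendsto_mult_left gamma_hat_tendsto_on_sphere[OF f _ h h1 lim]) (simp_all add: norm_sgn)
    then show ?thesis using hom[OF gamma_hat_in_forms[OF f k]] hom[OF f] by simp
  qed
qed

text \<open>A form in P_{2k} is nonnegative at all nodes, so its images lie in the sets A_s, and
  they converge to it. Conversely, exactness of the rules keeps every A_s inside P_{2k}, which is
  closed.\<close>

lemma hierarchy_convergesI:
  fixes X :: "nat \<Rightarrow> (real^'n) set"
  assumes k: "k \<ge> 1"
    and h: "\<And>s t. - 1 \<le> t \<Longrightarrow> t \<le> 1 \<Longrightarrow> 0 \<le> poly (h s) t"
    and h1: "\<And>s. L (h s) = 1" and lim: "(\<lambda>s. L (h s * P 2)) \<longlonglongrightarrow> 1"
    and cub: "\<And>t. cubature_rule (2 * t) (X (2 * t)) (W (2 * t))"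
  shows "hierarchy_converges k (harmonic_hierarchy k X h)"
  unfolding hierarchy_converges_def
proof (intro equalityI subsetI)
  fix f :: "real^'n \<Rightarrow> real" assume "f \<in> nonneg_forms (2 * k)"
  then have f: "f \<in> forms (2 * k)" and pos: "\<And>x. norm x = 1 \<Longrightarrow> 0 \<le> f x"
    by (auto simp: nonneg_forms_def)
  show "f \<in> top_of_set (forms (2 * k)) closure_of (\<Union>s. harmonic_hierarchy k X h s)"
    unfolding in_closure_of
  proof (intro conjI allI impI)
    show "f \<in> topspace (top_of_set (forms (2 * k)))" using f by simp
    fix T assume T: "f \<in> T \<and> openin (top_of_set (forms (2 * k))) T"
    then obtain U where U: "open U" "T = forms (2 * k) \<inter> U" by (auto simp: openin_open)
    have "\<forall>\<^sub>F s in sequentially. gamma_hat k (h s) f \<in> U"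
      using topological_tendstoD[OF gamma_hat_tendsto[OF f k h h1 lim] U(1)] T U(2) by auto
    then obtain s where s: "gamma_hat k (h s) f \<in> U" by (auto simp: eventually_sequentially)
    have "X (2 * (k + degree (h s))) \<subseteq> sphere 0 1" using cub[of "k + degree (h s)"] by (simp add: cubature_rule_def)
    then have "gamma_hat k (h s) f \<in> harmonic_hierarchy k X h s"
      unfolding harmonic_hierarchy_def using f pos by (intro imageI) auto
    then show "\<exists>y. y \<in> (\<Union>s. harmonic_hierarchy k X h s) \<and> y \<in> T"
      using s U(2) gamma_hat_in_forms[OF f k] by blast
  qed
next
  fix f :: "real^'n \<Rightarrow> real"
  assume cl: "f \<in> top_of_set (forms (2 * k)) closure_of (\<Union>s. harmonic_hierarchy k X h s)"
  then have f: "f \<in> forms (2 * k)" by (auto simp: in_closure_of)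
  have "0 \<le> f x" if x: "norm x = 1" for x
  proof (rule ccontr)
    assume "\<not> 0 \<le> f x"
    \<comment> \<open>Evaluation at x is continuous for pointwise convergence, so a negative value f
      x would force some element of some A_s to be negative at x as well.\<close>
    define U where "U = {g :: real^'n \<Rightarrow> real. g x < 0}"
    have "open U" unfolding U_def
      by (intro open_Collect_less continuous_on_product_coordinates continuous_on_const)
    then have "openin (top_of_set (forms (2 * k))) (forms (2 * k) \<inter> U)" by (auto simp: openin_open)
    moreover have "f \<in> forms (2 * k) \<inter> U" using f \<open>\<not> 0 \<le> f x\<close> by (simp add: U_def)
    ultimately obtain g s where g: "g \<in> U" "g \<in> harmonic_hierarchy k X h s"
      using cl unfolding in_closure_of by blast
    then obtain F where "F \<in> forms (2 * k)" "\<And>y. y \<in> X (2 * (k + degree (h s))) \<Longrightarrow> 0 \<le> F y"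
      "g = gamma_hat k (h s) F" by (auto simp: harmonic_hierarchy_def)
    then have "0 \<le> g x" using gamma_hat_cubature_nonneg[OF _ x h cub] by blast
    with g(1) show False by (simp add: U_def)
  qed
  with f show "f \<in> nonneg_forms (2 * k)" by (simp add: nonneg_forms_def)
qed

section \<open>Convergence for the two families of kernels\<close>

lemma power_kernel_limit: "(\<lambda>s. L (power_kernel i s * P 2)) \<longlonglongrightarrow> 1"
proof -
  \<comment> \<open>Here \<lambda>_2 = s / (s + n/2).\<close>
  have "L (power_kernel i s * P 2) = 1 - (n / 2) / (n / 2 + real s)" for s
    using L_power_kernel[of s 1, unfolded mult_1_right] n_ge by (simp add: ratio_def field_simps)
  moreover have "(\<lambda>s. 1 - (n / 2) / (n / 2 + real s)) \<longlonglongrightarrow> 1 - 0"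
    by (intro tendsto_diff tendsto_const tendsto_divide_0[OF tendsto_const] filterlim_at_top_imp_at_infinity
        filterlim_tendsto_add_at_top[OF tendsto_const] filterlim_real_sequentially)
  ultimately show ?thesis by simp
qed

lemma optimal_root_limit:
  assumes k: "k \<ge> 1" and q: "\<And>s. optimal_root TYPE('n) k s (q s)"
  shows "L ((q s)\<^sup>2) = 1" "(\<lambda>s. L ((q s)\<^sup>2 * P 2)) \<longlonglongrightarrow> 1"
proof -
  obtain C where C: "\<And>s. L ((q s)\<^sup>2) = 1" "\<And>s. 0 \<le> 1 - L ((q s)\<^sup>2 * P (2 * 1))"
    "\<And>s. 1 - L ((q s)\<^sup>2 * P (2 * 1)) \<le> C / (real s + 1)\<^sup>2"
    using optimal_root_estimate[of k] q k by metis
  show "L ((q s)\<^sup>2) = 1" by (rule C(1))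
  have lim: "(\<lambda>s. C / (1 + real s)\<^sup>2) \<longlonglongrightarrow> 0"
  proof (rule tendsto_divide_0[OF tendsto_const filterlim_at_top_imp_at_infinity])
    have "filterlim (\<lambda>s. 1 + real s) at_top sequentially"
      by (rule filterlim_tendsto_add_at_top[OF tendsto_const filterlim_real_sequentially])
    then show "filterlim (\<lambda>s. (1 + real s)\<^sup>2) at_top sequentially"
      by (intro filterlim_pow_at_top) simp_all
  qed
  have le: "1 - L ((q s)\<^sup>2 * P 2) \<le> C / (1 + real s)\<^sup>2" and ge: "0 \<le> 1 - L ((q s)\<^sup>2 * P 2)" for s
    using C(2,3)[of s] by (simp_all only: mult_1_right add.commute[of "real s"])
  have "(\<lambda>s. 1 - L ((q s)\<^sup>2 * P 2)) \<longlonglongrightarrow> 0"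
    by (rule tendsto_sandwich[OF always_eventually always_eventually tendsto_const lim]) (intro allI ge le)+
  from tendsto_diff[OF tendsto_const[of 1] this] show "(\<lambda>s. L ((q s)\<^sup>2 * P 2)) \<longlonglongrightarrow> 1" by simp
qed

lemma kernel_hierarchy_converges:
  fixes X :: "nat \<Rightarrow> (real^'n) set"
  assumes k: "k \<ge> 1"
    and h: "h = power_kernel i \<or> (\<exists>q. (\<forall>s. optimal_root TYPE('n) k s (q s)) \<and> h = (\<lambda>s. (q s)\<^sup>2))"
    and cub: "\<And>t. cubature_rule (2 * t) (X (2 * t)) (W (2 * t))"
  shows "hierarchy_converges k (harmonic_hierarchy k X h)"
  using h
proof (elim disjE exE conjE)
  assume h: "h = power_kernel i"
  show ?thesis
  proof (rule hierarchy_convergesI[OF k _ _ _ cub])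
    fix s t
    have "0 \<le> (LINT y|(sphere_area :: (real^'n) measure). (y $ i) ^ (2 * s))"
      by (intro Bochner_Integration.integral_nonneg) simp
    then show "0 \<le> poly (h s) t" by (simp add: h power_kernel_def poly_monom)
    show "L (h s) = 1" using L_power_kernel[of s 0] by (simp add: h ratio_def)
    show "(\<lambda>s. L (h s * P 2)) \<longlonglongrightarrow> 1" unfolding h by (rule power_kernel_limit)
  qed
next
  fix q assume q: "\<forall>s. optimal_root TYPE('n) k s (q s)" and h: "h = (\<lambda>s. (q s)\<^sup>2)"
  then show ?thesis
    using optimal_root_limit[OF k, of q] by (intro hierarchy_convergesI[OF k _ _ _ cub]) auto
qed

end

theorem corollary1p5:
  fixes k :: nat and i :: "'n::finite"
  assumes "CARD('n) \<ge> 3" and "k \<ge> 1"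
  shows
    "let n = real CARD('n); D = real (max_dim_harmonic TYPE('n) k) in
     (\<exists>E1 \<in> O(\<lambda>s. 1 / (real s)\<^sup>2). \<exists>E2 \<in> O(\<lambda>s. 1 / (real s)\<^sup>2). \<forall>\<^sub>F s in sequentially.
        ereal ((1 + n / 2) / real s + E1 s) \<le> frobenius_threshold TYPE('n) k (power_kernel i s) \<and>
        frobenius_threshold TYPE('n) k (power_kernel i s)
          \<le> ereal (D * (((real k)\<^sup>2 + real k * n / 2) / real s) + E2 s))
   \<and> (\<forall>q. (\<forall>s. optimal_root TYPE('n) k s (q s)) \<longrightarrow>
        (\<exists>E \<in> O(\<lambda>s. 1 / (real s)\<^sup>2). \<forall>\<^sub>F s in sequentially.
           frobenius_threshold TYPE('n) k ((q s)\<^sup>2) \<le> ereal (sqrt D * (real k)\<^sup>2 * n\<^sup>2 * E s)))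
   \<and> (\<forall>h. h = power_kernel i \<or>
           (\<exists>q. (\<forall>s. optimal_root TYPE('n) k s (q s)) \<and> h = (\<lambda>s. (q s)\<^sup>2)) \<longrightarrow>
        (\<forall>(X :: nat \<Rightarrow> (real^'n) set) W. (\<forall>t. cubature_rule (2 * t) (X (2 * t)) (W (2 * t))) \<longrightarrow>
           hierarchy_converges k (harmonic_hierarchy k X h)))"
proof -
  interpret sphere_axis i "real CARD('n)" "\<lambda>j. real (dim_harmonic TYPE('n) j)"
    by unfold_locales (use assms in auto)
  show ?thesis
    unfolding Let_def
    using power_kernel_threshold[OF assms(2)] optimal_root_threshold[OF assms(2)]
      kernel_hierarchy_converges[OF assms(2)]
    by (intro conjI allI impI) blast+
qed

end
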